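(* Suppose that $\theta$ is a real-valued cut distance identifying graphon parameter that is continuous with respect to the cut distance. For every $\varepsilon>0$ there exists $b_\varepsilon>0$ such that the following holds. Suppose that $W:\Omega^2\to[0,1]$ is a graphon, $\mathcal P$ is a finite partition of $\Omega$, and $X\subset\Omega$ is a measurable set such that $\left|\int_{X\times X}(W-W^{\Join\mathcal P})\right|>\frac{\varepsilon}{4}$. Define $\mathcal P^*:=\{C\cap X,\,C\setminus X: C\in\mathcal P\}$. Then $\theta(W^{\Join\mathcal P^*})>\theta(W^{\Join\mathcal P})+b_\varepsilon$.
   Context: $\Omega$ is a standard Borel space with an atomless probability measure $\nu$. A graphon is a symmetric measurable function $W:\Omega^2\to[0,1]$ (modulo null sets); $\mathcal W_0$ is the set of graphons. For a measure preserving bijection $\varphi:\Omega\to\Omega$ put $W^\varphi(x,y)=W(\varphi(x),\varphi(y))$. The cut norm is $\|Y\|_\square=\sup_{S,T\subset\Omega}|\int_{S\times T}Y|$ and the cut distance is $\delta_\square(U,W)=\inf_\varphi\|U-W^\varphi\|_\square$ over measure preserving bijections $\varphi$ of $\Omega$. Graphons $\Gamma_n$ converge weak* to $W$ if $\int_{S\times T}\Gamma_n\to\int_{S\times T}W$ for all measurable $S,T\subset\Omega$. The envelope $\langle W\rangle$ is the set of all graphons $U$ for which there are measure preserving bijections $\pi_1,\pi_2,\ldots$ of $\Omega$ with $W^{\pi_n}\to U$ weak*. Write $U\preceq W$ if $\langle U\rangle\subset\langle W\rangle$, and $U\prec W$ if $U\preceq W$ but not $W\preceq U$. A real-valued graphon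 parameter is a function $\theta:\mathcal W_0\to\mathbb R$ with $\theta(W_1)=\theta(W_2)$ whenever $\delta_\square(W_1,W_2)=0$. It is cut distance identifying if $W_1\prec W_2$ implies $\theta(W_1)<\theta(W_2)$. For a finite (measurable) partition $\mathcal P=\{\Omega_1,\dots,\Omega_k\}$ of $\Omega$, $W^{\Join\mathcal P}$ is the graphon that is constant on each $\Omega_i\times\Omega_j$, equal there to the average of $W$ on $\Omega_i\times\Omega_j$ (values on null rectangles are irrelevant). *)

theory Defs
  imports "HOL-Probability.Probability"
begin

(* The measure nu and its underlying space are packed into one measure M: Omega is "space M". *)

definition standard_borel :: "'a measure \<Rightarrow> bool" where
  "standard_borel M \<longleftrightarrow>
     (\<exists>X. completely_metrizable_space X \<and> separable_space X \<and>
          topspace X = space M \<and> sets M = sigma_sets (space M) {U. openin X U})"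

definition atomless :: "'a measure \<Rightarrow> bool" where
  "atomless M \<longleftrightarrow>
     (\<forall>A\<in>sets M. measure M A > 0 \<longrightarrow>
        (\<exists>B\<in>sets M. B \<subseteq> A \<and> 0 < measure M B \<and> measure M B < measure M A))"

(* Representatives rather than classes modulo null sets; every notion below is insensitive to
   changing a graphon on a null set, and to its values outside space M \<times> space M. *)
definition graphons :: "'a measure \<Rightarrow> ('a \<times> 'a \<Rightarrow> real) set" where
  "graphons M = {W. W \<in> borel_measurable (M \<Otimes>\<^sub>M M) \<and>
     (\<forall>x\<in>space M. \<forall>y\<in>space M. W (x, y) = W (y, x) \<and> 0 \<le> W (x, y) \<and> W (x, y) \<le> 1)}"

(* On a standard Borel space the inverse of a measurable bijection is automatically measurable
   (Lusin--Souslin), so the third conjunct is not a restriction there. *)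
definition mp_bijections :: "'a measure \<Rightarrow> ('a \<Rightarrow> 'a) set" where
  "mp_bijections M = {\<phi>. \<phi> \<in> measurable M M \<and> bij_betw \<phi> (space M) (space M) \<and>
     the_inv_into (space M) \<phi> \<in> measurable M M \<and> distr M M \<phi> = M}"

definition pullback :: "('a \<times> 'a \<Rightarrow> real) \<Rightarrow> ('a \<Rightarrow> 'a) \<Rightarrow> 'a \<times> 'a \<Rightarrow> real" where
  "pullback W \<phi> = (\<lambda>(x, y). W (\<phi> x, \<phi> y))"

definition rect_integral ::
    "'a measure \<Rightarrow> 'a set \<Rightarrow> 'a set \<Rightarrow> ('a \<times> 'a \<Rightarrow> real) \<Rightarrow> real" where
  "rect_integral M S T Y = set_lebesgue_integral (M \<Otimes>\<^sub>M M) (S \<times> T) Y"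

definition cut_norm :: "'a measure \<Rightarrow> ('a \<times> 'a \<Rightarrow> real) \<Rightarrow> real" where
  "cut_norm M Y = (SUP (S, T) \<in> sets M \<times> sets M. \<bar>rect_integral M S T Y\<bar>)"

definition cut_dist :: "'a measure \<Rightarrow> ('a \<times> 'a \<Rightarrow> real) \<Rightarrow> ('a \<times> 'a \<Rightarrow> real) \<Rightarrow> real" where
  "cut_dist M U W = (INF \<phi> \<in> mp_bijections M. cut_norm M (\<lambda>z. U z - pullback W \<phi> z))"

definition weak_star_conv ::
    "'a measure \<Rightarrow> (nat \<Rightarrow> 'a \<times> 'a \<Rightarrow> real) \<Rightarrow> ('a \<times> 'a \<Rightarrow> real) \<Rightarrow> bool" where
  "weak_star_conv M \<Gamma> W \<longleftrightarrow>
     (\<forall>S\<in>sets M. \<forall>T\<in>sets M. (\<lambda>n. rect_integral M S T (\<Gamma> n)) \<longlonglongrightarrow> rect_integral M S T W)"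

definition envelope :: "'a measure \<Rightarrow> ('a \<times> 'a \<Rightarrow> real) \<Rightarrow> ('a \<times> 'a \<Rightarrow> real) set" where
  "envelope M W = {U \<in> graphons M. \<exists>\<pi>. (\<forall>n. \<pi> n \<in> mp_bijections M) \<and>
     weak_star_conv M (\<lambda>n. pullback W (\<pi> n)) U}"

definition struct_le :: "'a measure \<Rightarrow> ('a \<times> 'a \<Rightarrow> real) \<Rightarrow> ('a \<times> 'a \<Rightarrow> real) \<Rightarrow> bool" where
  "struct_le M U W \<longleftrightarrow> envelope M U \<subseteq> envelope M W"

definition struct_less :: "'a measure \<Rightarrow> ('a \<times> 'a \<Rightarrow> real) \<Rightarrow> ('a \<times> 'a \<Rightarrow> real) \<Rightarrow> bool" where
  "struct_less M U W \<longleftrightarrow> struct_le M U W \<and> \<not> struct_le M W U"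

definition graphon_parameter :: "'a measure \<Rightarrow> (('a \<times> 'a \<Rightarrow> real) \<Rightarrow> real) \<Rightarrow> bool" where
  "graphon_parameter M \<theta> \<longleftrightarrow>
     (\<forall>W1\<in>graphons M. \<forall>W2\<in>graphons M. cut_dist M W1 W2 = 0 \<longrightarrow> \<theta> W1 = \<theta> W2)"

definition cut_dist_identifying :: "'a measure \<Rightarrow> (('a \<times> 'a \<Rightarrow> real) \<Rightarrow> real) \<Rightarrow> bool" where
  "cut_dist_identifying M \<theta> \<longleftrightarrow>
     (\<forall>W1\<in>graphons M. \<forall>W2\<in>graphons M. struct_less M W1 W2 \<longrightarrow> \<theta> W1 < \<theta> W2)"

definition cut_dist_continuous :: "'a measure \<Rightarrow> (('a \<times> 'a \<Rightarrow> real) \<Rightarrow> real) \<Rightarrow> bool" where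
  "cut_dist_continuous M \<theta> \<longleftrightarrow>
     (\<forall>W\<in>graphons M. \<forall>e>0. \<exists>d>0. \<forall>U\<in>graphons M. cut_dist M W U < d \<longrightarrow> \<bar>\<theta> U - \<theta> W\<bar> < e)"

definition finite_partition :: "'a measure \<Rightarrow> 'a set set \<Rightarrow> bool" where
  "finite_partition M P \<longleftrightarrow> finite P \<and> P \<subseteq> sets M \<and> partition_on (space M) P"

(* On a null rectangle the quotient is 0 / 0 = 0. An empty member of P contributes nothing. *)
definition stepping ::
    "'a measure \<Rightarrow> ('a \<times> 'a \<Rightarrow> real) \<Rightarrow> 'a set set \<Rightarrow> 'a \<times> 'a \<Rightarrow> real" where
  "stepping M W P = (\<lambda>z. \<Sum>C\<in>P. \<Sum>D\<in>P.
     rect_integral M C D W / (measure M C * measure M D) * indicator (C \<times> D) z)"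

(* May contain the empty set, which is harmless for stepping. *)
definition split_by :: "'a set set \<Rightarrow> 'a set \<Rightarrow> 'a set set" where
  "split_by P X = (\<Union>C\<in>P. {C \<inter> X, C - X})"

end

theory Submission
  imports Defs
begin

text \<open>Suppose the increments have no positive lower bound, so that along some sequence averaging over
  \<open>P\<^sub>n\<close> instead of \<open>P\<^sub>n\<^sup>*\<close> decreases the parameter by at most \<open>1/n\<close>. By compactness in the cut
  distance, the averages \<open>V\<^sub>n\<close> over \<open>P\<^sub>n\<^sup>*\<close> and \<open>U\<^sub>n\<close> over \<open>P\<^sub>n\<close> converge, up to measure preserving
  bijections, to graphons \<open>V\<close> and \<open>U\<close>, and continuity gives \<open>\<theta> V \<le> \<theta> U\<close>. As \<open>U\<^sub>n\<close> is a conditional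
  expectation of \<open>V\<^sub>n\<close>, and conditional expectations contract the cut norm and stay in the envelope,
  \<open>U\<close> lies in the envelope of \<open>V\<close>. If \<open>V\<close> were in the envelope of \<open>U\<close>, both would have the same
  \<open>L\<^sup>2\<close> norm; weak* convergence without loss of norm is \<open>L\<^sup>2\<close> convergence, and this makes
  \<open>V\<^sub>n - U\<^sub>n\<close> small in cut norm, contrary to the integral over \<open>X\<^sub>n \<times> X\<^sub>n\<close> being larger than \<open>\<epsilon>/4\<close>.
  So \<open>U \<prec> V\<close>, and \<open>\<theta> U < \<theta> V\<close> is a contradiction.\<close>

section \<open>Coding standard Borel spaces by real numbers\<close>

text \<open>The partitions \<open>P\<^sub>n\<close> may have unboundedly many cells, so no
  finite-dimensional compactness applies to them and they have no limit. What survives the limit is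
  that averaging contracts the cut norm: therefore \<open>V\<close> itself can be averaged over
  transported copies of \<open>P\<^sub>n\<close>. Two topologies are played against each other. The
  parameter is continuous for the cut distance only, so limits must be taken there and weak*
  compactness alone would not do; the strictness of \<open>U \<prec> V\<close> needs a quantity that
  weak* limits can only decrease, the L2 norm. Compactness in the cut distance rests on a regularity
  lemma whose dyadic level depends on the accuracy alone: each graphon is first rearranged so that
  witnesses of irregularity become, up to a small error, unions of dyadic cells. Rearrangements must
  be genuine bijections of \<open>\<Omega>\<close>, so constructions that work almost everywhere
  have to be repaired on null sets; hence the real code and the uniform coordinate at the
  beginning.\<close>

primrec ternary_tail :: "real \<Rightarrow> nat \<Rightarrow> real" where
  "ternary_tail y 0 = y"
| "ternary_tail y (Suc m) = 3 * ternary_tail y m - (if ternary_tail y m \<ge> 1/2 then 2 else 0)"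

lemma measurable_ternary_tail [measurable]: "(\<lambda>y. ternary_tail y m) \<in> borel_measurable borel"
  by (induction m) simp_all

text \<open>The usual map onto the Cantor set. Digits 0 and 2 in base 3 make it injective, whereas
  binary expansions are ambiguous at dyadic rationals.\<close>

definition cantor_code :: "(nat \<Rightarrow> bool) \<Rightarrow> real" where
  "cantor_code b = (\<Sum>i. 2 * of_bool (b i) / 3 ^ Suc i)"

lemma summable_cantor_code: "summable (\<lambda>i. 2 * of_bool (b i) / 3 ^ Suc i :: real)"
proof (rule summable_comparison_test')
  show "summable (\<lambda>i. 2 / 3 * (1 / 3) ^ i :: real)"
    by (intro summable_mult summable_geometric) simp
  show "norm (2 * of_bool (b i) / 3 ^ Suc i :: real) \<le> 2 / 3 * (1 / 3) ^ i" for i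
    by (simp add: field_simps)
qed

lemma cantor_code_bounds: "0 \<le> cantor_code b" "cantor_code b \<le> 1"
proof -
  show "0 \<le> cantor_code b"
    unfolding cantor_code_def by (intro suminf_nonneg summable_cantor_code) simp
  have "cantor_code b \<le> (\<Sum>i. 2 / 3 * (1 / 3) ^ i :: real)"
    unfolding cantor_code_def
    by (intro suminf_le summable_cantor_code summable_mult summable_geometric) (auto simp: field_simps)
  also have "\<dots> = 1"
    by (subst suminf_mult) (auto simp: suminf_geometric intro!: summable_geometric)
  finally show "cantor_code b \<le> 1" .
qed

lemma cantor_code_shift: "cantor_code b = 2 * of_bool (b 0) / 3 + cantor_code (\<lambda>i. b (Suc i)) / 3"
proof -
  have "cantor_code b = 2 * of_bool (b 0) / 3 + (\<Sum>i. 2 * of_bool (b (Suc i)) / 3 ^ Suc (Suc i))"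
    unfolding cantor_code_def
    using suminf_split_initial_segment[OF summable_cantor_code[of b], of 1] by simp
  also have "(\<Sum>i. 2 * of_bool (b (Suc i)) / 3 ^ Suc (Suc i) :: real) = cantor_code (\<lambda>i. b (Suc i)) / 3"
    unfolding cantor_code_def
    by (subst suminf_divide[OF summable_cantor_code, symmetric]) (simp add: field_simps)
  finally show ?thesis .
qed

lemma ternary_tail_cantor_code: "ternary_tail (cantor_code b) m = cantor_code (\<lambda>i. b (m + i))"
proof (induction m)
  case (Suc m)
  have "cantor_code (\<lambda>i. b (m + i)) = 2 * of_bool (b m) / 3 + cantor_code (\<lambda>i. b (Suc m + i)) / 3"
    using cantor_code_shift[of "\<lambda>i. b (m + i)"] by simp
  then show ?case
    using Suc cantor_code_bounds[of "\<lambda>i. b (Suc m + i)"] by (auto split: if_splits)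
qed simp

text \<open>\<open>ternary_tail\<close> acts as the shift on the Cantor set. A leading digit 0 keeps
  the value at most 1/3, a leading 2 makes it at least 2/3, so the threshold 1/2 in the gap reads
  off the digit.\<close>

lemma cantor_decode: "ternary_tail (cantor_code b) m \<ge> 1/2 \<longleftrightarrow> b m"
  using cantor_code_shift[of "\<lambda>i. b (m + i)"] cantor_code_bounds[of "\<lambda>i. b (Suc m + i)"]
  by (auto simp: ternary_tail_cantor_code)

lemma measurable_cantor_code:
  assumes "\<And>i. Measurable.pred M (\<lambda>x. b x i)"
  shows "(\<lambda>x. cantor_code (b x)) \<in> borel_measurable M"
proof -
  note [measurable] = assms
  show ?thesis unfolding cantor_code_def of_bool_def by measurable
qed

text \<open>The point \<open>x\<close> is coded by the sequence of indices of points of a countable dense set that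
  approximate it; decoding takes the limit, which exists by completeness.\<close>

lemma standard_borel_real_code:
  assumes sb: "standard_borel M" and ne: "space M \<noteq> {}"
  shows "\<exists>c\<in>borel_measurable M. \<exists>g\<in>measurable borel M. \<forall>x\<in>space M. g (c x :: real) = (x :: 'a)"
proof -
  obtain X where X: "completely_metrizable_space X" "separable_space X" "topspace X = space M"
      "sets M = sigma_sets (space M) {U. openin X U}"
    using sb by (auto simp: standard_borel_def)
  obtain S d where "Metric_space S d" and comp: "Metric_space.mcomplete S d"
      and Xm: "X = Metric_space.mtopology S d"
    using X(1) unfolding completely_metrizable_space_def by blast
  interpret Metric_space S d by fact
  have S: "S = space M" using X(3) Xm by simp
  obtain A where A: "countable A" "A \<subseteq> space M" "X closure_of A = space M"
    using X(2,3) unfolding separable_space_def by auto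
  have "A \<noteq> {}" using A(3) ne by auto
  define a where "a = from_nat_into A"
  have aS: "a n \<in> S" for n
    using A(2) S from_nat_into[OF \<open>A \<noteq> {}\<close>] by (auto simp: a_def)
  have dense: "\<exists>n. d x (a n) < r" if "x \<in> S" "r > 0" for x r
  proof -
    have "x \<in> mtopology closure_of A" using that A(3) S Xm by simp
    then obtain y where "y \<in> A" "y \<in> mball x r"
      using \<open>r > 0\<close> unfolding metric_closure_of by blast
    moreover obtain n where "a n = y"
      using from_nat_into_surj[OF A(1) \<open>y \<in> A\<close>] by (auto simp: a_def)
    ultimately show ?thesis by auto
  qed
  have ball_sets: "mball x r \<in> sets M" if "x \<in> S" for x r
    unfolding X(4) using Xm by (auto intro: sigma_sets.Basic)
  have dist_meas [measurable]: "(\<lambda>x. d x (a n)) \<in> borel_measurable M" for n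
  proof (rule borel_measurableI_less)
    fix r
    have "{x \<in> space M. d x (a n) < r} = mball (a n) r"
      unfolding S[symmetric] using aS commute by auto
    then show "{x \<in> space M. d x (a n) < r} \<in> sets M" using ball_sets[OF aS] by simp
  qed
  \<comment> \<open>Taking the least index makes the choice of an approximating point
    measurable.\<close>
  define idx where "idx k x = (LEAST n. d x (a n) < (1/2)^k)" for k :: nat and x
  have idx: "d x (a (idx k x)) < (1/2)^k" if "x \<in> S" for k x
    unfolding idx_def by (rule LeastI_ex) (rule dense[OF that], simp)
  have [measurable]: "idx k \<in> measurable M (count_space UNIV)" for k
    unfolding idx_def[abs_def] by measurable
  \<comment> \<open>Each index is stored in unary, one bit for every pair \<open>(k, n)\<close>, so
    that a single 0-1 sequence holds all of them.\<close>
  define b where "b x i = (case prod_decode i of (k, n) \<Rightarrow> idx k x = n)" for x i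
  define c where "c x = cantor_code (b x)" for x
  have c_meas: "c \<in> borel_measurable M"
    unfolding c_def[abs_def] by (rule measurable_cantor_code) (simp add: b_def split_beta)
  define s where "s k y = (LEAST n. ternary_tail y (prod_encode (k, n)) \<ge> 1/2)" for k y
  have [measurable]: "s k \<in> measurable borel (count_space UNIV)" for k
    unfolding s_def[abs_def] by measurable
  have sc: "s k (c x) = idx k x" for k x
    unfolding s_def c_def cantor_decode by (auto simp: b_def intro!: Least_equality)
  \<comment> \<open>Codes of points satisfy this by the triangle inequality through
    \<open>x\<close>. It is a Borel condition on \<open>y\<close> that forces the Cauchy property,
    so the decoder can be defined on all reals, with value \<open>a 0\<close> where it
    fails.\<close>
  define G where "G y \<longleftrightarrow> (\<forall>k l. d (a (s k y)) (a (s l y)) \<le> (1/2)^k + (1/2)^l)" for y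
  have [measurable]: "Measurable.pred borel G"
    unfolding G_def[abs_def] by measurable
  have lim_ex: "\<exists>x. limitin mtopology (\<lambda>k. a (s k y)) x sequentially" if "G y" for y
  proof -
    have "MCauchy (\<lambda>k. a (s k y))"
      unfolding MCauchy_def
    proof (intro conjI allI impI)
      show "range (\<lambda>k. a (s k y)) \<subseteq> S" using aS by auto
      fix e :: real assume "e > 0"
      then obtain K where K: "(1/2)^K < e / 2"
        using real_arch_pow_inv[of "e/2" "1/2"] by auto
      have "d (a (s k y)) (a (s l y)) < e" if "K \<le> k" "K \<le> l" for k l
      proof -
        have "(1/2)^k \<le> (1/2::real)^K" "(1/2)^l \<le> (1/2::real)^K"
          using that by (auto intro: power_decreasing)
        then show ?thesis using K \<open>G y\<close> unfolding G_def
          by (smt (verit) field_sum_of_halves)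
      qed
      then show "\<exists>N. \<forall>n n'. N \<le> n \<longrightarrow> N \<le> n' \<longrightarrow> d (a (s n y)) (a (s n' y)) < e" by blast
    qed
    then show ?thesis using comp unfolding mcomplete_def by blast
  qed
  define g where "g y = (if G y then SOME x. limitin mtopology (\<lambda>k. a (s k y)) x sequentially
    else a 0)" for y
  have g_lim: "limitin mtopology (\<lambda>k. a (s k y)) (g y) sequentially" if "G y" for y
    using someI_ex[OF lim_ex[OF that]] that by (simp add: g_def)
  have gS: "g y \<in> S" for y
    using g_lim[of y] aS by (cases "G y") (auto simp: g_def limitin_metric)
  have g_dist_lim: "(\<lambda>k. d (a (s k y)) (a n)) \<longlonglongrightarrow> d (g y) (a n)" if "G y" for y n
  proof (rule metric_tendsto_imp_tendsto[where f = "\<lambda>k. d (a (s k y)) (g y)" and a = 0])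
    show "(\<lambda>k. d (a (s k y)) (g y)) \<longlonglongrightarrow> 0"
      using g_lim[OF that] by (simp add: limitin_metric_dist_null)
    show "\<forall>\<^sub>F k in sequentially. dist (d (a (s k y)) (a n)) (d (g y) (a n)) \<le> dist (d (a (s k y)) (g y)) 0"
      using mdist_reverse_triangle aS gS
      by (intro always_eventually allI)
        (smt (verit) commute dist_real_def nonneg triangle)
  qed
  \<comment> \<open>Limits in the space are replaced by limits of real functions: \<open>g\<close>
    is controlled through its distances to the dense points.\<close>
  have g_dist_meas: "(\<lambda>y. d (g y) (a n)) \<in> borel_measurable borel" for n
  proof -
    have "d (g y) (a n) = (if G y then lim (\<lambda>k. d (a (s k y)) (a n)) else d (a 0) (a n))" for y
      using limI[OF g_dist_lim] by (auto simp: g_def)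
    moreover have [measurable]: "(\<lambda>y. d (a (s k y)) (a n)) \<in> borel_measurable borel" for k
      by (rule measurable_compose[where N = "count_space UNIV" and g = "\<lambda>j. d (a j) (a n)"]) auto
    have "(\<lambda>y. if G y then lim (\<lambda>k. d (a (s k y)) (a n)) else d (a 0) (a n)) \<in> borel_measurable borel"
      by (intro measurable_If borel_measurable_lim_metric) measurable
    ultimately show ?thesis by simp
  qed
  have g_meas: "g \<in> measurable borel M"
  proof (rule measurable_sigma_sets[OF X(4)])
    show "{U. openin X U} \<subseteq> Pow (space M)" using openin_subset X(3) by auto
    show "g \<in> space borel \<rightarrow> space M" using gS S by auto
    fix U assume "U \<in> {U. openin X U}"
    then have U: "openin mtopology U" using Xm by auto
    \<comment> \<open>Balls around dense points with radii \<open>(1/2)^m\<close> form a countable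
      base.\<close>
    have "g y \<in> U \<longleftrightarrow> (\<exists>n m. mball (a n) ((1/2)^m) \<subseteq> U \<and> d (g y) (a n) < (1/2)^m)" for y
    proof
      assume "g y \<in> U"
      then obtain r where r: "r > 0" "mball (g y) r \<subseteq> U" using U by (auto simp: openin_mtopology)
      obtain m where m: "(1/2)^m < r/2" using real_arch_pow_inv[of "r/2" "1/2"] r by auto
      obtain n where n: "d (g y) (a n) < (1/2)^m" using dense[OF gS, of "(1/2)^m"] by auto
      have "mball (a n) ((1/2)^m) \<subseteq> mball (g y) r"
      proof
        fix z assume "z \<in> mball (a n) ((1/2)^m)"
        then have z: "z \<in> S" "d (a n) z < (1/2)^m" by auto
        then have "d (g y) z < r" using triangle[OF gS[of y] aS[of n] z(1)] n m
          by (smt (verit) field_sum_of_halves)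
        then show "z \<in> mball (g y) r" using z gS by auto
      qed
      then show "\<exists>n m. mball (a n) ((1/2)^m) \<subseteq> U \<and> d (g y) (a n) < (1/2)^m"
        using r n by blast
    next
      assume "\<exists>n m. mball (a n) ((1/2)^m) \<subseteq> U \<and> d (g y) (a n) < (1/2)^m"
      then show "g y \<in> U" using aS gS commute by (auto simp: subset_iff)
    qed
    then have "g -` U \<inter> space borel
        = {y \<in> space borel. \<exists>n m. mball (a n) ((1/2)^m) \<subseteq> U \<and> d (g y) (a n) < (1/2)^m}"
      by auto
    also have "\<dots> \<in> sets borel" using g_dist_meas by measurable
    finally show "g -` U \<inter> space borel \<in> sets borel" .
  qed
  have gc: "g (c x) = x" if "x \<in> space M" for x
  proof -
    have xS: "x \<in> S" using that S by simp
    have "G (c x)"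
      unfolding G_def sc
    proof (intro allI)
      fix k l
      show "d (a (idx k x)) (a (idx l x)) \<le> (1/2)^k + (1/2)^l"
        using idx[OF xS, of k] idx[OF xS, of l] triangle[OF aS xS aS, of "idx k x" "idx l x"]
          commute[of x "a (idx k x)"] by linarith
    qed
    have "limitin mtopology (\<lambda>k. a (idx k x)) x sequentially"
      unfolding limitin_metric_dist_null
    proof (intro conjI)
      show "(\<lambda>k. d (a (idx k x)) x) \<longlonglongrightarrow> 0"
      proof (rule tendsto_sandwich[where f = "\<lambda>_. 0" and h = "\<lambda>k. (1/2)^k"])
        show "(\<lambda>k. (1/2::real)^k) \<longlonglongrightarrow> 0" by (intro LIMSEQ_realpow_zero) auto
        show "\<forall>\<^sub>F k in sequentially. d (a (idx k x)) x \<le> (1/2)^k"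
          using less_imp_le[OF idx[OF xS]] by (simp add: commute)
      qed auto
    qed (use xS aS in auto)
    moreover have "limitin mtopology (\<lambda>k. a (idx k x)) (g (c x)) sequentially"
      using g_lim[OF \<open>G (c x)\<close>] by (simp add: sc)
    ultimately show ?thesis
      using limitin_metric_unique trivial_limit_sequentially by metis
  qed
  show ?thesis by (intro bexI[OF _ c_meas] bexI[OF _ g_meas] ballI gc)
qed

section \<open>Measure preserving bijections\<close>

text \<open>The standard Borel structure enters as a measurable real code with a measurable decoder.
  Atomlessness enters as the vanishing of point masses, the form that makes the law of the code
  continuous.\<close>

locale atomless_space = prob_space M for M :: "'a measure" +
  fixes c :: "'a \<Rightarrow> real" and g :: "real \<Rightarrow> 'a"
  assumes c_meas [measurable]: "c \<in> borel_measurable M"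
    and g_meas [measurable]: "g \<in> measurable borel M"
    and g_c [simp]: "x \<in> space M \<Longrightarrow> g (c x) = x"
    and atom_null: "x \<in> space M \<Longrightarrow> measure M {x} = 0"

abbreviation unit_unif :: "real measure" where
  "unit_unif \<equiv> distr (restrict_space lborel {0<..<1}) borel (\<lambda>x. x)"

text \<open>\<open>q\<close> is the quantile function, which pushes the uniform law to
  \<open>\<mu>\<close>. Without atoms the distribution function is continuous, which gives
  \<open>cdf \<mu> (q u) = u\<close>, so the two maps are inverse to each other almost
  everywhere.\<close>

lemma uniform_transform_atomless:
  assumes "real_distribution \<mu>" and atoms: "\<And>s. measure \<mu> {s} = 0"
  obtains q where "q \<in> borel_measurable borel" "distr unit_unif borel q = \<mu>"
    "distr \<mu> borel (cdf \<mu>) = unit_unif" "AE s in \<mu>. q (cdf \<mu> s) = s"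
proof -
  interpret real_distribution \<mu> by fact
  interpret cdf_distribution \<mu> by standard
  define U where "U = restrict_space lborel {0<..<1::real}"
  define q where "q u = (if 0 < u \<and> u < 1 then I u else 0)" for u
  have q_meas [measurable]: "q \<in> borel_measurable borel"
  proof -
    have "(\<lambda>u. if u \<in> {0<..<1} then I u else 0) \<in> borel_measurable borel"
      by (subst measurable_restrict_space_iff[symmetric]) (auto intro: measurable_CI)
    then show ?thesis by (simp add: q_def[abs_def])
  qed
  have U_meas [measurable]: "(\<lambda>x. x) \<in> borel_measurable U"
    unfolding U_def by (simp add: measurable_restrict_space1)
  have q_eq: "q u = I u" if "u \<in> space U" for u
    using that by (auto simp: U_def space_restrict_space q_def)
  have q_dist: "distr U borel q = \<mu>"
    using distr_I_eq_M unfolding U_def[symmetric]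
    by (metis (mono_tags, lifting) distr_cong q_eq)
  have cdf_q: "cdf \<mu> (q u) = u" if "u \<in> space U" for u
  proof -
    have u: "0 < u" "u < 1" using that by (auto simp: U_def space_restrict_space)
    have *: "u \<le> cdf \<mu> x \<longleftrightarrow> I u \<le> x" for x using pseudoinverse[OF u] .
    have "isCont (cdf \<mu>) (I u)" using isCont_cdf atoms by simp
    then have "((cdf \<mu>) \<longlongrightarrow> cdf \<mu> (I u)) (at_left (I u))"
      unfolding isCont_def by (rule filterlim_mono) (auto intro: at_le)
    \<comment> \<open>To the left of \<open>I u\<close> the pseudoinverse property keeps the
      distribution function at most \<open>u\<close>; continuity carries this bound to
      \<open>I u\<close>.\<close>
    moreover have "\<forall>\<^sub>F x in at_left (I u). cdf \<mu> x \<le> u"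
    proof (rule eventually_at_leftI)
      show "I u - 1 < I u" by simp
      show "cdf \<mu> x \<le> u" if "x \<in> {I u - 1<..<I u}" for x
        using that *[of x] by (meson greaterThanLessThan_iff linorder_not_le order_less_imp_le)
    qed
    ultimately have "cdf \<mu> (I u) \<le> u"
      by (rule tendsto_upperbound) simp
    moreover have "u \<le> cdf \<mu> (I u)" using *[of "I u"] by blast
    ultimately show ?thesis unfolding q_eq[OF that] by (rule antisym)
  qed
  show ?thesis
  proof (rule that[OF q_meas])
    show "distr unit_unif borel q = \<mu>"
      unfolding U_def[symmetric] by (subst distr_distr) (auto simp: comp_def q_dist)
    have "distr \<mu> borel (cdf \<mu>) = distr U borel (cdf \<mu> \<circ> q)"
      by (subst q_dist[symmetric], subst distr_distr) auto
    also have "\<dots> = distr U borel (\<lambda>x. x)"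
      by (rule distr_cong) (auto simp: cdf_q)
    finally show "distr \<mu> borel (cdf \<mu>) = unit_unif" by (simp add: U_def)
    have "AE s in distr U borel q. q (cdf \<mu> s) = s"
      by (subst AE_distr_iff) (auto simp: cdf_q measurable_restrict_space1 U_def)
    then show "AE s in \<mu>. q (cdf \<mu> s) = s" unfolding q_dist .
  qed
qed

context atomless_space begin

text \<open>Condition on \<open>A\<close> and compose the code with the distribution function of its
  conditional law: every set of positive measure is, up to null sets, a copy of the unit
  interval.\<close>

lemma uniform_coordinate:
  assumes A [measurable]: "A \<in> events" and pos: "prob A > 0"
  obtains h e where "h \<in> borel_measurable M" "e \<in> measurable borel M"
    "distr (uniform_measure M A) borel h = unit_unif" "distr unit_unif M e = uniform_measure M A"
    "AE x in uniform_measure M A. e (h x) = x"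
proof -
  define MA where "MA = uniform_measure M A"
  have eA: "emeasure M A \<noteq> 0" "emeasure M A \<noteq> \<infinity>"
    using pos by (auto simp: emeasure_eq_measure)
  have [measurable_cong]: "sets MA = sets M" by (simp add: MA_def)
  have spMA: "space MA = space M" by (simp add: MA_def)
  interpret MA: prob_space MA
    unfolding MA_def by (rule prob_space_uniform_measure[OF eA])
  define \<mu> where "\<mu> = distr MA borel c"
  have rd: "real_distribution \<mu>"
    unfolding \<mu>_def by simp
  have atoms: "measure \<mu> {s} = 0" for s
  proof -
    \<comment> \<open>The code is injective, so its fibres are at most single points and the
      conditional law has no atoms.\<close>
    have "c -` {s} \<inter> space M \<subseteq> {g s} \<inter> space M" by auto
    then consider "c -` {s} \<inter> space M = {}" | x where "x \<in> space M" "c -` {s} \<inter> space M = {x}"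
      by (cases "g s \<in> space M") (auto simp: subset_singleton_iff)
    then have 0: "prob (c -` {s} \<inter> space M) = 0" by cases (auto simp: atom_null)
    have "prob (A \<inter> (c -` {s} \<inter> space M)) \<le> prob (c -` {s} \<inter> space M)"
      by (rule finite_measure_mono) auto
    then have "prob (A \<inter> (c -` {s} \<inter> space M)) = 0"
      using 0 by (simp add: measure_le_0_iff)
    moreover have "measure \<mu> {s} = measure MA (c -` {s} \<inter> space M)"
      by (simp add: \<mu>_def measure_distr spMA)
    ultimately show ?thesis
      by (simp add: MA_def measure_uniform_measure eA)
  qed
  obtain q where q [measurable]: "q \<in> borel_measurable borel" and qd: "distr unit_unif borel q = \<mu>"
    and cd: "distr \<mu> borel (cdf \<mu>) = unit_unif" and qc: "AE s in \<mu>. q (cdf \<mu> s) = s"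
    using uniform_transform_atomless[OF rd atoms] by blast
  interpret \<mu>: real_distribution \<mu> by fact
  have [measurable]: "cdf \<mu> \<in> borel_measurable borel"
    by (intro borel_measurable_mono monoI \<mu>.cdf_nondecreasing)
  show ?thesis
  proof (rule that[of "\<lambda>x. cdf \<mu> (c x)" "\<lambda>u. g (q u)"])
    show "distr (uniform_measure M A) borel (\<lambda>x. cdf \<mu> (c x)) = unit_unif"
      unfolding MA_def[symmetric] cd[symmetric] by (subst (2) \<mu>_def, subst distr_distr) (auto simp: comp_def)
    have "distr unit_unif M (\<lambda>u. g (q u)) = distr (distr unit_unif borel q) M g"
      by (subst distr_distr[where f = q]) (auto simp: comp_def)
    also have "\<dots> = distr MA M (\<lambda>x. g (c x))"
      unfolding qd by (simp add: \<mu>_def distr_distr comp_def)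
    also have "\<dots> = distr MA M (\<lambda>x. x)"
      by (rule distr_cong) (auto simp: spMA)
    also have "\<dots> = MA" by (rule distr_id2) (simp add: MA_def)
    finally show "distr unit_unif M (\<lambda>u. g (q u)) = uniform_measure M A" by (simp add: MA_def)
    have "AE x in MA. q (cdf \<mu> (c x)) = c x"
      using qc unfolding \<mu>_def by (subst (asm) AE_distr_iff) (auto simp: \<mu>_def[symmetric])
    moreover have "AE x in MA. x \<in> space M" using AE_space[of MA] by (simp add: spMA)
    ultimately show "AE x in uniform_measure M A. g (q (cdf \<mu> (c x))) = x"
      unfolding MA_def[symmetric] by eventually_elim simp
  qed measurable
qed

end

section \<open>Inverses, composition and swaps of measure preserving bijections\<close>

lemma mp_id: "(\<lambda>x. x) \<in> mp_bijections M"
proof -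
  have "the_inv_into (space M) (\<lambda>x. x) x = x" if "x \<in> space M" for x
    using that by (simp add: the_inv_into_f_eq)
  then have "the_inv_into (space M) (\<lambda>x. x) \<in> measurable M M"
    by (simp cong: measurable_cong)
  then show ?thesis by (simp add: mp_bijections_def bij_betw_def distr_id2)
qed

lemma mp_bijectionsI:
  assumes [measurable]: "\<phi> \<in> measurable M M" "\<psi> \<in> measurable M M"
    and inv: "\<And>x. x \<in> space M \<Longrightarrow> \<psi> (\<phi> x) = x" "\<And>x. x \<in> space M \<Longrightarrow> \<phi> (\<psi> x) = x"
    and d: "distr M M \<phi> = M"
  shows "\<phi> \<in> mp_bijections M"
proof -
  have bij: "bij_betw \<phi> (space M) (space M)"
    by (rule bij_betw_byWitness[where f' = \<psi>]) (use inv assms(1,2)[THEN measurable_space] in auto)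
  have "the_inv_into (space M) \<phi> x = \<psi> x" if "x \<in> space M" for x
    using that inv assms(2)[THEN measurable_space] bij_betw_imp_inj_on[OF bij]
    by (intro the_inv_into_f_eq) auto
  then have "the_inv_into (space M) \<phi> \<in> measurable M M"
    using assms(2) by (simp cong: measurable_cong)
  then show ?thesis using bij d assms(1) by (simp add: mp_bijections_def)
qed

lemma mp_measurable [measurable_dest]: "\<phi> \<in> mp_bijections M \<Longrightarrow> \<phi> \<in> measurable M M"
  by (simp add: mp_bijections_def)

lemma mp_obtain_inverse:
  assumes "\<phi> \<in> mp_bijections M"
  obtains \<psi> where "\<psi> \<in> mp_bijections M" "\<And>x. x \<in> space M \<Longrightarrow> \<psi> (\<phi> x) = x"
    "\<And>x. x \<in> space M \<Longrightarrow> \<phi> (\<psi> x) = x"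
proof -
  define \<psi> where "\<psi> = the_inv_into (space M) \<phi>"
  have [measurable]: "\<phi> \<in> measurable M M" "\<psi> \<in> measurable M M"
    and bij: "bij_betw \<phi> (space M) (space M)" and d: "distr M M \<phi> = M"
    using assms by (auto simp: mp_bijections_def \<psi>_def)
  have 1: "\<psi> (\<phi> x) = x" "\<phi> (\<psi> x) = x" if "x \<in> space M" for x
    using that bij by (auto simp: \<psi>_def bij_betw_def the_inv_into_f_f f_the_inv_into_f)
  have "distr M M \<psi> = distr (distr M M \<phi>) M \<psi>" by (simp add: d)
  also have "\<dots> = distr M M (\<psi> \<circ> \<phi>)"
    by (rule distr_distr) simp_all
  also have "\<dots> = distr M M (\<lambda>x. x)"
    by (rule distr_cong) (simp_all add: 1)
  finally have "distr M M \<psi> = M" by (simp add: distr_id2)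
  then have "\<psi> \<in> mp_bijections M" by (intro mp_bijectionsI[where \<psi> = \<phi>]) (auto simp: 1)
  then show ?thesis using that 1 by blast
qed

lemma mp_comp:
  assumes "\<phi> \<in> mp_bijections M" "\<psi> \<in> mp_bijections M"
  shows "(\<lambda>x. \<phi> (\<psi> x)) \<in> mp_bijections M"
proof -
  note [measurable] = assms[THEN mp_measurable]
  obtain \<phi>' where \<phi>': "\<phi>' \<in> mp_bijections M" "\<And>x. x \<in> space M \<Longrightarrow> \<phi>' (\<phi> x) = x"
    "\<And>x. x \<in> space M \<Longrightarrow> \<phi> (\<phi>' x) = x" using mp_obtain_inverse[OF assms(1)] by blast
  obtain \<psi>' where \<psi>': "\<psi>' \<in> mp_bijections M" "\<And>x. x \<in> space M \<Longrightarrow> \<psi>' (\<psi> x) = x"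
    "\<And>x. x \<in> space M \<Longrightarrow> \<psi> (\<psi>' x) = x" using mp_obtain_inverse[OF assms(2)] by blast
  note [measurable] = \<phi>'(1)[THEN mp_measurable] \<psi>'(1)[THEN mp_measurable]
  have sp: "\<psi> x \<in> space M" "\<phi>' x \<in> space M" if "x \<in> space M" for x
    using that by (auto intro: measurable_space[OF mp_measurable] assms \<phi>' \<psi>')
  have d: "distr M M \<phi> = M" "distr M M \<psi> = M" using assms by (auto simp: mp_bijections_def)
  have "distr M M (\<lambda>x. \<phi> (\<psi> x)) = distr (distr M M \<psi>) M \<phi>"
    by (subst distr_distr) (auto simp: comp_def)
  also have "\<dots> = M" by (simp add: d)
  finally show ?thesis
    by (intro mp_bijectionsI[where \<psi> = "\<lambda>x. \<psi>' (\<phi>' x)"]) (auto simp: sp \<phi>'(2,3) \<psi>'(2,3))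
qed

lemma mp_vimage_measure:
  assumes "\<phi> \<in> mp_bijections M" "A \<in> sets M"
  shows "measure M (\<phi> -` A \<inter> space M) = measure M A"
  using assms measure_distr[of \<phi> M M A] by (simp add: mp_bijections_def)

context atomless_space begin

text \<open>Uniform coordinates identify \<open>A\<close> and \<open>B\<close> with one interval,
  and crossing over through them swaps the sets. The resulting \<open>f\<close> is an involution
  only almost everywhere; it is used on the set \<open>Z\<close> where it behaves as one, and the
  identity on the rest turns it into a genuine bijection.\<close>

lemma mp_swap:
  assumes A [measurable]: "A \<in> events" and B [measurable]: "B \<in> events"
    and disj: "A \<inter> B = {}" and eq: "prob A = prob B"
  obtains \<pi> where "\<pi> \<in> mp_bijections M" "\<And>x. x \<notin> A \<union> B \<Longrightarrow> \<pi> x = x"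
    "\<And>x. x \<in> A \<union> B \<Longrightarrow> \<pi> x \<in> A \<union> B"
    "AE x in M. \<pi> x \<in> B \<longleftrightarrow> x \<in> A"
proof (cases "prob A = 0")
  case True
  have "AE x in M. x \<notin> A" "AE x in M. x \<notin> B"
    using True eq by (auto simp: prob_eq_0[symmetric])
  then have "AE x in M. x \<in> B \<longleftrightarrow> x \<in> A" by eventually_elim simp
  then show ?thesis using that[OF mp_id] by auto
next
  case False
  then have pos: "prob A > 0" "prob B > 0" using eq by (auto simp: zero_less_measure_iff)
  have e0: "emeasure M A \<noteq> 0" "emeasure M A < \<infinity>" "emeasure M B \<noteq> 0" "emeasure M B < \<infinity>"
    using pos by (auto simp: emeasure_eq_measure)
  obtain hA eA where [measurable]: "hA \<in> borel_measurable M" "eA \<in> measurable borel M"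
    and dA: "distr (uniform_measure M A) borel hA = unit_unif" "distr unit_unif M eA = uniform_measure M A"
    and iA: "AE x in uniform_measure M A. eA (hA x) = x"
    using uniform_coordinate[OF A pos(1)] by blast
  obtain hB eB where [measurable]: "hB \<in> borel_measurable M" "eB \<in> measurable borel M"
    and dB: "distr (uniform_measure M B) borel hB = unit_unif" "distr unit_unif M eB = uniform_measure M B"
    and iB: "AE x in uniform_measure M B. eB (hB x) = x"
    using uniform_coordinate[OF B pos(2)] by blast
  have transport: "distr (uniform_measure M A) M (\<lambda>x. eB (hA x)) = uniform_measure M B"
      "distr (uniform_measure M B) M (\<lambda>x. eA (hB x)) = uniform_measure M A"
  proof -
    have "distr (uniform_measure M A) M (\<lambda>x. eB (hA x)) = distr (distr (uniform_measure M A) borel hA) M eB"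
      by (subst distr_distr) (auto simp: comp_def)
    then show "distr (uniform_measure M A) M (\<lambda>x. eB (hA x)) = uniform_measure M B"
      by (simp only: dA(1) dB(2))
    have "distr (uniform_measure M B) M (\<lambda>x. eA (hB x)) = distr (distr (uniform_measure M B) borel hB) M eA"
      by (subst distr_distr) (auto simp: comp_def)
    then show "distr (uniform_measure M B) M (\<lambda>x. eA (hB x)) = uniform_measure M A"
      by (simp only: dB(1) dA(2))
  qed
  have mem: "AE x in uniform_measure M A. x \<in> A" "AE x in uniform_measure M B. x \<in> B"
    by (rule AE_uniform_measureI; simp)+
  define f where "f x = (if x \<in> A then eB (hA x) else if x \<in> B then eA (hB x) else x)" for x
  have [measurable]: "f \<in> measurable M M" unfolding f_def[abs_def] by measurable
  have fA: "AE x in M. x \<in> A \<longrightarrow> f x \<in> B \<and> f (f x) = x"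
  proof -
    have "AE x in uniform_measure M B. x \<in> B \<and> eB (hB x) = x"
      using iB mem(2) by eventually_elim simp
    then have 1: "AE x in uniform_measure M A. eB (hA x) \<in> B \<and> eB (hB (eB (hA x))) = eB (hA x)"
      unfolding transport(1)[symmetric] by (rule AE_distrD[rotated]) simp
    \<comment> \<open>The law of \<open>hB\<close> is uniform, so an identity that holds at almost
      all values \<open>hB x\<close> holds for almost all \<open>u\<close>.\<close>
    have "AE u in unit_unif. hB (eB u) = u"
      unfolding dB(1)[symmetric] using iB
      by (subst AE_distr_iff) auto
    then have 2: "AE x in uniform_measure M A. hB (eB (hA x)) = hA x"
      unfolding dA(1)[symmetric] by (rule AE_distrD[rotated]) simp
    have "AE x in uniform_measure M A. f x \<in> B \<and> f (f x) = x"
      using 1 2 iA mem(1)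
    proof (eventually_elim)
      case (elim x)
      then show ?case using disj by (auto simp: f_def)
    qed
    then show ?thesis unfolding AE_uniform_measure[OF e0(1,2)] .
  qed
  have fB: "AE x in M. x \<in> B \<longrightarrow> f x \<in> A \<and> f (f x) = x"
  proof -
    have "AE x in uniform_measure M A. x \<in> A \<and> eA (hA x) = x"
      using iA mem(1) by eventually_elim simp
    then have 1: "AE x in uniform_measure M B. eA (hB x) \<in> A \<and> eA (hA (eA (hB x))) = eA (hB x)"
      unfolding transport(2)[symmetric] by (rule AE_distrD[rotated]) simp
    have "AE u in unit_unif. hA (eA u) = u"
      unfolding dA(1)[symmetric] using iA
      by (subst AE_distr_iff) auto
    then have 2: "AE x in uniform_measure M B. hA (eA (hB x)) = hB x"
      unfolding dB(1)[symmetric] by (rule AE_distrD[rotated]) simp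
    have "AE x in uniform_measure M B. f x \<in> A \<and> f (f x) = x"
      using 1 2 iB mem(2)
    proof (eventually_elim)
      case (elim x)
      then show ?case using disj by (auto simp: f_def)
    qed
    then show ?thesis unfolding AE_uniform_measure[OF e0(3,4)] .
  qed
  \<comment> \<open>\<open>c (f (f x)) = c x\<close> amounts to \<open>f (f x) = x\<close>, but as
    an equation between real functions it is visibly measurable.\<close>
  define Z where "Z = {x \<in> space M. (x \<in> A \<longrightarrow> f x \<in> B) \<and> (x \<in> B \<longrightarrow> f x \<in> A) \<and> c (f (f x)) = c x}"
  have [measurable]: "Z \<in> events" unfolding Z_def by measurable
  have fsp: "f x \<in> space M" if "x \<in> space M" for x
    using that by (rule measurable_space[rotated]) simp
  have Zff: "f (f x) = x" if "x \<in> Z" for x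
    using that g_c[of x] g_c[of "f (f x)"] fsp by (auto simp: Z_def)
  have fout: "f x = x" if "x \<notin> A \<union> B" for x using that by (auto simp: f_def)
  \<comment> \<open>Invariance of \<open>Z\<close> is what makes \<open>\<pi>\<close> an involution
    at every point.\<close>
  have fZ: "f x \<in> Z" if "x \<in> Z" for x
    using that Zff[OF that] fsp fout[of x] disj by (cases "x \<in> A \<union> B") (auto simp: Z_def)
  have AEZ: "AE x in M. x \<in> Z"
    using fA fB AE_space
  proof eventually_elim
    case (elim x)
    then show ?case by (cases "x \<in> A \<union> B") (auto simp: Z_def fout)
  qed
  define \<pi> where "\<pi> x = (if x \<in> Z then f x else x)" for x
  have [measurable]: "\<pi> \<in> measurable M M" unfolding \<pi>_def[abs_def] by measurable
  have inv: "\<pi> (\<pi> x) = x" for x using fZ Zff by (auto simp: \<pi>_def)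
  have fpres: "prob (f -` E \<inter> space M) = prob E" if [measurable]: "E \<in> events" for E
  proof -
    have un: "measure (uniform_measure M S) E' = prob (S \<inter> E') / prob S"
      if "S \<in> events" "prob S > 0" "E' \<in> events" for S E'
      using that by (intro measure_uniform_measure) (auto simp: emeasure_eq_measure)
    have a: "prob (A \<inter> (f -` E \<inter> space M)) = prob (B \<inter> E)"
    proof -
      have "A \<inter> (f -` E \<inter> space M) = A \<inter> ((\<lambda>x. eB (hA x)) -` E \<inter> space M)" by (auto simp: f_def)
      moreover have "measure (uniform_measure M A) ((\<lambda>x. eB (hA x)) -` E \<inter> space M)
          = measure (uniform_measure M B) E"
        unfolding transport(1)[symmetric] by (subst measure_distr) auto
      ultimately show ?thesis using pos eq by (simp add: un)
    qed
    have b: "prob (B \<inter> (f -` E \<inter> space M)) = prob (A \<inter> E)"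
    proof -
      have "B \<inter> (f -` E \<inter> space M) = B \<inter> ((\<lambda>x. eA (hB x)) -` E \<inter> space M)"
        using disj by (auto simp: f_def split: if_splits)
      moreover have "measure (uniform_measure M B) ((\<lambda>x. eA (hB x)) -` E \<inter> space M)
          = measure (uniform_measure M A) E"
        unfolding transport(2)[symmetric] by (subst measure_distr) auto
      ultimately show ?thesis using pos eq by (simp add: un)
    qed
    have split: "prob T = prob (A \<inter> T) + prob (B \<inter> T) + prob (T - (A \<union> B))"
      if [measurable]: "T \<in> events" for T
    proof -
      have "T = (A \<inter> T) \<union> (B \<inter> T) \<union> (T - (A \<union> B))" by auto
      then have "prob T = prob ((A \<inter> T) \<union> (B \<inter> T) \<union> (T - (A \<union> B)))" by simp
      also have "\<dots> = prob ((A \<inter> T) \<union> (B \<inter> T)) + prob (T - (A \<union> B))"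
        by (rule finite_measure_Union) auto
      also have "prob ((A \<inter> T) \<union> (B \<inter> T)) = prob (A \<inter> T) + prob (B \<inter> T)"
        by (rule finite_measure_Union) (use disj in auto)
      finally show ?thesis .
    qed
    have "f -` E \<inter> space M - (A \<union> B) = E - (A \<union> B)"
      using fout sets.sets_into_space[OF that] by auto
    moreover have "f -` E \<inter> space M \<in> events" by measurable
    ultimately show ?thesis using split[of "f -` E \<inter> space M"] split[OF that] a b by simp
  qed
  have "distr M M \<pi> = M"
  proof (rule measure_eqI)
    fix E assume "E \<in> sets (distr M M \<pi>)"
    then have E [measurable]: "E \<in> events" by simp
    have "prob (\<pi> -` E \<inter> space M) = prob (f -` E \<inter> space M)"
      by (rule finite_measure_eq_AE) (use AEZ in \<open>auto simp: \<pi>_def\<close>)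
    then show "emeasure (distr M M \<pi>) E = emeasure M E"
      by (simp add: emeasure_distr emeasure_eq_measure fpres)
  qed simp
  then have "\<pi> \<in> mp_bijections M"
    by (intro mp_bijectionsI[where \<psi> = \<pi>]) (auto simp: inv)
  moreover have "\<pi> x = x" if "x \<notin> A \<union> B" for x
    using that fout by (auto simp: \<pi>_def)
  moreover have "\<pi> x \<in> A \<union> B" if "x \<in> A \<union> B" for x
    using that by (auto simp: \<pi>_def Z_def)
  moreover have "AE x in M. \<pi> x \<in> B \<longleftrightarrow> x \<in> A"
    using AEZ
  proof eventually_elim
    case (elim x)
    then show ?case using disj fout[of x] by (auto simp: \<pi>_def Z_def)
  qed
  ultimately show ?thesis using that by blast
qed

end

section \<open>Subsets of prescribed measure and alignment of families of sets\<close>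

lemma measure_unit_unif:
  assumes "0 \<le> u" "u \<le> 1"
  shows "measure unit_unif {..u} = u" "measure unit_unif {..<u} = u"
proof -
  have m: "measure unit_unif E = measure lborel (E \<inter> {0<..<1})" if "E \<in> sets borel" for E
    using that by (subst measure_distr)
      (auto simp: space_restrict_space measure_restrict_space measurable_restrict_space1)
  have 1: "{..u} \<inter> {0<..<1} = (if u < 1 then {0<..u} else {0<..<1})"
    and 2: "{..<u} \<inter> {0<..<1} = {0<..<u}"
    using assms by auto
  show "measure unit_unif {..u} = u" using assms by (subst m) (auto simp: 1)
  show "measure unit_unif {..<u} = u" using assms by (subst m) (auto simp: 2)
qed

lemma AE_mp: "\<phi> \<in> mp_bijections M \<Longrightarrow> AE x in M. P x \<Longrightarrow> AE x in M. P (\<phi> x)"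
  by (rule AE_distrD[of \<phi> M M P]) (simp_all only: mp_bijections_def mem_Collect_eq)

context atomless_space begin

text \<open>An initial segment of the uniform coordinate of \<open>A\<close> has the prescribed
  share.\<close>

lemma exists_subset_prob:
  assumes A [measurable]: "A \<in> events" and t: "0 \<le> t" "t \<le> prob A"
  obtains B where "B \<in> events" "B \<subseteq> A" "prob B = t"
proof (cases "prob A = 0")
  case True
  then show ?thesis using that[of "{}"] t by auto
next
  case False
  then have pos: "prob A > 0" by (simp add: zero_less_measure_iff)
  obtain h e where [measurable]: "h \<in> borel_measurable M"
    and d: "distr (uniform_measure M A) borel h = unit_unif"
    using uniform_coordinate[OF A pos] by metis
  have "prob (A \<inter> (h -` {..t / prob A} \<inter> space M)) / prob A
      = measure (uniform_measure M A) (h -` {..t / prob A} \<inter> space M)"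
    using pos by (subst measure_uniform_measure) (auto simp: emeasure_eq_measure)
  also have "\<dots> = measure unit_unif {..t / prob A}"
    unfolding d[symmetric] by (subst measure_distr) auto
  also have "\<dots> = t / prob A" using t pos by (intro measure_unit_unif) auto
  finally have "prob (A \<inter> (h -` {..t / prob A} \<inter> space M)) = t" using pos by simp
  then show ?thesis using that[of "A \<inter> (h -` {..t / prob A} \<inter> space M)"] by auto
qed

lemma exists_disjoint_subsets_prob:
  assumes "finite I" and A: "A \<in> events" and "\<And>i. i \<in> I \<Longrightarrow> 0 \<le> t i" and "sum t I \<le> prob A"
  shows "\<exists>b. (\<forall>i\<in>I. b i \<in> events \<and> b i \<subseteq> A \<and> prob (b i) = t i) \<and> disjoint_family_on b I"
  using assms(1,3,4)
proof (induction I)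
  case empty
  then show ?case by (auto simp: disjoint_family_on_def)
next
  case (insert j I)
  have "sum t I \<le> prob A" using insert.prems(1)[of j] insert.prems(2) insert.hyps by simp
  then obtain b where b: "\<And>i. i \<in> I \<Longrightarrow> b i \<in> events \<and> b i \<subseteq> A \<and> prob (b i) = t i"
      and disj: "disjoint_family_on b I"
    using insert.IH insert.prems by auto
  have U: "(\<Union>i\<in>I. b i) \<in> events" "(\<Union>i\<in>I. b i) \<subseteq> A" using b insert.hyps by auto
  have "prob (\<Union>i\<in>I. b i) = sum t I"
    using finite_measure_finite_Union[of I b] b disj insert.hyps by auto
  then have "prob (A - (\<Union>i\<in>I. b i)) = prob A - sum t I"
    using finite_measure_Diff[OF A U] by simp
  then obtain B where B: "B \<in> events" "B \<subseteq> A - (\<Union>i\<in>I. b i)" "prob B = t j"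
    using exists_subset_prob[of "A - (\<Union>i\<in>I. b i)" "t j"] A U insert.prems insert.hyps by auto
  show ?case
  proof (intro exI[of _ "b(j := B)"] conjI ballI)
    fix i assume "i \<in> insert j I"
    then show "(b(j := B)) i \<in> events" "(b(j := B)) i \<subseteq> A" "prob ((b(j := B)) i) = t i"
      using b B by auto
  next
    show "disjoint_family_on (b(j := B)) (insert j I)"
    proof -
      have "(b(j := B)) i = b i" if "i \<in> I" for i using that insert.hyps by auto
      then have "disjoint_family_on (b(j := B)) I" "(\<Union>i\<in>I. (b(j := B)) i) = (\<Union>i\<in>I. b i)"
        using disj by (simp_all add: disjoint_family_on_def)
      moreover have "(b(j := B)) j \<inter> (\<Union>i\<in>I. b i) = {}" using B(2) by auto
      ultimately show ?thesis unfolding disjoint_family_on_insert[OF insert.hyps(2)] by simp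
    qed
  qed
qed

text \<open>One pair at a time. After \<open>\<pi>\<close> has aligned the other pairs, swapping
  \<open>A j\<close> minus the pulled back \<open>B j\<close> with the opposite difference aligns
  the new pair. By disjointness both differences avoid the earlier sets up to null sets, so nothing
  is lost. A set of \<open>\<C>\<close> contains or misses everything that a swap moves and is
  therefore respected at every point, not only almost everywhere.\<close>

lemma mp_align:
  assumes "finite I" and "\<And>i. i \<in> I \<Longrightarrow> A i \<in> events" "\<And>i. i \<in> I \<Longrightarrow> B i \<in> events"
    "\<And>i. i \<in> I \<Longrightarrow> prob (A i) = prob (B i)"
    "disjoint_family_on A I" "disjoint_family_on B I"
    "\<And>i C. i \<in> I \<Longrightarrow> C \<in> \<C> \<Longrightarrow> A i \<union> B i \<subseteq> C \<or> (A i \<union> B i) \<inter> C = {}"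
  shows "\<exists>\<pi>\<in>mp_bijections M. (\<forall>i\<in>I. AE x in M. \<pi> x \<in> B i \<longleftrightarrow> x \<in> A i) \<and>
    (\<forall>C\<in>\<C>. \<forall>x\<in>space M. \<pi> x \<in> C \<longleftrightarrow> x \<in> C)"
  using assms
proof (induction I)
  case empty
  then show ?case using mp_id by (intro bexI[of _ "\<lambda>x. x"]) auto
next
  case (insert j I)
  have "\<exists>\<pi>\<in>mp_bijections M. (\<forall>i\<in>I. AE x in M. \<pi> x \<in> B i \<longleftrightarrow> x \<in> A i) \<and>
    (\<forall>C\<in>\<C>. \<forall>x\<in>space M. \<pi> x \<in> C \<longleftrightarrow> x \<in> C)"
    using insert.prems by (intro insert.IH) (auto simp: disjoint_family_on_def)
  then obtain \<pi> where \<pi>: "\<pi> \<in> mp_bijections M" "\<And>i. i \<in> I \<Longrightarrow> AE x in M. \<pi> x \<in> B i \<longleftrightarrow> x \<in> A i"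
    "\<And>C x. C \<in> \<C> \<Longrightarrow> x \<in> space M \<Longrightarrow> \<pi> x \<in> C \<longleftrightarrow> x \<in> C" by blast
  note [measurable] = mp_measurable[OF \<pi>(1)]
  have Aj [measurable]: "A j \<in> events" and Bj [measurable]: "B j \<in> events"
    and eqj: "prob (A j) = prob (B j)" using insert.prems by auto
  define B' where "B' = \<pi> -` B j \<inter> space M"
  define D1 where "D1 = A j - B'"
  define D2 where "D2 = B' - A j"
  have B' [measurable]: "B' \<in> events" unfolding B'_def by measurable
  have [measurable]: "D1 \<in> events" "D2 \<in> events" unfolding D1_def D2_def by auto
  have "prob B' = prob (A j)" unfolding B'_def eqj using mp_vimage_measure[OF \<pi>(1) Bj] .
  then have "prob D1 = prob D2"
    unfolding D1_def D2_def by (simp add: finite_measure_Diff' Int_commute)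
  moreover have "D1 \<inter> D2 = {}" by (auto simp: D1_def D2_def)
  ultimately obtain \<sigma> where \<sigma>: "\<sigma> \<in> mp_bijections M" "\<And>x. x \<notin> D1 \<union> D2 \<Longrightarrow> \<sigma> x = x"
    "\<And>x. x \<in> D1 \<union> D2 \<Longrightarrow> \<sigma> x \<in> D1 \<union> D2" "AE x in M. \<sigma> x \<in> D2 \<longleftrightarrow> x \<in> D1"
    using mp_swap[of D1 D2] by auto
  have \<sigma>sp: "\<sigma> x \<in> space M" if "x \<in> space M" for x
    using mp_measurable[OF \<sigma>(1)] that by (rule measurable_space)
  show ?case
  proof (intro bexI conjI ballI)
    show "(\<lambda>x. \<pi> (\<sigma> x)) \<in> mp_bijections M" using mp_comp[OF \<pi>(1) \<sigma>(1)] .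
  next
    fix i assume i: "i \<in> insert j I"
    show "AE x in M. \<pi> (\<sigma> x) \<in> B i \<longleftrightarrow> x \<in> A i"
    proof (cases "i = j")
      case True
      show ?thesis using \<sigma>(4) AE_space
      proof eventually_elim
        case (elim x)
        have "\<pi> (\<sigma> x) \<in> B j \<longleftrightarrow> \<sigma> x \<in> B'" using \<sigma>sp[OF elim(2)] by (simp add: B'_def)
        then show ?case using elim(1) \<sigma>(2,3)[of x] True
          by (cases "x \<in> A j"; cases "x \<in> B'"; cases "\<sigma> x \<in> A j"; cases "\<sigma> x \<in> B'")
            (auto simp: D1_def D2_def)
      qed
    next
      case False
      then have iI: "i \<in> I" using i by simp
      have dis: "A i \<inter> A j = {}" "B i \<inter> B j = {}"
        using insert.prems(4,5) i False by (auto simp: disjoint_family_on_def)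
      show ?thesis using \<pi>(2)[OF iI] AE_mp[OF \<sigma>(1) \<pi>(2)[OF iI]] AE_space
      proof eventually_elim
        case (elim x)
        then show ?case using \<sigma>(2,3)[of x] dis \<sigma>sp[of x]
          by (cases "x \<in> A j"; cases "\<pi> x \<in> B j"; cases "\<sigma> x \<in> A j"; cases "\<pi> (\<sigma> x) \<in> B j")
            (auto simp: D1_def D2_def B'_def)
      qed
    qed
  next
    fix C x assume C: "C \<in> \<C>" and x: "x \<in> space M"
    have "A j \<union> B j \<subseteq> C \<or> (A j \<union> B j) \<inter> C = {}" using insert.prems(6)[of j C] C by auto
    then have "D1 \<union> D2 \<subseteq> C \<or> (D1 \<union> D2) \<inter> C = {}"
      using \<pi>(3)[OF C] by (auto simp: D1_def D2_def B'_def)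
    then have "\<sigma> x \<in> C \<longleftrightarrow> x \<in> C" using \<sigma>(2,3)[of x] by (cases "x \<in> D1 \<union> D2") auto
    then show "\<pi> (\<sigma> x) \<in> C \<longleftrightarrow> x \<in> C" using \<pi>(3)[OF C \<sigma>sp[OF x]] by simp
  qed
qed

section \<open>A global uniform coordinate and its dyadic labels\<close>

lemma unit_coordinate:
  "\<exists>h\<in>borel_measurable M. (\<forall>x. 0 \<le> h x \<and> h x < (1::real)) \<and>
    (\<forall>t. 0 \<le> t \<and> t \<le> 1 \<longrightarrow> prob {x \<in> space M. h x < t} = t) \<and>
    (\<exists>e\<in>measurable borel M. AE x in M. e (h x) = x)"
proof -
  have pos: "prob (space M) > 0" by (simp add: prob_space)
  have "uniform_measure M (space M) = M"
  proof (rule measure_eqI)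
    fix E assume "E \<in> sets (uniform_measure M (space M))"
    then show "emeasure (uniform_measure M (space M)) E = emeasure M E"
      using sets.sets_into_space[of E M]
      by (simp add: emeasure_space_1 Int_absorb1 divide_ennreal_def)
  qed simp
  then obtain h e where [measurable]: "h \<in> borel_measurable M" "e \<in> measurable borel M"
    and d: "distr M borel h = unit_unif" and e: "AE x in M. e (h x) = x"
    using uniform_coordinate[OF sets.top pos] by metis
  \<comment> \<open>Sending the null set of bad values to 0 makes the bounds hold everywhere, so
    that labels are bounded without exception.\<close>
  define h' where "h' x = (if 0 \<le> h x \<and> h x < 1 then h x else 0)" for x
  have [measurable]: "h' \<in> borel_measurable M" unfolding h'_def[abs_def] by measurable
  have "AE u in unit_unif. 0 \<le> u \<and> u < (1::real)"
    by (subst AE_distr_iff) (auto simp: measurable_restrict_space1 AE_restrict_space_iff)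
  then have h: "AE x in M. 0 \<le> h x \<and> h x < 1"
    unfolding d[symmetric] by (rule AE_distrD[rotated]) simp
  show ?thesis
  proof (intro bexI[of _ h'] conjI allI impI)
    fix t :: real assume t: "0 \<le> t \<and> t \<le> 1"
    have "prob {x \<in> space M. h' x < t} = prob (h -` {..<t} \<inter> space M)"
      by (rule finite_measure_eq_AE) (use h in \<open>auto simp: h'_def\<close>)
    also have "\<dots> = measure unit_unif {..<t}"
      unfolding d[symmetric] by (subst measure_distr) auto
    finally show "prob {x \<in> space M. h' x < t} = t" using measure_unit_unif t by auto
  next
    show "\<exists>e\<in>measurable borel M. AE x in M. e (h' x) = x"
      by (rule bexI[of _ e]) (use h e in \<open>auto simp: h'_def\<close>)
  qed (auto simp: h'_def)
qed

definition coord :: "'a \<Rightarrow> real" where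
  "coord = (SOME h. h \<in> borel_measurable M \<and> (\<forall>x. 0 \<le> h x \<and> h x < (1::real)) \<and>
    (\<forall>t. 0 \<le> t \<and> t \<le> 1 \<longrightarrow> prob {x \<in> space M. h x < t} = t) \<and>
    (\<exists>e\<in>measurable borel M. AE x in M. e (h x) = x))"

lemma coord_measurable [measurable]: "coord \<in> borel_measurable M"
  and coord_range: "0 \<le> coord x" "coord x < 1"
  and prob_coord: "0 \<le> t \<Longrightarrow> t \<le> 1 \<Longrightarrow> prob {x \<in> space M. coord x < t} = t"
  and coord_inverse: "\<exists>e\<in>measurable borel M. AE x in M. e (coord x) = x"
proof -
  let ?P = "\<lambda>h. h \<in> borel_measurable M \<and> (\<forall>x. 0 \<le> h x \<and> h x < (1::real)) \<and>
    (\<forall>t. 0 \<le> t \<and> t \<le> 1 \<longrightarrow> prob {x \<in> space M. h x < t} = t) \<and>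
    (\<exists>e\<in>measurable borel M. AE x in M. e (h x) = x)"
  have "\<exists>h. ?P h" using unit_coordinate unfolding Bex_def .
  then have *: "?P coord" unfolding coord_def by (rule someI_ex)
  show "coord \<in> borel_measurable M" using conjunct1[OF *] .
  show "0 \<le> coord x" "coord x < 1" using conjunct1[OF conjunct2[OF *]] by simp_all
  show "\<exists>e\<in>measurable borel M. AE x in M. e (coord x) = x"
    using conjunct2[OF conjunct2[OF conjunct2[OF *]]] .
  show "0 \<le> t \<Longrightarrow> t \<le> 1 \<Longrightarrow> prob {x \<in> space M. coord x < t} = t"
    using conjunct1[OF conjunct2[OF conjunct2[OF *]]] by simp
qed

lemma prob_coord_interval:
  assumes "0 \<le> s" "s \<le> t" "t \<le> 1"
  shows "prob {x \<in> space M. s \<le> coord x \<and> coord x < t} = t - s"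
proof -
  have "{x \<in> space M. s \<le> coord x \<and> coord x < t}
      = {x \<in> space M. coord x < t} - {x \<in> space M. coord x < s}" using assms by auto
  also have "prob \<dots> = prob {x \<in> space M. coord x < t} - prob {x \<in> space M. coord x < s}"
    by (rule finite_measure_Diff) (use assms in auto)
  finally show ?thesis using assms by (simp add: prob_coord)
qed

text \<open>Index of the half-open dyadic interval of length \<open>1 / 2 ^ k\<close> that contains
  the coordinate. With natural numbers as labels, passing to a coarser level is an integer division,
  see \<open>lab_div\<close>.\<close>

definition lab :: "nat \<Rightarrow> 'a \<Rightarrow> nat" where
  "lab k x = nat \<lfloor>2 ^ k * coord x\<rfloor>"

lemma lab_measurable [measurable]: "lab k \<in> measurable M (count_space UNIV)"
  unfolding lab_def[abs_def] by measurable

lemma lab_eq_iff: "lab k x = i \<longleftrightarrow> real i / 2 ^ k \<le> coord x \<and> coord x < (real i + 1) / 2 ^ k"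
proof -
  have "0 \<le> 2 ^ k * coord x" using coord_range by simp
  then have "lab k x = i \<longleftrightarrow> real i \<le> 2 ^ k * coord x \<and> 2 ^ k * coord x < real i + 1"
    unfolding lab_def by (simp add: nat_eq_iff floor_eq_iff)
  then show ?thesis by (simp add: field_simps)
qed

lemma lab_less: "lab k x < 2 ^ k"
proof -
  have "real (lab k x) / 2 ^ k \<le> coord x" using lab_eq_iff[of k x "lab k x"] by simp
  then have "real (lab k x) / 2 ^ k < 1" using coord_range(2)[of x] by linarith
  then have "real (lab k x) < real (2 ^ k)" by (simp add: field_simps)
  then show ?thesis by (simp only: of_nat_less_iff)
qed

lemma lab_div: "lab k x = lab (k + m) x div 2 ^ m"
proof -
  have "\<lfloor>2 ^ k * coord x\<rfloor> = \<lfloor>(2 ^ (k + m) * coord x) / real_of_int (2 ^ m)\<rfloor>"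
    by (simp add: power_add)
  also have "\<dots> = \<lfloor>2 ^ (k + m) * coord x\<rfloor> div 2 ^ m"
    by (subst floor_divide_real_eq_div) auto
  finally show ?thesis unfolding lab_def
    by (simp add: nat_div_distrib coord_range nat_power_eq)
qed

definition cell :: "nat \<Rightarrow> nat \<Rightarrow> 'a set" where
  "cell k i = {x \<in> space M. lab k x = i}"

lemma cell_sets [measurable]: "cell k i \<in> events"
  unfolding cell_def by measurable

lemma prob_cell: "i < 2 ^ k \<Longrightarrow> prob (cell k i) = 1 / 2 ^ k"
proof -
  assume i: "i < 2 ^ k"
  then have "real (Suc i) \<le> real (2 ^ k)" by (simp only: of_nat_le_iff Suc_le_eq)
  then have "prob (cell k i) = (real i + 1) / 2 ^ k - real i / 2 ^ k"
    unfolding cell_def lab_eq_iff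
    by (intro prob_coord_interval) (auto simp: field_simps)
  then show ?thesis by (simp add: field_simps)
qed

end

text \<open>The sets approximable by unions of label classes form a sigma-algebra: complements
  complement \<open>J\<close>, finite unions pass to a common finer level, countable ones follow by
  continuity of the measure. Labels are abstract because the lemma serves both the law of the
  coordinate and the product space.\<close>

lemma (in finite_measure) labels_approximate:
  fixes L :: "nat \<Rightarrow> 'a \<Rightarrow> 'l :: countable"
  assumes L [measurable]: "\<And>k. L k \<in> measurable M (count_space UNIV)"
    and refine: "\<And>k m. \<exists>r. \<forall>x. L k x = r (L (k + m) x)"
    and G: "G \<subseteq> sets M"
    and base: "\<And>E e. E \<in> G \<Longrightarrow> 0 < e \<Longrightarrow> \<exists>k J. measure M {x \<in> space M. (x \<in> E) \<noteq> (L k x \<in> J)} < e"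
    and E: "E \<in> sigma_sets (space M) G"
  shows "0 < e \<Longrightarrow> \<exists>k J. measure M {x \<in> space M. (x \<in> E) \<noteq> (L k x \<in> J)} < e"
  using E
proof (induction E arbitrary: e)
  case (Basic E)
  then show ?case using base by blast
next
  case Empty
  then show ?case by (intro exI[of _ 0] exI[of _ "{}"]) simp
next
  case (Compl E)
  then obtain k J where kJ: "measure M {x \<in> space M. (x \<in> E) \<noteq> (L k x \<in> J)} < e" by blast
  have eq: "{x \<in> space M. (x \<in> space M - E) \<noteq> (L k x \<in> - J)}
      = {x \<in> space M. (x \<in> E) \<noteq> (L k x \<in> J)}" by auto
  show ?case by (intro exI[of _ k] exI[of _ "- J"]) (simp only: eq kJ)
next
  case (Union E)
  have sG: "sigma_sets (space M) G \<subseteq> sets M" using G by (rule sets.sigma_sets_subset)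
  have Em [measurable]: "E i \<in> sets M" for i using Union.hyps sG by auto
  have fin: "\<exists>k J. measure M {x \<in> space M. (x \<in> (\<Union>i<n. E i)) \<noteq> (L k x \<in> J)} < d"
    if "0 < d" for n :: nat and d
    using that
  proof (induction n arbitrary: d)
    case 0
    then show ?case by (intro exI[of _ 0] exI[of _ "{}"]) simp
  next
    case (Suc n)
    obtain k J where 1: "measure M {x \<in> space M. (x \<in> (\<Union>i<n. E i)) \<noteq> (L k x \<in> J)} < d / 2"
      using Suc.IH[of "d / 2"] Suc.prems by auto
    obtain k' J' where 2: "measure M {x \<in> space M. (x \<in> E n) \<noteq> (L k' x \<in> J')} < d / 2"
      using Union.IH[of "d / 2" n] Suc.prems by auto
    obtain r where r: "\<And>x. L k x = r (L (k + k') x)" using refine by blast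
    obtain r' where r': "\<And>x. L k' x = r' (L (k + k') x)" using refine[of k' k] by (auto simp: add.commute)
    have "measure M {x \<in> space M. (x \<in> (\<Union>i<Suc n. E i)) \<noteq> (L (k + k') x \<in> {j. r j \<in> J \<or> r' j \<in> J'})}
      \<le> measure M ({x \<in> space M. (x \<in> (\<Union>i<n. E i)) \<noteq> (L k x \<in> J)} \<union>
          {x \<in> space M. (x \<in> E n) \<noteq> (L k' x \<in> J')})"
      by (rule finite_measure_mono) (auto simp: r r' less_Suc_eq)
    also have "\<dots> \<le> measure M {x \<in> space M. (x \<in> (\<Union>i<n. E i)) \<noteq> (L k x \<in> J)} +
        measure M {x \<in> space M. (x \<in> E n) \<noteq> (L k' x \<in> J')}"
      by (rule measure_Un_le) measurable
    finally have "measure M {x \<in> space M. (x \<in> (\<Union>i<Suc n. E i)) \<noteq> (L (k + k') x \<in> {j. r j \<in> J \<or> r' j \<in> J'})} < d"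
      using 1 2 by linarith
    then show ?case by blast
  qed
  have "(\<lambda>n. measure M (\<Union>i<n. E i)) \<longlonglongrightarrow> measure M (\<Union>n. \<Union>i<n. E i)"
  proof (rule finite_Lim_measure_incseq)
    show "incseq (\<lambda>n. \<Union>i<n. E i)" by (intro monoI UN_mono) simp_all
  qed auto
  moreover have "(\<Union>n. \<Union>i<n. E i) = (\<Union>i. E i)"
    using UN_UN_finite_eq[of E] by (simp only: lessThan_atLeast0)
  ultimately have "\<forall>\<^sub>F n in sequentially. measure M (\<Union>i. E i) - e / 2 < measure M (\<Union>i<n. E i)"
    using Union.prems by (intro order_tendstoD(1)) auto
  then obtain n where n: "measure M (\<Union>i. E i) - e / 2 < measure M (\<Union>i<n. E i)"
    by (auto dest: eventually_happens)
  obtain k J where kJ: "measure M {x \<in> space M. (x \<in> (\<Union>i<n. E i)) \<noteq> (L k x \<in> J)} < e / 2"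
    using fin[of "e / 2" n] Union.prems by auto
  have "measure M {x \<in> space M. (x \<in> (\<Union>i. E i)) \<noteq> (L k x \<in> J)}
      \<le> measure M (((\<Union>i. E i) - (\<Union>i<n. E i)) \<union> {x \<in> space M. (x \<in> (\<Union>i<n. E i)) \<noteq> (L k x \<in> J)})"
    by (rule finite_measure_mono) auto
  also have "\<dots> \<le> measure M ((\<Union>i. E i) - (\<Union>i<n. E i)) + measure M {x \<in> space M. (x \<in> (\<Union>i<n. E i)) \<noteq> (L k x \<in> J)}"
    by (rule measure_Un_le) measurable
  also have "measure M ((\<Union>i. E i) - (\<Union>i<n. E i)) = measure M (\<Union>i. E i) - measure M (\<Union>i<n. E i)"
    by (rule finite_measure_Diff) auto
  finally have "measure M {x \<in> space M. (x \<in> (\<Union>i. E i)) \<noteq> (L k x \<in> J)} < e"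
    using n kJ by linarith
  then show ?case by blast
qed

context atomless_space begin

text \<open>Through the decoder \<open>d\<close> the event becomes a Borel set of coordinates. Borel
  sets are generated by half-lines, and a half-line cuts at most one dyadic interval, of mass
  \<open>(1/2)^k\<close>.\<close>

lemma event_approx:
  assumes S [measurable]: "S \<in> events" and "e > 0"
  shows "\<exists>k J. prob {x \<in> space M. (x \<in> S) \<noteq> (lab k x \<in> J)} < e"
proof -
  obtain d where d [measurable]: "d \<in> measurable borel M" and dc: "AE x in M. d (coord x) = x"
    using coord_inverse by blast
  define N where "N = distr M borel coord"
  interpret N: prob_space N unfolding N_def by (rule prob_space_distr) simp
  have [measurable_cong]: "sets N = sets borel" by (simp add: N_def)
  have spN: "space N = UNIV" by (simp add: N_def)
  \<comment> \<open>Clamping at 0 keeps the floor nonnegative on the whole line, where the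
    refinement identity is required.\<close>
  define L where "L k y = nat \<lfloor>2 ^ k * max 0 y\<rfloor>" for k and y :: real
  have Lm [measurable]: "L k \<in> measurable borel (count_space UNIV)" for k
    unfolding L_def[abs_def] by measurable
  have lab_L: "lab k x = L k (coord x)" for k x using coord_range(1)[of x] by (simp add: lab_def L_def)
  have N_meas: "measure N {y. Q y} = prob {x \<in> space M. Q (coord x)}"
    if "Measurable.pred borel Q" for Q
    unfolding N_def using that by (subst measure_distr) (auto simp: vimage_def Int_def conj_commute)
  have sets_eq: "sigma_sets (space N) (range lessThan) = sets N"
  proof -
    have "sets (borel :: real measure) = sigma_sets UNIV (range lessThan)"
      by (subst borel_Iio, subst sets_measure_of) simp_all
    then show ?thesis by (simp add: spN N_def)
  qed
  have T [measurable]: "d -` S \<in> sets borel"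
    using measurable_sets[OF d S] by simp
  have "\<exists>k J. measure N {x \<in> space N. (x \<in> d -` S) \<noteq> (L k x \<in> J)} < e"
  proof (rule N.labels_approximate[where G = "range lessThan", OF _ _ _ _ _ \<open>e > 0\<close>])
    show "L k \<in> measurable N (count_space UNIV)" for k by measurable
    show "\<exists>r. \<forall>x. L k x = r (L (k + m) x)" for k m
    proof (intro exI allI)
      fix y
      have "\<lfloor>2 ^ k * max 0 y\<rfloor> = \<lfloor>(2 ^ (k + m) * max 0 y) / real_of_int (2 ^ m)\<rfloor>"
        by (simp add: power_add)
      also have "\<dots> = \<lfloor>2 ^ (k + m) * max 0 y\<rfloor> div 2 ^ m"
        by (subst floor_divide_real_eq_div) auto
      finally show "L k y = L (k + m) y div 2 ^ m" unfolding L_def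
        by (simp add: nat_div_distrib nat_power_eq)
    qed
    show "range lessThan \<subseteq> sets N" by (auto simp: N_def)
    show "d -` S \<in> sigma_sets (space N) (range lessThan)" unfolding sets_eq by (simp add: N_def)
    fix E :: "real set" and e :: real assume "E \<in> range lessThan" and e: "0 < e"
    then obtain t :: real where E: "E = {..<t}" by auto
    obtain k where k: "(1/2)^k < e" using real_arch_pow_inv[OF e, of "1/2"] by auto
    have p: "0 < 1 / (2::real) ^ k" by simp
    \<comment> \<open>The dyadic intervals that lie entirely to the left of
      \<open>t\<close>.\<close>
    define J where "J = {j. (real j + 1) / 2 ^ k \<le> t}"
    have "measure N {x \<in> space N. (x \<in> E) \<noteq> (L k x \<in> J)} = prob {x \<in> space M. (coord x < t) \<noteq> (lab k x \<in> J)}"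
      unfolding lab_L by (simp add: spN E N_meas)
    \<comment> \<open>Errors lie in a strip of width \<open>1 / 2 ^ k\<close> to the left of
      \<open>t\<close>, with both ends clamped since \<open>t\<close> may lie outside the unit
      interval.\<close>
    also have "\<dots> \<le> prob {x \<in> space M. max 0 (min 1 t - 1 / 2 ^ k) \<le> coord x \<and> coord x < max 0 (min 1 t)}"
    proof (rule finite_measure_mono)
      show "{x \<in> space M. (coord x < t) \<noteq> (lab k x \<in> J)}
        \<subseteq> {x \<in> space M. max 0 (min 1 t - 1 / 2 ^ k) \<le> coord x \<and> coord x < max 0 (min 1 t)}"
      proof (rule subsetI)
        fix x assume "x \<in> {x \<in> space M. (coord x < t) \<noteq> (lab k x \<in> J)}"
        then have x: "x \<in> space M" "(coord x < t) \<noteq> (lab k x \<in> J)" by auto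
        have l: "real (lab k x) / 2 ^ k \<le> coord x" "coord x < (real (lab k x) + 1) / 2 ^ k"
          using lab_eq_iff[of k x "lab k x"] by auto
        then have 1: "coord x < t" "(real (lab k x) + 1) / 2 ^ k > t" using x by (auto simp: J_def)
        have "t - 1 / 2 ^ k < real (lab k x) / 2 ^ k" using 1 by (simp add: add_divide_distrib)
        then show "x \<in> {x \<in> space M. max 0 (min 1 t - 1 / 2 ^ k) \<le> coord x \<and> coord x < max 0 (min 1 t)}"
          using l 1 coord_range[of x] x(1) by (auto simp: max_def min_def)
      qed
    qed measurable
    also have "\<dots> = max 0 (min 1 t) - max 0 (min 1 t - 1 / 2 ^ k)"
      using p by (intro prob_coord_interval) linarith+
    also have "\<dots> \<le> 1 / 2 ^ k" using p by linarith
    finally have "measure N {x \<in> space N. (x \<in> E) \<noteq> (L k x \<in> J)} < e"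
      using k by (simp only: power_one_over)
    then show "\<exists>k J. measure N {x \<in> space N. (x \<in> E) \<noteq> (L k x \<in> J)} < e" by blast
  qed
  then obtain k J where kJ: "measure N {x. (d x \<in> S) \<noteq> (L k x \<in> J)} < e" by (auto simp: spN)
  have "measure N {x. (d x \<in> S) \<noteq> (L k x \<in> J)} = prob {x \<in> space M. (d (coord x) \<in> S) \<noteq> (lab k x \<in> J)}"
    unfolding lab_L by (rule N_meas) measurable
  also have "\<dots> = prob {x \<in> space M. (x \<in> S) \<noteq> (lab k x \<in> J)}"
    by (rule finite_measure_eq_AE) (use dc in auto)
  finally have "prob {x \<in> space M. (x \<in> S) \<noteq> (lab k x \<in> J)} < e" using kJ by simp
  then show ?thesis by blast
qed

end

section \<open>Bounded kernels and the cut norm\<close>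

context atomless_space begin

sublocale P: pair_prob_space M M ..

abbreviation N :: "('a \<times> 'a) measure" where "N \<equiv> M \<Otimes>\<^sub>M M"

text \<open>Differences of graphons leave the interval [0, 1] and indicators of rectangles are not
  symmetric; hence an arbitrary bound and no symmetry. The bound holds at every point of the space,
  so that pointwise estimates come without null sets.\<close>

definition bounded_kernel :: "real \<Rightarrow> ('a \<times> 'a \<Rightarrow> real) \<Rightarrow> bool" where
  "bounded_kernel b Y \<longleftrightarrow> Y \<in> borel_measurable N \<and> (\<forall>z\<in>space N. \<bar>Y z\<bar> \<le> b)"

lemma bounded_kernel_measurable [measurable_dest]: "bounded_kernel b Y \<Longrightarrow> Y \<in> borel_measurable N"
  by (simp add: bounded_kernel_def)

lemma bounded_kernel_bound: "bounded_kernel b Y \<Longrightarrow> z \<in> space N \<Longrightarrow> \<bar>Y z\<bar> \<le> b"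
  by (simp add: bounded_kernel_def)

lemma bounded_kernel_nonneg: "bounded_kernel b Y \<Longrightarrow> 0 \<le> b"
  using P.not_empty bounded_kernel_bound by (meson abs_ge_zero ex_in_conv order_trans)

lemma bounded_kernel_integrable: "bounded_kernel b Y \<Longrightarrow> integrable N Y"
  by (rule P.integrable_const_bound[where B = b])
    (auto simp: bounded_kernel_def intro!: AE_I2)

lemma bounded_kernel_diff: "bounded_kernel a X \<Longrightarrow> bounded_kernel b Y \<Longrightarrow> bounded_kernel (a + b) (\<lambda>z. X z - Y z)"
  unfolding bounded_kernel_def by (auto intro: order_trans[OF abs_triangle_ineq4] add_mono)

lemma bounded_kernel_mult: "bounded_kernel a X \<Longrightarrow> bounded_kernel b Y \<Longrightarrow> bounded_kernel (a * b) (\<lambda>z. X z * Y z)"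
  using bounded_kernel_nonneg[of a X] bounded_kernel_nonneg[of b Y]
  unfolding bounded_kernel_def by (auto simp: abs_mult intro!: mult_mono)

lemma bounded_kernel_indicator: "A \<in> sets N \<Longrightarrow> bounded_kernel 1 (indicator A)"
  unfolding bounded_kernel_def by (auto simp: indicator_def)

lemma integrable_indicator_N: "A \<in> sets N \<Longrightarrow> integrable N (indicator A :: _ \<Rightarrow> real)"
  by (rule bounded_kernel_integrable[OF bounded_kernel_indicator])

lemma graphon_bounded_kernel: "W \<in> graphons M \<Longrightarrow> bounded_kernel 1 W"
  by (auto simp: graphons_def bounded_kernel_def space_pair_measure)

lemma rect_integral_eq: "rect_integral M S T Y = (\<integral>z. indicator (S \<times> T) z * Y z \<partial>N)"
  by (simp add: rect_integral_def set_lebesgue_integral_def)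

lemma bounded_kernel_rect:
  "bounded_kernel b Y \<Longrightarrow> S \<in> events \<Longrightarrow> T \<in> events \<Longrightarrow> integrable N (\<lambda>z. indicator (S \<times> T) z * Y z)"
  by (rule bounded_kernel_integrable[OF bounded_kernel_mult[OF bounded_kernel_indicator]]) auto

lemma rect_integral_diff:
  assumes "bounded_kernel a X" "bounded_kernel b Y" "S \<in> events" "T \<in> events"
  shows "rect_integral M S T (\<lambda>z. X z - Y z) = rect_integral M S T X - rect_integral M S T Y"
  unfolding rect_integral_eq right_diff_distrib
  by (rule Bochner_Integration.integral_diff) (use assms in \<open>auto intro: bounded_kernel_rect\<close>)

lemma rect_integral_cong:
  assumes "\<And>z. z \<in> space N \<Longrightarrow> X z = Y z"
  shows "rect_integral M S T X = rect_integral M S T Y"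
  unfolding rect_integral_eq using assms by (intro Bochner_Integration.integral_cong) auto

lemma abs_rect_integral_le:
  assumes Y: "bounded_kernel b Y" and [measurable]: "S \<in> events" "T \<in> events"
  shows "\<bar>rect_integral M S T Y\<bar> \<le> (\<integral>z. \<bar>Y z\<bar> \<partial>N)"
proof -
  have "\<bar>rect_integral M S T Y\<bar> \<le> (\<integral>z. \<bar>indicator (S \<times> T) z * Y z\<bar> \<partial>N)"
    unfolding rect_integral_eq using integral_abs_bound by blast
  also have "\<dots> \<le> (\<integral>z. \<bar>Y z\<bar> \<partial>N)"
    using bounded_kernel_integrable[OF Y] bounded_kernel_rect[OF Y, of S T]
    by (intro integral_mono) (auto simp: indicator_def)
  finally show ?thesis .
qed

lemma measure_rect: "S \<in> events \<Longrightarrow> T \<in> events \<Longrightarrow> measure N (S \<times> T) = prob S * prob T"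
  unfolding measure_def by (simp add: emeasure_pair_measure_Times enn2real_mult)

text \<open>The two indicators differ only on the union of two strips, over the symmetric
  differences of \<open>S\<close>, \<open>S'\<close> and of \<open>T\<close>,
  \<open>T'\<close>.\<close>

lemma rect_integral_change:
  assumes Y: "bounded_kernel b Y"
    and [measurable]: "S \<in> events" "T \<in> events" "S' \<in> events" "T' \<in> events"
  shows "\<bar>rect_integral M S T Y - rect_integral M S' T' Y\<bar> \<le>
    b * (prob {x \<in> space M. (x \<in> S) \<noteq> (x \<in> S')} + prob {x \<in> space M. (x \<in> T) \<noteq> (x \<in> T')})"
proof -
  define A where "A = {x \<in> space M. (x \<in> S) \<noteq> (x \<in> S')}"
  define B where "B = {x \<in> space M. (x \<in> T) \<noteq> (x \<in> T')}"
  have [measurable]: "A \<in> events" "B \<in> events" unfolding A_def B_def by measurable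
  have b0: "0 \<le> b" using bounded_kernel_nonneg[OF Y] .
  have "rect_integral M S T Y - rect_integral M S' T' Y
      = (\<integral>z. indicator (S \<times> T) z * Y z - indicator (S' \<times> T') z * Y z \<partial>N)"
    unfolding rect_integral_eq
    by (rule Bochner_Integration.integral_diff[symmetric]) (auto intro: bounded_kernel_rect[OF Y])
  also have "\<bar>\<dots>\<bar> \<le> (\<integral>z. \<bar>indicator (S \<times> T) z * Y z - indicator (S' \<times> T') z * Y z\<bar> \<partial>N)"
    using integral_abs_bound by blast
  also have "\<dots> \<le> (\<integral>z. b * indicator (A \<times> space M) z + b * indicator (space M \<times> B) z \<partial>N)"
  proof (rule integral_mono)
    fix z assume z: "z \<in> space N"
    then have "\<bar>Y z\<bar> \<le> b" using bounded_kernel_bound[OF Y] by auto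
    then show "\<bar>indicator (S \<times> T) z * Y z - indicator (S' \<times> T') z * Y z\<bar>
      \<le> b * indicator (A \<times> space M) z + b * indicator (space M \<times> B) z"
      using z b0 by (cases z) (auto simp: indicator_def A_def B_def space_pair_measure)
  qed (auto intro!: bounded_kernel_rect[OF Y] Bochner_Integration.integrable_diff integrable_abs
      Bochner_Integration.integrable_add integrable_mult_right integrable_indicator_N)
  also have "\<dots> = b * measure N (A \<times> space M) + b * measure N (space M \<times> B)"
    by (subst Bochner_Integration.integral_add) (auto intro!: integrable_mult_right integrable_indicator_N)
  also have "\<dots> = b * (prob A + prob B)"
    by (simp add: measure_rect prob_space distrib_left)
  finally show ?thesis by (simp only: A_def B_def)
qed

lemma rect_integral_change_AE:
  assumes Y: "bounded_kernel b Y" and m: "S \<in> events" "T \<in> events" "S' \<in> events" "T' \<in> events"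
    and AE: "AE x in M. x \<in> S \<longleftrightarrow> x \<in> S'" "AE x in M. x \<in> T \<longleftrightarrow> x \<in> T'"
  shows "rect_integral M S T Y = rect_integral M S' T' Y"
proof -
  note [measurable] = m
  have "prob {x \<in> space M. (x \<in> S) \<noteq> (x \<in> S')} = 0" "prob {x \<in> space M. (x \<in> T) \<noteq> (x \<in> T')} = 0"
    using AE by (auto intro!: prob_eq_0_AE)
  then show ?thesis using rect_integral_change[OF Y m] by simp
qed

lemma pullback_measurable [measurable (raw)]:
  assumes [measurable]: "Y \<in> borel_measurable N" "\<phi> \<in> measurable M M"
  shows "pullback Y \<phi> \<in> borel_measurable N"
  unfolding pullback_def by measurable

lemma integral_pullback:
  assumes \<phi>: "\<phi> \<in> mp_bijections M" and [measurable]: "Y \<in> borel_measurable N"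
  shows "(\<integral>z. pullback Y \<phi> z \<partial>N) = (\<integral>z. Y z \<partial>N)"
proof -
  have d: "distr M M \<phi> = M" and [measurable]: "\<phi> \<in> measurable M M"
    using \<phi> by (auto simp: mp_bijections_def)
  have "sigma_finite_measure (distr M M \<phi>)" unfolding d ..
  then have "N = distr N N (\<lambda>(x, y). (\<phi> x, \<phi> y))"
    using pair_measure_distr[of \<phi> M M \<phi> M M] by (simp add: d)
  then have "(\<integral>z. Y z \<partial>N) = (\<integral>z. Y z \<partial>distr N N (\<lambda>(x, y). (\<phi> x, \<phi> y)))" by simp
  also have "\<dots> = (\<integral>z. pullback Y \<phi> z \<partial>N)"
    by (subst integral_distr) (auto simp: pullback_def case_prod_beta')
  finally show ?thesis by simp
qed

lemma pullback_bounded_kernel: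
  assumes \<phi>: "\<phi> \<in> mp_bijections M" and Y: "bounded_kernel b Y"
  shows "bounded_kernel b (pullback Y \<phi>)"
proof -
  note [measurable] = mp_measurable[OF \<phi>] bounded_kernel_measurable[OF Y]
  have "\<phi> x \<in> space M" if "x \<in> space M" for x
    using mp_measurable[OF \<phi>] that by (rule measurable_space)
  then show ?thesis
    using Y unfolding bounded_kernel_def by (auto simp: pullback_def space_pair_measure)
qed

lemma pullback_graphon:
  assumes \<phi>: "\<phi> \<in> mp_bijections M" and W: "W \<in> graphons M"
  shows "pullback W \<phi> \<in> graphons M"
proof -
  note [measurable] = mp_measurable[OF \<phi>]
  have [measurable]: "W \<in> borel_measurable N" using W by (simp add: graphons_def)
  have "\<phi> x \<in> space M" if "x \<in> space M" for x
    using mp_measurable[OF \<phi>] that by (rule measurable_space)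
  then show ?thesis
    using W by (simp add: graphons_def pullback_def)
qed

lemma pullback_comp: "pullback (pullback Y \<phi>) \<psi> = pullback Y (\<lambda>x. \<phi> (\<psi> x))"
  by (auto simp: pullback_def)

lemma pullback_diff: "pullback (\<lambda>z. X z - Y z) \<phi> = (\<lambda>z. pullback X \<phi> z - pullback Y \<phi> z)"
  by (auto simp: pullback_def)

lemma rect_integral_pullback:
  assumes \<phi>: "\<phi> \<in> mp_bijections M" and [measurable]: "Y \<in> borel_measurable N" "S \<in> events" "T \<in> events"
  shows "rect_integral M (\<phi> -` S \<inter> space M) (\<phi> -` T \<inter> space M) (pullback Y \<phi>) = rect_integral M S T Y"
proof -
  have "rect_integral M S T Y = (\<integral>z. pullback (\<lambda>z. indicator (S \<times> T) z * Y z) \<phi> z \<partial>N)"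
    unfolding rect_integral_eq by (rule integral_pullback[OF \<phi>, symmetric]) measurable
  also have "\<dots> = rect_integral M (\<phi> -` S \<inter> space M) (\<phi> -` T \<inter> space M) (pullback Y \<phi>)"
    unfolding rect_integral_eq
    by (intro Bochner_Integration.integral_cong) (auto simp: pullback_def indicator_def space_pair_measure)
  finally show ?thesis by simp
qed

lemma cut_norm_bdd:
  assumes "bounded_kernel b Y"
  shows "bdd_above ((\<lambda>(S, T). \<bar>rect_integral M S T Y\<bar>) ` (sets M \<times> sets M))"
  by (rule bdd_aboveI[where M = "\<integral>z. \<bar>Y z\<bar> \<partial>N"]) (auto intro: abs_rect_integral_le[OF assms])

lemma rect_le_cut_norm:
  assumes "bounded_kernel b Y" "S \<in> events" "T \<in> events"
  shows "\<bar>rect_integral M S T Y\<bar> \<le> cut_norm M Y"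
  unfolding cut_norm_def using cSUP_upper[OF _ cut_norm_bdd[OF assms(1)], of "(S, T)"] assms(2,3) by simp

lemma cut_norm_leI:
  assumes "\<And>S T. S \<in> events \<Longrightarrow> T \<in> events \<Longrightarrow> \<bar>rect_integral M S T Y\<bar> \<le> r"
  shows "cut_norm M Y \<le> r"
  unfolding cut_norm_def by (rule cSUP_least) (use assms in \<open>auto intro: sets.top\<close>)

lemma cut_norm_lessD:
  assumes "bounded_kernel b Y" "r < cut_norm M Y"
  obtains S T where "S \<in> events" "T \<in> events" "r < \<bar>rect_integral M S T Y\<bar>"
  using assms cut_norm_leI[of Y r] by force

lemma cut_norm_nonneg: "bounded_kernel b Y \<Longrightarrow> 0 \<le> cut_norm M Y"
  using rect_le_cut_norm[OF _ sets.top sets.top] by (meson abs_ge_zero order_trans)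

lemma cut_norm_le_L1: "bounded_kernel b Y \<Longrightarrow> cut_norm M Y \<le> (\<integral>z. \<bar>Y z\<bar> \<partial>N)"
  by (intro cut_norm_leI abs_rect_integral_le)

lemma cut_norm_cong: "(\<And>z. z \<in> space N \<Longrightarrow> X z = Y z) \<Longrightarrow> cut_norm M X = cut_norm M Y"
  unfolding cut_norm_def using rect_integral_cong[of X Y] by simp

lemma cut_norm_triangle:
  assumes "bounded_kernel a X" "bounded_kernel b Y" "bounded_kernel d Z"
  shows "cut_norm M (\<lambda>z. X z - Z z) \<le> cut_norm M (\<lambda>z. X z - Y z) + cut_norm M (\<lambda>z. Y z - Z z)"
proof (rule cut_norm_leI)
  fix S T assume m: "S \<in> events" "T \<in> events"
  have "\<bar>rect_integral M S T (\<lambda>z. X z - Z z)\<bar>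
      \<le> \<bar>rect_integral M S T (\<lambda>z. X z - Y z)\<bar> + \<bar>rect_integral M S T (\<lambda>z. Y z - Z z)\<bar>"
    using m assms by (simp add: rect_integral_diff)
  also have "\<dots> \<le> cut_norm M (\<lambda>z. X z - Y z) + cut_norm M (\<lambda>z. Y z - Z z)"
    using m assms by (intro add_mono rect_le_cut_norm[OF bounded_kernel_diff])
  finally show "\<bar>rect_integral M S T (\<lambda>z. X z - Z z)\<bar> \<le> \<dots>" .
qed

lemma cut_norm_minus_commute:
  assumes "bounded_kernel a X" "bounded_kernel b Y"
  shows "cut_norm M (\<lambda>z. X z - Y z) = cut_norm M (\<lambda>z. Y z - X z)"
proof -
  have "cut_norm M (\<lambda>z. X z - Y z) \<le> cut_norm M (\<lambda>z. Y z - X z)"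
    if "bounded_kernel a X" "bounded_kernel b Y" for a b X Y
  proof (rule cut_norm_leI)
    fix S T assume m: "S \<in> events" "T \<in> events"
    then have "\<bar>rect_integral M S T (\<lambda>z. X z - Y z)\<bar> = \<bar>rect_integral M S T (\<lambda>z. Y z - X z)\<bar>"
      using that by (simp add: rect_integral_diff)
    also have "\<dots> \<le> cut_norm M (\<lambda>z. Y z - X z)"
      using m that by (intro rect_le_cut_norm[OF bounded_kernel_diff])
    finally show "\<bar>rect_integral M S T (\<lambda>z. X z - Y z)\<bar> \<le> cut_norm M (\<lambda>z. Y z - X z)" .
  qed
  from this[OF assms] this[OF assms(2,1)] show ?thesis by (rule antisym)
qed

text \<open>Replacing a rectangle by its preimage gives one inequality; the other is the same
  inequality for the inverse bijection.\<close>

lemma cut_norm_pullback: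
  assumes \<phi>: "\<phi> \<in> mp_bijections M" and Y: "bounded_kernel b Y"
  shows "cut_norm M (pullback Y \<phi>) = cut_norm M Y"
proof -
  have le: "cut_norm M X \<le> cut_norm M (pullback X \<psi>)"
    if \<psi>: "\<psi> \<in> mp_bijections M" and X: "bounded_kernel b X" for \<psi> X
  proof (rule cut_norm_leI)
    note [measurable] = mp_measurable[OF \<psi>] bounded_kernel_measurable[OF X]
    fix S T assume [measurable]: "S \<in> events" "T \<in> events"
    have "rect_integral M S T X = rect_integral M (\<psi> -` S \<inter> space M) (\<psi> -` T \<inter> space M) (pullback X \<psi>)"
      by (rule rect_integral_pullback[OF \<psi>, symmetric]) measurable
    then show "\<bar>rect_integral M S T X\<bar> \<le> cut_norm M (pullback X \<psi>)"
      using rect_le_cut_norm[OF pullback_bounded_kernel[OF \<psi> X]] by simp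
  qed
  obtain \<psi> where \<psi>: "\<psi> \<in> mp_bijections M" "\<And>x. x \<in> space M \<Longrightarrow> \<phi> (\<psi> x) = x"
    using mp_obtain_inverse[OF \<phi>] by metis
  have "cut_norm M (pullback Y \<phi>) \<le> cut_norm M (pullback (pullback Y \<phi>) \<psi>)"
    by (rule le[OF \<psi>(1) pullback_bounded_kernel[OF \<phi> Y]])
  also have "\<dots> = cut_norm M Y"
    by (rule cut_norm_cong) (auto simp: pullback_def space_pair_measure \<psi>(2))
  finally show ?thesis using le[OF \<phi> Y] by simp
qed

section \<open>Density of label step functions in L1 of the product space\<close>

lemma lab_pair_measurable [measurable]:
  "(\<lambda>z. f (lab k (fst z)) (lab k (snd z))) \<in> measurable N (count_space UNIV)"
  by (rule measurable_compose_countable[where f = "\<lambda>i z. f i (lab k (snd z))"],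
      rule measurable_compose_countable[where f = "\<lambda>j z. f i j" for i]) measurable

lemma lab_step_bounded: "\<exists>b. bounded_kernel b (\<lambda>z. \<rho> (lab k (fst z)) (lab k (snd z)))"
proof (intro exI[of _ "\<Sum>i<2^k. \<Sum>j<2^k. \<bar>\<rho> i j\<bar>"], unfold bounded_kernel_def, intro conjI ballI)
  show "(\<lambda>z. \<rho> (lab k (fst z)) (lab k (snd z))) \<in> borel_measurable N"
    by (rule measurable_compose[OF lab_pair_measurable[of \<rho> k], of "\<lambda>x. x"]) simp
next
  fix z :: "'a \<times> 'a"
  let ?i = "lab k (fst z)" and ?j = "lab k (snd z)"
  have "\<bar>\<rho> ?i ?j\<bar> \<le> (\<Sum>j<2^k. \<bar>\<rho> ?i j\<bar>)"
    by (rule member_le_sum) (use lab_less in auto)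
  also have "\<dots> \<le> (\<Sum>i<2^k. \<Sum>j<2^k. \<bar>\<rho> i j\<bar>)"
    by (rule member_le_sum[where f = "\<lambda>i. \<Sum>j<2^k. \<bar>\<rho> i j\<bar>"]) (use lab_less in \<open>auto intro: sum_nonneg\<close>)
  finally show "\<bar>\<rho> ?i ?j\<bar> \<le> \<dots>" .
qed

lemma pair_event_approx:
  assumes E: "E \<in> sets N" and e: "e > 0"
  shows "\<exists>k J. measure N {z \<in> space N. (z \<in> E) \<noteq> ((lab k (fst z), lab k (snd z)) \<in> J)} < e"
proof (rule P.labels_approximate[where G = "{S \<times> T |S T. S \<in> events \<and> T \<in> events}", OF _ _ _ _ _ e])
  show "(\<lambda>z. (lab k (fst z), lab k (snd z))) \<in> measurable N (count_space UNIV)" for k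
    by (rule lab_pair_measurable)
  show "\<exists>r. \<forall>z. (lab k (fst z), lab k (snd z)) = r (lab (k + m) (fst z), lab (k + m) (snd z))" for k m
    by (rule exI[of _ "\<lambda>(i, j). (i div 2 ^ m, j div 2 ^ m)"]) (simp add: lab_div[symmetric])
  show "{S \<times> T |S T. S \<in> events \<and> T \<in> events} \<subseteq> sets N" by auto
  show "E \<in> sigma_sets (space N) {S \<times> T |S T. S \<in> events \<and> T \<in> events}"
    using E by (simp add: sets_pair_measure space_pair_measure)
next
  fix E and e :: real assume "E \<in> {S \<times> T |S T. S \<in> events \<and> T \<in> events}" and e: "0 < e"
  then obtain S T where ST [measurable]: "S \<in> events" "T \<in> events" and E: "E = S \<times> T" by auto
  obtain k J where 1: "prob {x \<in> space M. (x \<in> S) \<noteq> (lab k x \<in> J)} < e / 2"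
    using event_approx[OF ST(1), of "e/2"] e by auto
  obtain k' J' where 2: "prob {x \<in> space M. (x \<in> T) \<noteq> (lab k' x \<in> J')} < e / 2"
    using event_approx[OF ST(2), of "e/2"] e by auto
  define A where "A = {x \<in> space M. (x \<in> S) \<noteq> (lab k x \<in> J)}"
  define B where "B = {x \<in> space M. (x \<in> T) \<noteq> (lab k' x \<in> J')}"
  have [measurable]: "A \<in> events" "B \<in> events" unfolding A_def B_def by measurable
  \<comment> \<open>Both label sets are read at the common level \<open>k + k'\<close>; division
    recovers the coarser label in each variable.\<close>
  define JJ where "JJ = {(i, j). i div 2 ^ k' \<in> J \<and> j div 2 ^ k \<in> J'}"
  have l: "lab (k + k') x div 2 ^ k' = lab k x" "lab (k + k') x div 2 ^ k = lab k' x" for x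
    using lab_div[of k x k'] lab_div[of k' x k] by (simp_all add: add.commute)
  have "measure N {z \<in> space N. (z \<in> E) \<noteq> ((lab (k + k') (fst z), lab (k + k') (snd z)) \<in> JJ)}
      \<le> measure N (A \<times> space M \<union> space M \<times> B)"
    by (rule P.finite_measure_mono) (auto simp: E JJ_def l A_def B_def space_pair_measure)
  also have "\<dots> \<le> measure N (A \<times> space M) + measure N (space M \<times> B)"
    by (rule measure_Un_le) measurable
  also have "\<dots> = prob A + prob B" by (simp add: measure_rect prob_space)
  also have "\<dots> < e" using 1 2 unfolding A_def B_def by linarith
  finally show "\<exists>k J. measure N {z \<in> space N. (z \<in> E) \<noteq> ((lab k (fst z), lab k (snd z)) \<in> J)} < e"
    by blast
qed

lemma integrable_approx:
  fixes f :: "'a \<times> 'a \<Rightarrow> real"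
  assumes "integrable N f"
  shows "0 < e \<Longrightarrow> \<exists>k \<rho>. (\<integral>z. \<bar>f z - \<rho> (lab k (fst z)) (lab k (snd z))\<bar> \<partial>N) < e"
  using assms
proof (induction f arbitrary: e rule: integrable_induct)
  case (base A c)
  have [measurable]: "A \<in> sets N" using base by simp
  have "0 < e / (1 + \<bar>c\<bar>)" using base by simp
  then obtain k J where kJ: "measure N {z \<in> space N. (z \<in> A) \<noteq> ((lab k (fst z), lab k (snd z)) \<in> J)} < e / (1 + \<bar>c\<bar>)"
    using pair_event_approx base by blast
  define D where "D = {z \<in> space N. (z \<in> A) \<noteq> ((lab k (fst z), lab k (snd z)) \<in> J)}"
  have D [measurable]: "D \<in> sets N" unfolding D_def by measurable
  have "(\<integral>z. \<bar>indicator A z *\<^sub>R c - c * indicator J (lab k (fst z), lab k (snd z))\<bar> \<partial>N) = (\<integral>z. \<bar>c\<bar> * indicator D z \<partial>N)"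
    by (rule Bochner_Integration.integral_cong) (auto simp: D_def indicator_def)
  also have "\<dots> = \<bar>c\<bar> * measure N D" by simp
  also have "\<dots> \<le> (1 + \<bar>c\<bar>) * measure N D" by (simp add: distrib_right)
  also have "\<dots> < e" using kJ by (simp add: D_def field_simps)
  finally show ?case by (intro exI[of _ k] exI[of _ "\<lambda>i j. c * indicator J (i, j)"])
next
  case (add f g)
  obtain k \<rho> where 1: "(\<integral>z. \<bar>f z - \<rho> (lab k (fst z)) (lab k (snd z))\<bar> \<partial>N) < e / 2"
    using add.IH(1)[of "e / 2"] add.prems by auto
  obtain k' \<rho>' where 2: "(\<integral>z. \<bar>g z - \<rho>' (lab k' (fst z)) (lab k' (snd z))\<bar> \<partial>N) < e / 2"
    using add.IH(2)[of "e / 2"] add.prems by auto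
  have l: "lab (k + k') x div 2 ^ k' = lab k x" "lab (k + k') x div 2 ^ k = lab k' x" for x
    using lab_div[of k x k'] lab_div[of k' x k] by (simp_all add: add.commute)
  define R where "R i j = \<rho> (i div 2 ^ k') (j div 2 ^ k') + \<rho>' (i div 2 ^ k) (j div 2 ^ k)" for i j
  obtain b b' where b: "bounded_kernel b (\<lambda>z. \<rho> (lab k (fst z)) (lab k (snd z)))"
      "bounded_kernel b' (\<lambda>z. \<rho>' (lab k' (fst z)) (lab k' (snd z)))"
    using lab_step_bounded by blast
  note bi = b[THEN bounded_kernel_integrable]
  have "(\<integral>z. \<bar>f z + g z - R (lab (k + k') (fst z)) (lab (k + k') (snd z))\<bar> \<partial>N)
     \<le> (\<integral>z. \<bar>f z - \<rho> (lab k (fst z)) (lab k (snd z))\<bar> + \<bar>g z - \<rho>' (lab k' (fst z)) (lab k' (snd z))\<bar> \<partial>N)"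
  proof (rule integral_mono)
    show "integrable N (\<lambda>z. \<bar>f z + g z - R (lab (k + k') (fst z)) (lab (k + k') (snd z))\<bar>)"
      unfolding R_def l using bi add.hyps by auto
  qed (use bi add.hyps in \<open>auto simp: R_def l\<close>)
  also have "\<dots> = (\<integral>z. \<bar>f z - \<rho> (lab k (fst z)) (lab k (snd z))\<bar> \<partial>N) + (\<integral>z. \<bar>g z - \<rho>' (lab k' (fst z)) (lab k' (snd z))\<bar> \<partial>N)"
    by (rule Bochner_Integration.integral_add) (use bi add.hyps in auto)
  also have "\<dots> < e" using 1 2 by simp
  finally show ?case by blast
next
  case (lim f s)
  have int: "integrable N (\<lambda>z. \<bar>f z - s i z\<bar>)" for i using lim.hyps by auto
  have "(\<lambda>i. \<integral>z. \<bar>f z - s i z\<bar> \<partial>N) \<longlonglongrightarrow> (\<integral>z. 0 \<partial>N)"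
  proof (rule integral_dominated_convergence[where w = "\<lambda>z. 3 * \<bar>f z\<bar>"])
    show "AE z in N. (\<lambda>i. \<bar>f z - s i z\<bar>) \<longlonglongrightarrow> 0"
    proof (rule AE_I2)
      fix z assume "z \<in> space N"
      then have "(\<lambda>i. \<bar>f z - s i z\<bar>) \<longlonglongrightarrow> \<bar>f z - f z\<bar>"
        by (intro tendsto_intros lim.hyps)
      then show "(\<lambda>i. \<bar>f z - s i z\<bar>) \<longlonglongrightarrow> 0" by simp
    qed
    show "AE z in N. norm \<bar>f z - s i z\<bar> \<le> 3 * \<bar>f z\<bar>" for i
    proof (rule AE_I2)
      fix z assume "z \<in> space N"
      then have "norm (s i z) \<le> 2 * norm (f z)" by (rule lim.hyps)
      then show "norm \<bar>f z - s i z\<bar> \<le> 3 * \<bar>f z\<bar>" by (auto intro: order_trans[OF abs_triangle_ineq4])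
    qed
  qed (use lim.hyps in auto)
  then have "\<forall>\<^sub>F i in sequentially. (\<integral>z. \<bar>f z - s i z\<bar> \<partial>N) < e / 2"
    using lim.prems by (intro order_tendstoD(2)) auto
  then obtain i where i: "(\<integral>z. \<bar>f z - s i z\<bar> \<partial>N) < e / 2" by (auto dest: eventually_happens)
  obtain k \<rho> where 1: "(\<integral>z. \<bar>s i z - \<rho> (lab k (fst z)) (lab k (snd z))\<bar> \<partial>N) < e / 2"
    using lim.IH[of "e / 2" i] lim.prems by auto
  obtain b where b: "bounded_kernel b (\<lambda>z. \<rho> (lab k (fst z)) (lab k (snd z)))"
    using lab_step_bounded by blast
  note bi = bounded_kernel_integrable[OF b]
  have "(\<integral>z. \<bar>f z - \<rho> (lab k (fst z)) (lab k (snd z))\<bar> \<partial>N)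
     \<le> (\<integral>z. \<bar>f z - s i z\<bar> + \<bar>s i z - \<rho> (lab k (fst z)) (lab k (snd z))\<bar> \<partial>N)"
    by (rule integral_mono) (use bi lim.hyps in auto)
  also have "\<dots> = (\<integral>z. \<bar>f z - s i z\<bar> \<partial>N) + (\<integral>z. \<bar>s i z - \<rho> (lab k (fst z)) (lab k (snd z))\<bar> \<partial>N)"
    by (rule Bochner_Integration.integral_add) (use bi lim.hyps in auto)
  also have "\<dots> < e" using i 1 by simp
  finally show ?case by blast
qed

end

section \<open>Averaging over partitions\<close>

context atomless_space begin

text \<open>Unlike in \<open>finite_partition\<close>, the empty set may be a member, as it may occur in \<open>split_by\<close>.\<close>

definition fpart :: "'a set set \<Rightarrow> bool" where
  "fpart P \<longleftrightarrow> finite P \<and> P \<subseteq> events \<and> disjoint P \<and> \<Union>P = space M"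

definition avg :: "('a \<times> 'a \<Rightarrow> real) \<Rightarrow> 'a set \<Rightarrow> 'a set \<Rightarrow> real" where
  "avg W C D = rect_integral M C D W / (prob C * prob D)"

lemma fpart_events: "fpart P \<Longrightarrow> C \<in> P \<Longrightarrow> C \<in> events"
  by (auto simp: fpart_def)

lemma fpart_finite: "fpart P \<Longrightarrow> finite P"
  by (simp add: fpart_def)

lemma fpart_cell:
  assumes "fpart P" "x \<in> space M"
  obtains C where "C \<in> P" "x \<in> C"
  using assms unfolding fpart_def by blast

lemma fpart_unique: "fpart P \<Longrightarrow> C \<in> P \<Longrightarrow> D \<in> P \<Longrightarrow> x \<in> C \<Longrightarrow> x \<in> D \<Longrightarrow> C = D"
  unfolding fpart_def disjoint_def by blast

lemma fpart_sum_indicator: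
  fixes f :: "'a set \<Rightarrow> real"
  assumes P: "fpart P" and C: "C \<in> P" "x \<in> C"
  shows "(\<Sum>D\<in>P. f D * indicator D x) = f C"
proof -
  have "(\<Sum>D\<in>P. f D * indicator D x) = (\<Sum>D\<in>P. if D = C then f C else 0)"
    using fpart_unique[OF P C(1)] C by (intro sum.cong) (auto simp: indicator_def)
  then show ?thesis using C fpart_finite[OF P] by simp
qed

lemma stepping_value:
  assumes P: "fpart P" and "C \<in> P" "x \<in> C" "D \<in> P" "y \<in> D"
  shows "stepping M W P (x, y) = avg W C D"
proof -
  have "stepping M W P (x, y) = (\<Sum>C\<in>P. (\<Sum>D\<in>P. avg W C D * indicator D y) * indicator C x)"
    unfolding stepping_def avg_def sum_distrib_right
    by (intro sum.cong refl) (auto simp: indicator_def)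
  then show ?thesis using assms by (simp add: fpart_sum_indicator)
qed

lemma stepping_measurable [measurable]:
  assumes "fpart P"
  shows "stepping M W P \<in> borel_measurable N"
proof -
  have [measurable]: "C \<in> events" if "C \<in> P" for C using fpart_events[OF assms that] .
  show ?thesis unfolding stepping_def by measurable
qed

lemma stepping_diff:
  assumes "fpart P" "bounded_kernel a X" "bounded_kernel b Y"
  shows "stepping M (\<lambda>z. X z - Y z) P z = stepping M X P z - stepping M Y P z"
proof -
  have "rect_integral M C D (\<lambda>z. X z - Y z) = rect_integral M C D X - rect_integral M C D Y"
    if "C \<in> P" "D \<in> P" for C D
    using that assms by (intro rect_integral_diff fpart_events)
  then show ?thesis
    unfolding stepping_def sum_subtractf[symmetric]
    by (intro sum.cong refl) (simp add: diff_divide_distrib left_diff_distrib)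
qed

lemma abs_avg_le:
  assumes Y: "bounded_kernel b Y" and [measurable]: "C \<in> events" "D \<in> events"
  shows "\<bar>rect_integral M C D Y\<bar> \<le> b * (prob C * prob D)" "\<bar>avg Y C D\<bar> \<le> b"
proof -
  have "\<bar>rect_integral M C D Y\<bar> \<le> (\<integral>z. \<bar>indicator (C \<times> D) z * Y z\<bar> \<partial>N)"
    unfolding rect_integral_eq using integral_abs_bound by blast
  also have "\<dots> \<le> (\<integral>z. b * indicator (C \<times> D) z \<partial>N)"
  proof (rule integral_mono)
    show "integrable N (\<lambda>z. \<bar>indicator (C \<times> D) z * Y z\<bar>)"
      by (intro integrable_abs bounded_kernel_rect[OF Y]) simp_all
    show "integrable N (\<lambda>z. b * indicator (C \<times> D) z)"
      by (intro integrable_mult_right integrable_indicator_N) simp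
    show "\<bar>indicator (C \<times> D) z * Y z\<bar> \<le> b * indicator (C \<times> D) z" if "z \<in> space N" for z
      using bounded_kernel_bound[OF Y that] by (simp add: indicator_def)
  qed
  also have "\<dots> = b * (prob C * prob D)" by (simp add: measure_rect)
  finally show 1: "\<bar>rect_integral M C D Y\<bar> \<le> b * (prob C * prob D)" .
  show "\<bar>avg Y C D\<bar> \<le> b"
    unfolding avg_def abs_divide using 1 bounded_kernel_nonneg[OF Y]
    by (cases "prob C * prob D = 0") (auto simp: divide_le_eq zero_less_measure_iff zero_less_mult_iff measure_nonneg)
qed

lemma rect_integral_null:
  assumes Y: "bounded_kernel b Y" "C \<in> events" "D \<in> events" "prob C * prob D = 0"
  shows "rect_integral M C D Y = 0"
  using abs_avg_le(1)[OF Y(1-3)] Y(4) by simp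

text \<open>On a null rectangle both sides are 0: the integral vanishes, and the average is 0 by
  division by zero.\<close>

lemma avg_times:
  assumes "bounded_kernel b Y" "C \<in> events" "D \<in> events"
  shows "avg Y C D * (prob C * prob D) = rect_integral M C D Y"
  using rect_integral_null[OF assms] by (cases "prob C * prob D = 0") (auto simp: avg_def)

lemma stepping_bounded_kernel:
  assumes P: "fpart P" and Y: "bounded_kernel b Y"
  shows "bounded_kernel b (stepping M Y P)"
  unfolding bounded_kernel_def
proof (intro conjI ballI)
  fix z assume "z \<in> space N"
  then obtain x y where z: "z = (x, y)" "x \<in> space M" "y \<in> space M"
    by (auto simp: space_pair_measure)
  obtain C D where CD: "C \<in> P" "x \<in> C" "D \<in> P" "y \<in> D"
    using fpart_cell[OF P] z by metis
  then show "\<bar>stepping M Y P z\<bar> \<le> b"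
    unfolding z stepping_value[OF P CD] by (intro abs_avg_le Y fpart_events[OF P])
qed (rule stepping_measurable[OF P])

lemma rect_integral_swap:
  assumes W: "W \<in> graphons M" and [measurable]: "C \<in> events" "D \<in> events"
  shows "rect_integral M C D W = rect_integral M D C W"
proof -
  have [measurable]: "W \<in> borel_measurable N" using W by (simp add: graphons_def)
  have "rect_integral M D C W = (\<integral>(x, y). indicator (D \<times> C) (y, x) * W (y, x) \<partial>N)"
    unfolding rect_integral_eq
    by (rule P.integral_product_swap[symmetric]) measurable
  also have "\<dots> = rect_integral M C D W"
    unfolding rect_integral_eq using W
    by (intro Bochner_Integration.integral_cong) (auto simp: graphons_def space_pair_measure indicator_def)
  finally show ?thesis by simp
qed

lemma rect_integral_graphon_bounds:
  assumes W: "W \<in> graphons M" and "C \<in> events" "D \<in> events"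
  shows "0 \<le> rect_integral M C D W" "0 \<le> avg W C D" "avg W C D \<le> 1"
proof -
  show 1: "0 \<le> rect_integral M C D W"
    unfolding rect_integral_eq using W
    by (intro integral_nonneg_AE AE_I2) (auto simp: graphons_def space_pair_measure)
  show "0 \<le> avg W C D" unfolding avg_def using 1 by (intro divide_nonneg_nonneg) auto
  show "avg W C D \<le> 1" using abs_avg_le(2)[OF graphon_bounded_kernel[OF W] assms(2,3)] by simp
qed

lemma stepping_graphon:
  assumes P: "fpart P" and W: "W \<in> graphons M"
  shows "stepping M W P \<in> graphons M"
  unfolding graphons_def
proof (intro CollectI conjI ballI stepping_measurable[OF P])
  fix x y assume "x \<in> space M" "y \<in> space M"
  then obtain C D where CD: "C \<in> P" "x \<in> C" "D \<in> P" "y \<in> D"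
    using fpart_cell[OF P] by metis
  note ev = fpart_events[OF P CD(1)] fpart_events[OF P CD(3)]
  show "stepping M W P (x, y) = stepping M W P (y, x)"
    unfolding stepping_value[OF P CD] stepping_value[OF P CD(3,4,1,2)] avg_def
    using rect_integral_swap[OF W ev] by (simp add: mult.commute)
  show "0 \<le> stepping M W P (x, y)" "stepping M W P (x, y) \<le> 1"
    unfolding stepping_value[OF P CD] using rect_integral_graphon_bounds[OF W ev] by auto
qed

lemma integral_stepping_mult:
  assumes P: "fpart P" and K: "bounded_kernel b K"
  shows "(\<integral>z. stepping M W P z * K z \<partial>N) = (\<Sum>C\<in>P. \<Sum>D\<in>P. avg W C D * rect_integral M C D K)"
proof -
  have ev: "C \<in> events" if "C \<in> P" for C using fpart_events[OF P that] .
  have int: "integrable N (\<lambda>z. indicator (C \<times> D) z * K z)" if "C \<in> P" "D \<in> P" for C D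
    using that by (intro bounded_kernel_rect[OF K] ev)
  have "(\<integral>z. stepping M W P z * K z \<partial>N)
      = (\<integral>z. (\<Sum>C\<in>P. \<Sum>D\<in>P. avg W C D * (indicator (C \<times> D) z * K z)) \<partial>N)"
    unfolding stepping_def avg_def by (simp add: sum_distrib_right mult.assoc)
  also have "\<dots> = (\<Sum>C\<in>P. \<integral>z. (\<Sum>D\<in>P. avg W C D * (indicator (C \<times> D) z * K z)) \<partial>N)"
    by (rule Bochner_Integration.integral_sum)
      (intro Bochner_Integration.integrable_sum integrable_mult_right int)
  also have "\<dots> = (\<Sum>C\<in>P. \<Sum>D\<in>P. \<integral>z. avg W C D * (indicator (C \<times> D) z * K z) \<partial>N)"
    by (intro sum.cong refl Bochner_Integration.integral_sum integrable_mult_right int)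
  also have "\<dots> = (\<Sum>C\<in>P. \<Sum>D\<in>P. avg W C D * rect_integral M C D K)"
    unfolding rect_integral_eq by simp
  finally show ?thesis .
qed

lemma rect_integral_indicator:
  assumes [measurable]: "C \<in> events" "D \<in> events" "S \<in> events" "T \<in> events"
  shows "rect_integral M C D (indicator (S \<times> T)) = prob (S \<inter> C) * prob (T \<inter> D)"
proof -
  have "rect_integral M C D (indicator (S \<times> T)) = (\<integral>z. indicator ((S \<inter> C) \<times> (T \<inter> D)) z \<partial>N)"
    unfolding rect_integral_eq by (intro Bochner_Integration.integral_cong) (auto simp: indicator_def)
  also have "\<dots> = measure N ((S \<inter> C) \<times> (T \<inter> D))" by simp
  finally show ?thesis by (simp add: measure_rect)
qed

lemma rect_integral_stepping:
  assumes P: "fpart P" and S [measurable]: "S \<in> events" and T [measurable]: "T \<in> events"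
  shows "rect_integral M S T (stepping M W P)
    = (\<Sum>C\<in>P. \<Sum>D\<in>P. avg W C D * (prob (S \<inter> C) * prob (T \<inter> D)))"
proof -
  have "rect_integral M C D (indicator (S \<times> T)) = prob (S \<inter> C) * prob (T \<inter> D)" if "C \<in> P" "D \<in> P" for C D
    using that by (intro rect_integral_indicator fpart_events[OF P] S T)
  moreover have "rect_integral M S T (stepping M W P) = (\<integral>z. stepping M W P z * indicator (S \<times> T) z \<partial>N)"
    unfolding rect_integral_eq by (simp add: mult.commute)
  ultimately show ?thesis
    by (simp add: integral_stepping_mult[OF P bounded_kernel_indicator])
qed

lemma rect_integral_split:
  assumes P: "fpart P" and Y: "bounded_kernel b Y" and S: "S \<in> events" and T: "T \<in> events"
  shows "rect_integral M S T Y = (\<Sum>C\<in>P. \<Sum>D\<in>P. rect_integral M (S \<inter> C) (T \<inter> D) Y)"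
proof -
  have ev: "C \<in> events" if "C \<in> P" for C using fpart_events[OF P that] .
  have int: "integrable N (\<lambda>z. indicator ((S \<inter> C) \<times> (T \<inter> D)) z * Y z)" if "C \<in> P" "D \<in> P" for C D
    by (rule bounded_kernel_rect[OF Y sets.Int[OF S ev] sets.Int[OF T ev]]) (use that in auto)
  have "rect_integral M S T Y = (\<integral>z. (\<Sum>C\<in>P. \<Sum>D\<in>P. indicator ((S \<inter> C) \<times> (T \<inter> D)) z * Y z) \<partial>N)"
    unfolding rect_integral_eq
  proof (rule Bochner_Integration.integral_cong[OF refl])
    fix z assume "z \<in> space N"
    then obtain x y where z: "z = (x, y)" "x \<in> space M" "y \<in> space M"
      by (auto simp: space_pair_measure)
    obtain C D where CD: "C \<in> P" "x \<in> C" "D \<in> P" "y \<in> D"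
      using fpart_cell[OF P] z by metis
    have "(\<Sum>C\<in>P. \<Sum>D\<in>P. indicator ((S \<inter> C) \<times> (T \<inter> D)) z * Y z)
        = (\<Sum>C\<in>P. (\<Sum>D\<in>P. (indicator (S \<times> T) z * Y z) * indicator D y) * indicator C x)"
      unfolding sum_distrib_right by (intro sum.cong refl) (auto simp: indicator_def z)
    also have "\<dots> = indicator (S \<times> T) z * Y z"
      using CD by (simp add: fpart_sum_indicator[OF P])
    finally show "indicator (S \<times> T) z * Y z = (\<Sum>C\<in>P. \<Sum>D\<in>P. indicator ((S \<inter> C) \<times> (T \<inter> D)) z * Y z)" by simp
  qed
  also have "\<dots> = (\<Sum>C\<in>P. \<integral>z. (\<Sum>D\<in>P. indicator ((S \<inter> C) \<times> (T \<inter> D)) z * Y z) \<partial>N)"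
    by (intro Bochner_Integration.integral_sum Bochner_Integration.integrable_sum int)
  also have "\<dots> = (\<Sum>C\<in>P. \<Sum>D\<in>P. rect_integral M (S \<inter> C) (T \<inter> D) Y)"
    unfolding rect_integral_eq by (intro sum.cong refl Bochner_Integration.integral_sum int)
  finally show ?thesis .
qed

text \<open>Unions of cells cannot tell a kernel from its averages, since an average times the area
  of its cell rectangle is the integral over it.\<close>

lemma rect_integral_stepping_compat:
  assumes P: "fpart P" and Y: "bounded_kernel b Y" and S: "S \<in> events" and T: "T \<in> events"
    and cS: "\<And>C. C \<in> P \<Longrightarrow> C \<subseteq> S \<or> C \<inter> S = {}" and cT: "\<And>C. C \<in> P \<Longrightarrow> C \<subseteq> T \<or> C \<inter> T = {}"
  shows "rect_integral M S T (stepping M Y P) = rect_integral M S T Y"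
  unfolding rect_integral_stepping[OF P S T] rect_integral_split[OF P Y S T]
proof (intro sum.cong refl)
  fix C D assume CD: "C \<in> P" "D \<in> P"
  note ev = fpart_events[OF P CD(1)] fpart_events[OF P CD(2)]
  have 1: "S \<inter> C = {} \<or> S \<inter> C = C" "T \<inter> D = {} \<or> T \<inter> D = D" using cS[OF CD(1)] cT[OF CD(2)] by auto
  have 0: "rect_integral M {} D' Y = 0" "rect_integral M C' {} Y = 0" for C' D'
    unfolding rect_integral_eq by simp_all
  show "avg Y C D * (prob (S \<inter> C) * prob (T \<inter> D)) = rect_integral M (S \<inter> C) (T \<inter> D) Y"
    using 1 avg_times[OF Y ev] by (auto simp: 0)
qed

lemma stepping_cong:
  assumes "\<And>C D. C \<in> P \<Longrightarrow> D \<in> P \<Longrightarrow> rect_integral M C D X = rect_integral M C D Y"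
  shows "stepping M X P = stepping M Y P"
  unfolding stepping_def by (intro ext sum.cong refl) (simp add: assms)

text \<open>Tower property of conditional expectations: by \<open>ref\<close>, a cell of
  \<open>P\<close> is a union of cells of \<open>Q\<close>, so the inner averaging keeps the
  integrals over it.\<close>

lemma stepping_stepping:
  assumes P: "fpart P" and Q: "fpart Q" and Y: "bounded_kernel b Y"
    and ref: "\<And>C D. C \<in> P \<Longrightarrow> D \<in> Q \<Longrightarrow> D \<subseteq> C \<or> D \<inter> C = {}"
  shows "stepping M (stepping M Y Q) P = stepping M Y P"
  by (rule stepping_cong, rule rect_integral_stepping_compat[OF Q Y])
    (use ref fpart_events[OF P] in auto)

lemma stepping_idem:
  assumes P: "fpart P" and Y: "bounded_kernel b Y"
  shows "stepping M (stepping M Y P) P = stepping M Y P"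
  using fpart_unique[OF P] by (intro stepping_stepping[OF P P Y]) blast

text \<open>Both integrals are the same sum over cell rectangles, of the product of the two
  integrals divided by the area.\<close>

lemma stepping_self_adjoint:
  assumes P: "fpart P" and X: "bounded_kernel a X" and Y: "bounded_kernel b Y"
  shows "(\<integral>z. stepping M X P z * Y z \<partial>N) = (\<integral>z. X z * stepping M Y P z \<partial>N)"
proof -
  have "(\<integral>z. stepping M X P z * Y z \<partial>N) = (\<integral>z. stepping M Y P z * X z \<partial>N)"
    unfolding integral_stepping_mult[OF P X] integral_stepping_mult[OF P Y]
    by (simp add: avg_def mult.commute)
  then show ?thesis by (simp add: mult.commute)
qed

lemma integral_diff_square:
  assumes X: "bounded_kernel a X" and Y: "bounded_kernel b Y"
  shows "(\<integral>z. (X z - Y z)\<^sup>2 \<partial>N) = (\<integral>z. (X z)\<^sup>2 \<partial>N) - 2 * (\<integral>z. X z * Y z \<partial>N) + (\<integral>z. (Y z)\<^sup>2 \<partial>N)"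
proof -
  note i = bounded_kernel_integrable[OF bounded_kernel_mult[OF X X]]
    bounded_kernel_integrable[OF bounded_kernel_mult[OF Y Y]]
    bounded_kernel_integrable[OF bounded_kernel_mult[OF X Y]]
  have "(\<integral>z. (X z - Y z)\<^sup>2 \<partial>N) = (\<integral>z. (X z * X z - 2 * (X z * Y z)) + Y z * Y z \<partial>N)"
    by (intro Bochner_Integration.integral_cong refl) (simp add: power2_eq_square algebra_simps)
  also have "\<dots> = (\<integral>z. X z * X z - 2 * (X z * Y z) \<partial>N) + (\<integral>z. Y z * Y z \<partial>N)"
    by (rule Bochner_Integration.integral_add)
      (intro Bochner_Integration.integrable_diff integrable_mult_right i)+
  also have "(\<integral>z. X z * X z - 2 * (X z * Y z) \<partial>N) = (\<integral>z. X z * X z \<partial>N) - (\<integral>z. 2 * (X z * Y z) \<partial>N)"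
    by (rule Bochner_Integration.integral_diff) (intro integrable_mult_right i)+
  finally show ?thesis by (simp add: power2_eq_square)
qed

text \<open>Averaging is self-adjoint and idempotent, thus an orthogonal projection of L2.\<close>

lemma stepping_pythagoras:
  assumes P: "fpart P" and Y: "bounded_kernel b Y"
  shows "(\<integral>z. (Y z - stepping M Y P z)\<^sup>2 \<partial>N) = (\<integral>z. (Y z)\<^sup>2 \<partial>N) - (\<integral>z. (stepping M Y P z)\<^sup>2 \<partial>N)"
proof -
  note sY = stepping_bounded_kernel[OF P Y]
  have "(\<integral>z. (stepping M Y P z)\<^sup>2 \<partial>N) = (\<integral>z. Y z * stepping M Y P z \<partial>N)"
    using stepping_self_adjoint[OF P Y sY] by (simp add: power2_eq_square stepping_idem[OF P Y])
  then show ?thesis unfolding integral_diff_square[OF Y sY] by simp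
qed

lemma stepping_square_le:
  assumes P: "fpart P" and Y: "bounded_kernel b Y"
  shows "(\<integral>z. (stepping M Y P z)\<^sup>2 \<partial>N) \<le> (\<integral>z. (Y z)\<^sup>2 \<partial>N)"
proof -
  have "0 \<le> (\<integral>z. (Y z - stepping M Y P z)\<^sup>2 \<partial>N)" by simp
  then show ?thesis using stepping_pythagoras[OF P Y] by simp
qed

text \<open>Nonnegativity of the variance of \<open>\<bar>Y z\<bar>\<close>.\<close>

lemma L1_le_L2:
  assumes Y: "bounded_kernel b Y"
  shows "(\<integral>z. \<bar>Y z\<bar> \<partial>N)\<^sup>2 \<le> (\<integral>z. (Y z)\<^sup>2 \<partial>N)"
proof -
  define m where "m = (\<integral>z. \<bar>Y z\<bar> \<partial>N)"
  have aY: "bounded_kernel b (\<lambda>z. \<bar>Y z\<bar>)" and cm: "bounded_kernel \<bar>m\<bar> (\<lambda>_. m)"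
    using Y by (auto simp: bounded_kernel_def)
  have "0 \<le> (\<integral>z. (\<bar>Y z\<bar> - m)\<^sup>2 \<partial>N)" by simp
  also have "\<dots> = (\<integral>z. (Y z)\<^sup>2 \<partial>N) - 2 * m * m + m\<^sup>2"
    unfolding integral_diff_square[OF aY cm] by (simp add: m_def P.prob_space)
  finally show ?thesis by (simp add: power2_eq_square m_def)
qed

lemma cut_norm_square_le:
  assumes Y: "bounded_kernel b Y"
  shows "(cut_norm M Y)\<^sup>2 \<le> (\<integral>z. (Y z)\<^sup>2 \<partial>N)"
  using power_mono[OF cut_norm_le_L1[OF Y] cut_norm_nonneg[OF Y], of 2] L1_le_L2[OF Y] by linarith

lemma vimage_fpart:
  assumes \<phi>: "\<phi> \<in> mp_bijections M" and P: "fpart P"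
  shows "fpart ((\<lambda>C. \<phi> -` C \<inter> space M) ` P)"
proof -
  note [measurable] = mp_measurable[OF \<phi>]
  have "\<phi> x \<in> space M" if "x \<in> space M" for x
    using mp_measurable[OF \<phi>] that by (rule measurable_space)
  then have U: "(\<Union>C\<in>P. \<phi> -` C \<inter> space M) = space M"
    using P unfolding fpart_def by (auto simp: set_eq_iff)
  have ev: "\<phi> -` C \<inter> space M \<in> events" if "C \<in> P" for C
    using fpart_events[OF P that] by measurable
  have dis: "(\<phi> -` C \<inter> space M) \<inter> (\<phi> -` D \<inter> space M) = {}" if "C \<in> P" "D \<in> P" "C \<noteq> D" for C D
    using fpart_unique[OF P that(1,2)] that(3) by blast
  have "disjoint ((\<lambda>C. \<phi> -` C \<inter> space M) ` P)"
    unfolding disjoint_def by (intro ballI impI; elim imageE; hypsubst; rule dis) blast+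
  then show ?thesis
    unfolding fpart_def using U ev fpart_finite[OF P] by (simp add: image_subset_iff)
qed

text \<open>Cells correspond through \<open>\<phi>\<close> with the same measures and integrals, so
  averaging commutes with relabelling once the partition is pulled back too.\<close>

lemma stepping_pullback:
  assumes \<phi>: "\<phi> \<in> mp_bijections M" and P: "fpart P" and Y [measurable]: "Y \<in> borel_measurable N"
    and z: "z \<in> space N"
  shows "stepping M (pullback Y \<phi>) ((\<lambda>C. \<phi> -` C \<inter> space M) ` P) z = pullback (stepping M Y P) \<phi> z"
proof -
  obtain x y where xy: "z = (x, y)" "x \<in> space M" "y \<in> space M"
    using z by (auto simp: space_pair_measure)
  have sp: "\<phi> x \<in> space M" "\<phi> y \<in> space M"
    using mp_measurable[OF \<phi>] xy by (auto intro: measurable_space)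
  obtain C D where CD: "C \<in> P" "\<phi> x \<in> C" "D \<in> P" "\<phi> y \<in> D"
    using fpart_cell[OF P] sp by metis
  have ev: "C \<in> events" "D \<in> events" using fpart_events[OF P] CD by auto
  have "stepping M (pullback Y \<phi>) ((\<lambda>C. \<phi> -` C \<inter> space M) ` P) (x, y)
      = avg (pullback Y \<phi>) (\<phi> -` C \<inter> space M) (\<phi> -` D \<inter> space M)"
    by (rule stepping_value[OF vimage_fpart[OF \<phi> P]]) (use CD xy in auto)
  also have "\<dots> = avg Y C D"
    unfolding avg_def rect_integral_pullback[OF \<phi> Y ev] by (simp add: mp_vimage_measure[OF \<phi>] ev)
  also have "\<dots> = pullback (stepping M Y P) \<phi> (x, y)"
    using stepping_value[OF P CD] by (simp add: pullback_def)
  finally show ?thesis by (simp add: xy)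
qed

end

text \<open>A linear function on the cube attains its extreme values at vertices: the positive terms
  give an upper bound, the negative ones a lower bound.\<close>

lemma sum_weights_le_subset:
  fixes f s :: "'i \<Rightarrow> real"
  assumes "finite I" "\<And>i. i \<in> I \<Longrightarrow> 0 \<le> s i" "\<And>i. i \<in> I \<Longrightarrow> s i \<le> 1"
  shows "\<exists>J\<subseteq>I. \<bar>\<Sum>i\<in>I. s i * f i\<bar> \<le> \<bar>\<Sum>i\<in>J. f i\<bar>"
proof -
  define J where "J = {i \<in> I. 0 < f i}"
  define K where "K = {i \<in> I. f i < 0}"
  have J: "(\<Sum>i\<in>I. s i * f i) \<le> (\<Sum>i\<in>J. f i)"
  proof -
    have "(\<Sum>i\<in>I. s i * f i) \<le> (\<Sum>i\<in>I. if 0 < f i then f i else 0)"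
      using assms by (intro sum_mono) (auto simp: mult_left_le_one_le mult_nonneg_nonpos)
    then show ?thesis using assms(1) by (simp add: J_def sum.inter_filter)
  qed
  have K: "(\<Sum>i\<in>K. f i) \<le> (\<Sum>i\<in>I. s i * f i)"
  proof -
    have "(\<Sum>i\<in>I. if f i < 0 then f i else 0) \<le> (\<Sum>i\<in>I. s i * f i)"
    proof (rule sum_mono)
      fix i assume "i \<in> I"
      then have "0 \<le> s i" "s i \<le> 1" using assms by auto
      then show "(if f i < 0 then f i else 0) \<le> s i * f i"
        using mult_right_mono_neg[of "s i" 1 "f i"] by (auto simp: not_less)
    qed
    then show ?thesis using assms(1) by (simp add: K_def sum.inter_filter)
  qed
  show ?thesis
  proof (cases "0 \<le> (\<Sum>i\<in>I. s i * f i)")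
    case True
    then show ?thesis using J by (intro exI[of _ J]) (auto simp: J_def)
  next
    case False
    then show ?thesis using K by (intro exI[of _ K]) (auto simp: K_def)
  qed
qed

context atomless_space begin

text \<open>Averages see a rectangle only through the shares of \<open>S\<close> and
  \<open>T\<close> in each cell. The integral is bilinear in these shares, so first one family and
  then the other can be replaced by 0-1 values without lowering its absolute value. Then both sides
  are unions of cells, on which \<open>Y\<close> and its averages have the same integrals.\<close>

lemma cut_norm_stepping_le:
  assumes P: "fpart P" and Y: "bounded_kernel b Y"
  shows "cut_norm M (stepping M Y P) \<le> cut_norm M Y"
proof (rule cut_norm_leI)
  fix S T assume S: "S \<in> events" and T: "T \<in> events"
  have ev: "C \<in> events" if "C \<in> P" for C using fpart_events[OF P that] .
  note fin = fpart_finite[OF P]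
  define s where "s C = prob (S \<inter> C) / prob C" for C
  define t where "t C = prob (T \<inter> C) / prob C" for C
  have st: "0 \<le> s C" "s C \<le> 1" "0 \<le> t C" "t C \<le> 1" if "C \<in> P" for C
    using ev[OF that] finite_measure_mono[of "S \<inter> C" C] finite_measure_mono[of "T \<inter> C" C]
    by (auto simp: s_def t_def divide_le_eq_1 zero_less_measure_iff measure_nonneg)
  have "rect_integral M S T (stepping M Y P) = (\<Sum>C\<in>P. s C * (\<Sum>D\<in>P. t D * rect_integral M C D Y))"
    unfolding rect_integral_stepping[OF P S T] sum_distrib_left
    by (intro sum.cong refl) (simp add: avg_def s_def t_def)
  then obtain J where J: "J \<subseteq> P" and 1: "\<bar>rect_integral M S T (stepping M Y P)\<bar>
      \<le> \<bar>\<Sum>C\<in>J. \<Sum>D\<in>P. t D * rect_integral M C D Y\<bar>"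
    using sum_weights_le_subset[OF fin, of s "\<lambda>C. \<Sum>D\<in>P. t D * rect_integral M C D Y"] st by auto
  have "(\<Sum>C\<in>J. \<Sum>D\<in>P. t D * rect_integral M C D Y) = (\<Sum>D\<in>P. t D * (\<Sum>C\<in>J. rect_integral M C D Y))"
    by (subst sum.swap) (simp add: sum_distrib_left)
  then obtain K where K: "K \<subseteq> P" and 2: "\<bar>\<Sum>C\<in>J. \<Sum>D\<in>P. t D * rect_integral M C D Y\<bar>
      \<le> \<bar>\<Sum>D\<in>K. \<Sum>C\<in>J. rect_integral M C D Y\<bar>"
    using sum_weights_le_subset[OF fin, of t "\<lambda>D. \<Sum>C\<in>J. rect_integral M C D Y"] st by auto
  have U: "\<Union>J \<in> events" "\<Union>K \<in> events"
    using J K ev fin by (auto intro!: sets.finite_Union intro: finite_subset)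
  have Int: "\<Union>L \<inter> C = (if C \<in> L then C else {})" if "L \<subseteq> P" "C \<in> P" for L C
    using that fpart_unique[OF P] by auto
  have 0: "rect_integral M {} D' Y = 0" "rect_integral M C' {} Y = 0" for C' D'
    unfolding rect_integral_eq by simp_all
  have "rect_integral M (\<Union>J) (\<Union>K) Y
      = (\<Sum>C\<in>P. \<Sum>D\<in>P. if C \<in> J then (if D \<in> K then rect_integral M C D Y else 0) else 0)"
    unfolding rect_integral_split[OF P Y U] using J K
    by (intro sum.cong refl) (simp add: Int 0)
  also have "\<dots> = (\<Sum>C\<in>P. if C \<in> J then (\<Sum>D\<in>P. if D \<in> K then rect_integral M C D Y else 0) else 0)"
    by (intro sum.cong refl) simp
  also have "\<dots> = (\<Sum>C\<in>J. \<Sum>D\<in>K. rect_integral M C D Y)"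
    using J K fin by (simp add: sum.inter_restrict[symmetric] Int_absorb1)
  finally have "(\<Sum>D\<in>K. \<Sum>C\<in>J. rect_integral M C D Y) = rect_integral M (\<Union>J) (\<Union>K) Y"
    by (simp add: sum.swap[of _ K])
  then show "\<bar>rect_integral M S T (stepping M Y P)\<bar> \<le> cut_norm M Y"
    using 1 2 rect_le_cut_norm[OF Y U] by simp
qed

end

section \<open>Weak* convergence and envelopes\<close>

text \<open>The comparison sequence may depend on the error \<open>e\<close>; uniformity in
  \<open>n\<close> is what makes this enough.\<close>

lemma tendsto_uniform_approx:
  fixes f :: "nat \<Rightarrow> real"
  assumes "\<And>e. 0 < e \<Longrightarrow> \<exists>u L. u \<longlonglongrightarrow> L \<and> (\<forall>n. \<bar>f n - u n\<bar> \<le> e) \<and> \<bar>l - L\<bar> \<le> e"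
  shows "f \<longlonglongrightarrow> l"
proof (rule LIMSEQ_I)
  fix r :: real assume r: "0 < r"
  obtain u L where u: "u \<longlonglongrightarrow> L" "\<And>n. \<bar>f n - u n\<bar> \<le> r / 4" "\<bar>l - L\<bar> \<le> r / 4"
    using assms[of "r / 4"] r by auto
  obtain n0 where n0: "\<And>n. n \<ge> n0 \<Longrightarrow> norm (u n - L) < r / 4"
    using LIMSEQ_D[OF u(1), of "r / 4"] r by auto
  have "norm (f n - l) < r" if "n \<ge> n0" for n
    using n0[OF that] u(2)[of n] u(3) r unfolding real_norm_def by linarith
  then show "\<exists>no. \<forall>n\<ge>no. norm (f n - l) < r" by blast
qed

context atomless_space begin

definition dyadic :: "nat \<Rightarrow> 'a set set" where
  "dyadic k = cell k ` {..<2 ^ k}"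

lemma cell_disjoint: "i \<noteq> j \<Longrightarrow> cell k i \<inter> cell k j = {}"
  by (auto simp: cell_def)

lemma fpart_dyadic: "fpart (dyadic k)"
  unfolding fpart_def
proof (intro conjI)
  show "disjoint (dyadic k)"
    unfolding disjoint_def dyadic_def by (auto simp: cell_def)
  show "\<Union> (dyadic k) = space M"
    using lab_less[of k] by (auto simp: dyadic_def cell_def)
qed (auto simp: dyadic_def)

lemma dyadic_refines:
  assumes "k \<le> l" "C \<in> dyadic k" "D \<in> dyadic l"
  shows "D \<subseteq> C \<or> D \<inter> C = {}"
proof -
  have "lab k x = lab l x div 2 ^ (l - k)" for x
    using lab_div[of k x "l - k"] assms(1) by simp
  then show ?thesis using assms(2,3) by (auto simp: dyadic_def cell_def)
qed

lemma sum_cell_indicator: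
  fixes f :: "nat \<Rightarrow> real"
  assumes "x \<in> space M"
  shows "(\<Sum>i<2^k. f i * indicator (cell k i) x) = f (lab k x)"
proof -
  have "(\<Sum>i<2^k. f i * indicator (cell k i) x) = (\<Sum>i<2^k. if i = lab k x then f i else 0)"
    using assms by (intro sum.cong) (auto simp: cell_def)
  then show ?thesis using lab_less[of k x] by simp
qed

lemma integral_lab_step:
  assumes Y: "bounded_kernel b Y"
  shows "(\<integral>z. \<rho> (lab k (fst z)) (lab k (snd z)) * Y z \<partial>N)
    = (\<Sum>i<2^k. \<Sum>j<2^k. \<rho> i j * rect_integral M (cell k i) (cell k j) Y)"
proof -
  have int: "integrable N (\<lambda>z. indicator (cell k i \<times> cell k j) z * Y z)" for i j
    by (rule bounded_kernel_rect[OF Y]) simp_all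
  have "(\<integral>z. \<rho> (lab k (fst z)) (lab k (snd z)) * Y z \<partial>N)
      = (\<integral>z. (\<Sum>i<2^k. \<Sum>j<2^k. \<rho> i j * (indicator (cell k i \<times> cell k j) z * Y z)) \<partial>N)"
  proof (rule Bochner_Integration.integral_cong[OF refl])
    fix z assume "z \<in> space N"
    then obtain x y where z: "z = (x, y)" "x \<in> space M" "y \<in> space M"
      by (auto simp: space_pair_measure)
    have "(\<Sum>i<2^k. \<Sum>j<2^k. \<rho> i j * (indicator (cell k i \<times> cell k j) z * Y z))
      = (\<Sum>i<2^k. (\<Sum>j<2^k. \<rho> i j * Y z * indicator (cell k j) y) * indicator (cell k i) x)"
      unfolding sum_distrib_right by (intro sum.cong refl) (auto simp: indicator_def z(1))
    also have "\<dots> = \<rho> (lab k x) (lab k y) * Y z"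
      unfolding sum_cell_indicator[OF z(3)] sum_cell_indicator[OF z(2)] ..
    finally show "\<rho> (lab k (fst z)) (lab k (snd z)) * Y z
      = (\<Sum>i<2^k. \<Sum>j<2^k. \<rho> i j * (indicator (cell k i \<times> cell k j) z * Y z))"
      by (simp only: z(1) fst_conv snd_conv)
  qed
  also have "\<dots> = (\<Sum>i<2^k. \<integral>z. (\<Sum>j<2^k. \<rho> i j * (indicator (cell k i \<times> cell k j) z * Y z)) \<partial>N)"
    by (rule Bochner_Integration.integral_sum)
      (intro Bochner_Integration.integrable_sum integrable_mult_right int)
  also have "\<dots> = (\<Sum>i<2^k. \<Sum>j<2^k. \<integral>z. \<rho> i j * (indicator (cell k i \<times> cell k j) z * Y z) \<partial>N)"
    by (intro sum.cong refl Bochner_Integration.integral_sum integrable_mult_right int)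
  finally show ?thesis unfolding rect_integral_eq by simp
qed

lemma rect_integral_lab_step:
  assumes "S \<in> events" "T \<in> events"
  shows "rect_integral M S T (\<lambda>z. \<rho> (lab k (fst z)) (lab k (snd z)))
    = (\<Sum>i<2^k. \<Sum>j<2^k. \<rho> i j * (prob (S \<inter> cell k i) * prob (T \<inter> cell k j)))"
proof -
  have "rect_integral M S T (\<lambda>z. \<rho> (lab k (fst z)) (lab k (snd z)))
      = (\<integral>z. \<rho> (lab k (fst z)) (lab k (snd z)) * indicator (S \<times> T) z \<partial>N)"
    unfolding rect_integral_eq by (simp add: mult.commute)
  then show ?thesis
    using integral_lab_step[OF bounded_kernel_indicator, of "S \<times> T" \<rho> k] assms
    by (simp add: rect_integral_indicator)
qed

lemma rect_integral_lab_sets: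
  assumes "bounded_kernel b Y"
  shows "rect_integral M {x \<in> space M. lab k x \<in> I} {x \<in> space M. lab k x \<in> J} Y
    = (\<Sum>i<2^k. \<Sum>j<2^k. indicator (I \<times> J) (i, j) * rect_integral M (cell k i) (cell k j) Y)"
proof -
  have "rect_integral M {x \<in> space M. lab k x \<in> I} {x \<in> space M. lab k x \<in> J} Y
      = (\<integral>z. indicator (I \<times> J) (lab k (fst z), lab k (snd z)) * Y z \<partial>N)"
    unfolding rect_integral_eq
    by (intro Bochner_Integration.integral_cong) (auto simp: indicator_def space_pair_measure)
  then show ?thesis by (simp only: integral_lab_step[OF assms, of "\<lambda>i j. indicator (I \<times> J) (i, j)"])
qed

lemma lab_set_coarsen:
  assumes "k \<le> l"
  obtains J' where "{x \<in> space M. lab k x \<in> J} = {x \<in> space M. lab l x \<in> J'}"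
proof -
  have "lab k x = lab l x div 2 ^ (l - k)" for x
    using lab_div[of k x "l - k"] assms by simp
  then show ?thesis using that[of "{i. i div 2 ^ (l - k) \<in> J}"] by auto
qed

text \<open>Events are approximated by unions of cells, and the common bound on the kernels makes
  the error the same for all of them.\<close>

lemma weak_star_convI_cells:
  assumes Yn: "\<And>n. bounded_kernel b (Y n)" and Y: "bounded_kernel b Z"
    and lim: "\<And>k i j. (\<lambda>n. rect_integral M (cell k i) (cell k j) (Y n)) \<longlonglongrightarrow> rect_integral M (cell k i) (cell k j) Z"
  shows "weak_star_conv M Y Z"
  unfolding weak_star_conv_def
proof (intro ballI tendsto_uniform_approx)
  fix S T and e :: real assume S [measurable]: "S \<in> events" and T [measurable]: "T \<in> events" and e: "0 < e"
  have b0: "0 \<le> b" using bounded_kernel_nonneg[OF Y] .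
  \<comment> \<open>Changing both sides of a rectangle by \<open>d\<close> costs at most
    \<open>b * (d + d)\<close>; \<open>b + 1\<close> avoids a division by zero.\<close>
  define d where "d = e / (2 * (b + 1))"
  have d: "0 < d" using e b0 by (simp add: d_def)
  have "d * (2 * (b + 1)) = e" using b0 by (simp add: d_def)
  then have bd: "b * (d + d) \<le> e" using d by (simp add: algebra_simps)
  obtain k I where I: "prob {x \<in> space M. (x \<in> S) \<noteq> (lab k x \<in> I)} < d"
    using event_approx[OF S d] by blast
  obtain l J where J: "prob {x \<in> space M. (x \<in> T) \<noteq> (lab l x \<in> J)} < d"
    using event_approx[OF T d] by blast
  define S' where "S' = {x \<in> space M. lab k x \<in> I}"
  define T' where "T' = {x \<in> space M. lab l x \<in> J}"
  have [measurable]: "S' \<in> events" "T' \<in> events" unfolding S'_def T'_def by measurable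
  have "{x \<in> space M. (x \<in> S) \<noteq> (x \<in> S')} = {x \<in> space M. (x \<in> S) \<noteq> (lab k x \<in> I)}"
    "{x \<in> space M. (x \<in> T) \<noteq> (x \<in> T')} = {x \<in> space M. (x \<in> T) \<noteq> (lab l x \<in> J)}"
    by (auto simp: S'_def T'_def)
  then have close: "\<bar>rect_integral M S T X - rect_integral M S' T' X\<bar> \<le> e" if X: "bounded_kernel b X" for X
    using rect_integral_change[OF X S T, of S' T'] I J bd b0
    by (smt (verit) mult_left_mono \<open>S' \<in> events\<close> \<open>T' \<in> events\<close>)
  obtain I' where I': "S' = {x \<in> space M. lab (k + l) x \<in> I'}"
    using lab_set_coarsen[of k "k + l" I] unfolding S'_def by (metis le_add1)
  obtain J' where J': "T' = {x \<in> space M. lab (k + l) x \<in> J'}"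
    using lab_set_coarsen[of l "k + l" J] unfolding T'_def by (metis le_add2)
  have "(\<lambda>n. rect_integral M S' T' (Y n)) \<longlonglongrightarrow> rect_integral M S' T' Z"
    unfolding I' J' rect_integral_lab_sets[OF Yn] rect_integral_lab_sets[OF Y]
    by (intro tendsto_intros lim)
  then show "\<exists>u L. u \<longlonglongrightarrow> L \<and> (\<forall>n. \<bar>rect_integral M S T (Y n) - u n\<bar> \<le> e) \<and> \<bar>rect_integral M S T Z - L\<bar> \<le> e"
    using close[OF Yn] close[OF Y] by blast
qed

text \<open>Level \<open>n\<close> is approximated with error
  \<open>1 / ((real n + 1) * 4 ^ n)\<close>: a rectangle of coarser cells consists of at most
  \<open>4 ^ n\<close> rectangles of that level, so its error is at most
  \<open>1 / (real n + 1)\<close>. One bijection per level is thus a weak* convergent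
  sequence.\<close>

lemma envelopeI_cells:
  assumes W: "W \<in> graphons M" and U: "U \<in> graphons M"
    and approx: "\<And>n e. 0 < e \<Longrightarrow> \<exists>\<pi>\<in>mp_bijections M. \<forall>i<2^n. \<forall>j<2^n.
      \<bar>rect_integral M (cell n i) (cell n j) (pullback W \<pi>) - rect_integral M (cell n i) (cell n j) U\<bar> < e"
  shows "U \<in> envelope M W"
proof -
  have pos: "0 < 1 / ((real n + 1) * 4 ^ n)" for n by simp
  have "\<exists>\<pi>. \<forall>n. \<pi> n \<in> mp_bijections M \<and> (\<forall>i<2^n. \<forall>j<2^n.
      \<bar>rect_integral M (cell n i) (cell n j) (pullback W (\<pi> n)) - rect_integral M (cell n i) (cell n j) U\<bar>
        < 1 / ((real n + 1) * 4 ^ n))"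
    using approx[OF pos] by (intro choice) blast
  then obtain \<pi> where \<pi>: "\<And>n. \<pi> n \<in> mp_bijections M" and close: "\<And>n i j. i < 2 ^ n \<Longrightarrow> j < 2 ^ n \<Longrightarrow>
      \<bar>rect_integral M (cell n i) (cell n j) (pullback W (\<pi> n)) - rect_integral M (cell n i) (cell n j) U\<bar>
        < 1 / ((real n + 1) * 4 ^ n)"
    by blast
  note bk = graphon_bounded_kernel[OF pullback_graphon[OF \<pi> W]] graphon_bounded_kernel[OF U]
  have "weak_star_conv M (\<lambda>n. pullback W (\<pi> n)) U"
  proof (rule weak_star_convI_cells[OF bk])
    fix k i j
    have bound: "\<bar>rect_integral M (cell k i) (cell k j) (pullback W (\<pi> n)) - rect_integral M (cell k i) (cell k j) U\<bar>
        \<le> 1 / (real n + 1)" if nk: "n \<ge> k" for n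
    proof -
      obtain I where I: "cell k i = {x \<in> space M. lab n x \<in> I}"
        using lab_set_coarsen[OF nk, of "{i}"] by (auto simp: cell_def)
      obtain J where J: "cell k j = {x \<in> space M. lab n x \<in> J}"
        using lab_set_coarsen[OF nk, of "{j}"] by (auto simp: cell_def)
      have "\<bar>rect_integral M (cell k i) (cell k j) (pullback W (\<pi> n)) - rect_integral M (cell k i) (cell k j) U\<bar>
        = \<bar>\<Sum>i<2^n. \<Sum>j<2^n. indicator (I \<times> J) (i, j) *
            (rect_integral M (cell n i) (cell n j) (pullback W (\<pi> n)) - rect_integral M (cell n i) (cell n j) U)\<bar>"
        unfolding I J rect_integral_lab_sets[OF bk(1)] rect_integral_lab_sets[OF bk(2)]
        by (simp add: sum_subtractf right_diff_distrib)
      also have "\<dots> \<le> (\<Sum>i<2^n. \<Sum>j<2^n. \<bar>indicator (I \<times> J) (i, j) *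
            (rect_integral M (cell n i) (cell n j) (pullback W (\<pi> n)) - rect_integral M (cell n i) (cell n j) U)\<bar>)"
        by (rule order_trans[OF sum_abs sum_mono[OF sum_abs]])
      also have "\<dots> \<le> (\<Sum>i<2^n::nat. \<Sum>j<2^n::nat. 1 / ((real n + 1) * 4 ^ n))"
        using less_imp_le[OF close] by (intro sum_mono) (auto simp: indicator_def)
      also have "\<dots> = 1 / (real n + 1)"
        by (simp add: power_mult_distrib[symmetric])
      finally show ?thesis .
    qed
    have "(\<lambda>n. 1 / (real n + 1)) \<longlonglongrightarrow> 0"
      using LIMSEQ_inverse_real_of_nat by (simp add: inverse_eq_divide add.commute)
    then have "(\<lambda>n. rect_integral M (cell k i) (cell k j) (pullback W (\<pi> n)) - rect_integral M (cell k i) (cell k j) U) \<longlonglongrightarrow> 0"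
      by (rule Lim_null_comparison[rotated])
        (use bound in \<open>auto simp: eventually_sequentially\<close>)
    then show "(\<lambda>n. rect_integral M (cell k i) (cell k j) (pullback W (\<pi> n))) \<longlonglongrightarrow> rect_integral M (cell k i) (cell k j) U"
      by (rule LIM_zero_cancel)
  qed
  then show ?thesis using U \<pi> by (auto simp: envelope_def)
qed

lemma envelope_refl: "W \<in> graphons M \<Longrightarrow> W \<in> envelope M W"
  unfolding envelope_def weak_star_conv_def pullback_def
  by (auto intro!: exI[of _ "\<lambda>n x. x"] mp_id)

lemma envelope_finite_approx:
  assumes "U \<in> envelope M W" "finite \<S>" "\<S> \<subseteq> events" "0 < e"
  shows "\<exists>\<pi>\<in>mp_bijections M. \<forall>S\<in>\<S>. \<forall>T\<in>\<S>.
    \<bar>rect_integral M S T (pullback W \<pi>) - rect_integral M S T U\<bar> < e"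
proof -
  obtain \<pi> where \<pi>: "\<And>n. \<pi> n \<in> mp_bijections M" and w: "weak_star_conv M (\<lambda>n. pullback W (\<pi> n)) U"
    using assms(1) by (auto simp: envelope_def)
  have "\<forall>\<^sub>F n in sequentially. \<bar>rect_integral M S T (pullback W (\<pi> n)) - rect_integral M S T U\<bar> < e"
    if "S \<in> \<S>" "T \<in> \<S>" for S T
  proof -
    have "(\<lambda>n. rect_integral M S T (pullback W (\<pi> n))) \<longlonglongrightarrow> rect_integral M S T U"
      using w that assms(3) unfolding weak_star_conv_def by blast
    from tendstoD[OF this assms(4)] show ?thesis by (simp add: dist_real_def)
  qed
  then have "\<forall>\<^sub>F n in sequentially. \<forall>S\<in>\<S>. \<forall>T\<in>\<S>.
      \<bar>rect_integral M S T (pullback W (\<pi> n)) - rect_integral M S T U\<bar> < e"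
    by (intro eventually_ball_finite assms(2) ballI)
  then show ?thesis using \<pi> by (auto dest!: eventually_happens)
qed

text \<open>A diagonal argument level by level: \<open>V\<close> is first rearranged to look like
  \<open>U\<close> on the cells, then \<open>W\<close> is rearranged to look like \<open>V\<close>
  on the finitely many images of these cells.\<close>

lemma envelope_trans:
  assumes W: "W \<in> graphons M" and V: "V \<in> envelope M W" and U: "U \<in> envelope M V"
  shows "U \<in> envelope M W"
proof (rule envelopeI_cells[OF W])
  show "U \<in> graphons M" using U by (simp add: envelope_def)
  have Vg: "V \<in> graphons M" using V by (simp add: envelope_def)
  have [measurable]: "V \<in> borel_measurable N" "W \<in> borel_measurable N" using Vg W by (auto simp: graphons_def)
  fix n and e :: real assume e: "0 < e"
  have fin: "finite (dyadic n)" and ev: "dyadic n \<subseteq> events"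
    using fpart_dyadic[of n] by (auto simp: fpart_def)
  have "0 < e / 2" using e by simp
  from envelope_finite_approx[OF U fin ev this]
  obtain \<pi> where \<pi>: "\<pi> \<in> mp_bijections M" and 1: "\<forall>S\<in>dyadic n. \<forall>T\<in>dyadic n.
      \<bar>rect_integral M S T (pullback V \<pi>) - rect_integral M S T U\<bar> < e / 2"
    by (rule bexE)
  obtain \<pi>' where \<pi>': "\<pi>' \<in> mp_bijections M" "\<And>x. x \<in> space M \<Longrightarrow> \<pi>' (\<pi> x) = x"
    using mp_obtain_inverse[OF \<pi>] by metis
  note [measurable] = mp_measurable[OF \<pi>'(1)]
  \<comment> \<open>The image of \<open>S\<close> under \<open>\<pi>\<close>, written as a preimage
    under the inverse so that its measurability is immediate.\<close>
  define im where "im S = \<pi>' -` S \<inter> space M" for S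
  have im_ev: "im S \<in> events" if "S \<in> events" for S
    using that unfolding im_def by measurable
  have sp: "\<pi> x \<in> space M" if "x \<in> space M" for x
    using mp_measurable[OF \<pi>] that by (rule measurable_space)
  have vim: "\<pi> -` im S \<inter> space M = S" if "S \<in> events" for S
    using sets.sets_into_space[OF that] sp \<pi>'(2) by (auto simp: im_def)
  have "im ` dyadic n \<subseteq> events" using im_ev ev by auto
  from envelope_finite_approx[OF V finite_imageI[OF fin] this \<open>0 < e / 2\<close>]
  obtain \<sigma> where \<sigma>: "\<sigma> \<in> mp_bijections M" and 2: "\<forall>S\<in>im ` dyadic n. \<forall>T\<in>im ` dyadic n.
      \<bar>rect_integral M S T (pullback W \<sigma>) - rect_integral M S T V\<bar> < e / 2"
    by (rule bexE)
  note [measurable] = mp_measurable[OF \<sigma>]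
  have pull: "rect_integral M S T (pullback X \<pi>) = rect_integral M (im S) (im T) X"
    if "X \<in> borel_measurable N" "S \<in> events" "T \<in> events" for X S T
    using rect_integral_pullback[OF \<pi> that(1) im_ev im_ev, of S T] that by (simp add: vim)
  show "\<exists>\<pi>\<in>mp_bijections M. \<forall>i<2^n. \<forall>j<2^n.
      \<bar>rect_integral M (cell n i) (cell n j) (pullback W \<pi>) - rect_integral M (cell n i) (cell n j) U\<bar> < e"
  proof (intro bexI allI impI)
    show "(\<lambda>x. \<sigma> (\<pi> x)) \<in> mp_bijections M" by (rule mp_comp[OF \<sigma> \<pi>])
    fix i j :: nat assume "i < 2 ^ n" "j < 2 ^ n"
    then have m: "cell n i \<in> dyadic n" "cell n j \<in> dyadic n" by (auto simp: dyadic_def)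
    have "rect_integral M (cell n i) (cell n j) (pullback W (\<lambda>x. \<sigma> (\<pi> x)))
        = rect_integral M (im (cell n i)) (im (cell n j)) (pullback W \<sigma>)"
      unfolding pullback_comp[symmetric] by (rule pull) measurable
    moreover have "rect_integral M (cell n i) (cell n j) (pullback V \<pi>)
        = rect_integral M (im (cell n i)) (im (cell n j)) V"
      by (rule pull) measurable
    ultimately show "\<bar>rect_integral M (cell n i) (cell n j) (pullback W (\<lambda>x. \<sigma> (\<pi> x)))
        - rect_integral M (cell n i) (cell n j) U\<bar> < e"
      using 1[rule_format, OF m] 2[rule_format, OF imageI[OF m(1)] imageI[OF m(2)]] by linarith
  qed
qed

text \<open>Rectangles suffice as test functions, because label step functions are dense in L1 and
  the kernels are uniformly bounded.\<close>

lemma weak_star_integral_mult: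
  assumes w: "weak_star_conv M Y Z" and Yn: "\<And>n. bounded_kernel b (Y n)" and Z: "bounded_kernel b Z"
    and K: "bounded_kernel d K"
  shows "(\<lambda>n. \<integral>z. K z * Y n z \<partial>N) \<longlonglongrightarrow> (\<integral>z. K z * Z z \<partial>N)"
proof (rule tendsto_uniform_approx)
  fix e :: real assume e: "0 < e"
  have b0: "0 \<le> b" using bounded_kernel_nonneg[OF Z] .
  have "0 < e / (b + 1)" using e b0 by simp
  then obtain k \<rho> where R: "(\<integral>z. \<bar>K z - \<rho> (lab k (fst z)) (lab k (snd z))\<bar> \<partial>N) < e / (b + 1)"
    using integrable_approx[OF bounded_kernel_integrable[OF K]] by blast
  obtain r where rb: "bounded_kernel r (\<lambda>z. \<rho> (lab k (fst z)) (lab k (snd z)))"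
    using lab_step_bounded by blast
  note diff = bounded_kernel_diff[OF K rb]
  have close: "\<bar>(\<integral>z. K z * X z \<partial>N) - (\<integral>z. \<rho> (lab k (fst z)) (lab k (snd z)) * X z \<partial>N)\<bar> \<le> e"
    if X: "bounded_kernel b X" for X
  proof -
    have "(\<integral>z. K z * X z \<partial>N) - (\<integral>z. \<rho> (lab k (fst z)) (lab k (snd z)) * X z \<partial>N)
        = (\<integral>z. (K z - \<rho> (lab k (fst z)) (lab k (snd z))) * X z \<partial>N)"
      unfolding left_diff_distrib
      by (rule Bochner_Integration.integral_diff[symmetric,
            OF bounded_kernel_integrable[OF bounded_kernel_mult[OF K X]]
              bounded_kernel_integrable[OF bounded_kernel_mult[OF rb X]]])
    also have "\<bar>\<dots>\<bar> \<le> (\<integral>z. \<bar>(K z - \<rho> (lab k (fst z)) (lab k (snd z))) * X z\<bar> \<partial>N)"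
      using integral_abs_bound by blast
    also have "\<dots> \<le> (\<integral>z. \<bar>K z - \<rho> (lab k (fst z)) (lab k (snd z))\<bar> * b \<partial>N)"
    proof (rule integral_mono)
      show "integrable N (\<lambda>z. \<bar>(K z - \<rho> (lab k (fst z)) (lab k (snd z))) * X z\<bar>)"
        by (intro integrable_abs bounded_kernel_integrable[OF bounded_kernel_mult[OF diff X]])
      show "integrable N (\<lambda>z. \<bar>K z - \<rho> (lab k (fst z)) (lab k (snd z))\<bar> * b)"
        by (intro integrable_mult_left integrable_abs bounded_kernel_integrable[OF diff])
      show "\<bar>(K z - \<rho> (lab k (fst z)) (lab k (snd z))) * X z\<bar> \<le> \<bar>K z - \<rho> (lab k (fst z)) (lab k (snd z))\<bar> * b"
        if "z \<in> space N" for z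
        unfolding abs_mult by (intro mult_left_mono bounded_kernel_bound[OF X that]) simp
    qed
    also have "\<dots> = (\<integral>z. \<bar>K z - \<rho> (lab k (fst z)) (lab k (snd z))\<bar> \<partial>N) * b" by simp
    also have "\<dots> \<le> (\<integral>z. \<bar>K z - \<rho> (lab k (fst z)) (lab k (snd z))\<bar> \<partial>N) * (b + 1)"
      by (intro mult_left_mono) simp_all
    also have "\<dots> \<le> e" using R b0 by (simp add: field_simps)
    finally show ?thesis .
  qed
  have "(\<lambda>n. \<integral>z. \<rho> (lab k (fst z)) (lab k (snd z)) * Y n z \<partial>N) \<longlonglongrightarrow> (\<integral>z. \<rho> (lab k (fst z)) (lab k (snd z)) * Z z \<partial>N)"
    unfolding integral_lab_step[OF Yn] integral_lab_step[OF Z]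
    using w by (intro tendsto_intros) (simp add: weak_star_conv_def)
  then show "\<exists>u L. u \<longlonglongrightarrow> L \<and> (\<forall>n. \<bar>(\<integral>z. K z * Y n z \<partial>N) - u n\<bar> \<le> e) \<and> \<bar>(\<integral>z. K z * Z z \<partial>N) - L\<bar> \<le> e"
    using close[OF Yn] close[OF Z] by blast
qed

text \<open>Lower semicontinuity of the L2 norm: expand the nonnegative square of
  \<open>Z - Y n\<close> and pass to the limit in the mixed term.\<close>

lemma weak_star_square_le:
  assumes w: "weak_star_conv M Y Z" and Yn: "\<And>n. bounded_kernel b (Y n)" and Z: "bounded_kernel b Z"
    and le: "\<And>n. (\<integral>z. (Y n z)\<^sup>2 \<partial>N) \<le> r"
  shows "(\<integral>z. (Z z)\<^sup>2 \<partial>N) \<le> r"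
proof -
  have "(\<lambda>n. (\<integral>z. (Z z)\<^sup>2 \<partial>N) - 2 * (\<integral>z. Z z * Y n z \<partial>N) + r)
      \<longlonglongrightarrow> (\<integral>z. (Z z)\<^sup>2 \<partial>N) - 2 * (\<integral>z. Z z * Z z \<partial>N) + r"
    by (intro tendsto_intros weak_star_integral_mult[OF w Yn Z Z])
  moreover have "0 \<le> (\<integral>z. (Z z)\<^sup>2 \<partial>N) - 2 * (\<integral>z. Z z * Y n z \<partial>N) + r" for n
  proof -
    have "0 \<le> (\<integral>z. (Z z - Y n z)\<^sup>2 \<partial>N)" by simp
    then show ?thesis unfolding integral_diff_square[OF Z Yn] using le[of n] by linarith
  qed
  ultimately have "0 \<le> (\<integral>z. (Z z)\<^sup>2 \<partial>N) - 2 * (\<integral>z. Z z * Z z \<partial>N) + r"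
    by (intro LIMSEQ_le_const) auto
  then show ?thesis by (simp add: power2_eq_square)
qed

text \<open>The mixed term tends to the squared norm of \<open>Z\<close>, so the expanded square of
  \<open>Z - Y n\<close> is bounded by a sequence tending to 0.\<close>

lemma weak_star_square_imp_L2:
  assumes w: "weak_star_conv M Y Z" and Yn: "\<And>n. bounded_kernel b (Y n)" and Z: "bounded_kernel b Z"
    and le: "\<And>n. (\<integral>z. (Y n z)\<^sup>2 \<partial>N) \<le> (\<integral>z. (Z z)\<^sup>2 \<partial>N)"
  shows "(\<lambda>n. \<integral>z. (Z z - Y n z)\<^sup>2 \<partial>N) \<longlonglongrightarrow> 0"
proof (rule tendsto_sandwich[where f = "\<lambda>_. 0"])
  have "(\<lambda>n. (\<integral>z. (Z z)\<^sup>2 \<partial>N) - 2 * (\<integral>z. Z z * Y n z \<partial>N) + (\<integral>z. (Z z)\<^sup>2 \<partial>N))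
      \<longlonglongrightarrow> (\<integral>z. (Z z)\<^sup>2 \<partial>N) - 2 * (\<integral>z. Z z * Z z \<partial>N) + (\<integral>z. (Z z)\<^sup>2 \<partial>N)"
    by (intro tendsto_intros weak_star_integral_mult[OF w Yn Z Z])
  then show "(\<lambda>n. (\<integral>z. (Z z)\<^sup>2 \<partial>N) - 2 * (\<integral>z. Z z * Y n z \<partial>N) + (\<integral>z. (Z z)\<^sup>2 \<partial>N)) \<longlonglongrightarrow> 0"
    by (simp add: power2_eq_square)
  show "\<forall>\<^sub>F n in sequentially. (\<integral>z. (Z z - Y n z)\<^sup>2 \<partial>N)
      \<le> (\<integral>z. (Z z)\<^sup>2 \<partial>N) - 2 * (\<integral>z. Z z * Y n z \<partial>N) + (\<integral>z. (Z z)\<^sup>2 \<partial>N)"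
    unfolding integral_diff_square[OF Z Yn] using le by simp
qed simp_all

end

section \<open>Averages over a partition lie in the envelope\<close>

lemma sum_swap4:
  fixes f :: "'i \<Rightarrow> 'j \<Rightarrow> 'k \<Rightarrow> 'l \<Rightarrow> 'b :: comm_monoid_add"
  shows "(\<Sum>i\<in>A. \<Sum>j\<in>B. \<Sum>k\<in>C. \<Sum>l\<in>D. f i j k l) = (\<Sum>k\<in>C. \<Sum>l\<in>D. \<Sum>i\<in>A. \<Sum>j\<in>B. f i j k l)"
proof -
  have "(\<Sum>i\<in>A. \<Sum>j\<in>B. \<Sum>k\<in>C. \<Sum>l\<in>D. f i j k l) = (\<Sum>i\<in>A. \<Sum>k\<in>C. \<Sum>j\<in>B. \<Sum>l\<in>D. f i j k l)"
    by (intro sum.cong refl sum.swap)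
  also have "\<dots> = (\<Sum>k\<in>C. \<Sum>i\<in>A. \<Sum>j\<in>B. \<Sum>l\<in>D. f i j k l)" by (rule sum.swap)
  also have "\<dots> = (\<Sum>k\<in>C. \<Sum>i\<in>A. \<Sum>l\<in>D. \<Sum>j\<in>B. f i j k l)"
    by (intro sum.cong refl sum.swap)
  also have "\<dots> = (\<Sum>k\<in>C. \<Sum>l\<in>D. \<Sum>i\<in>A. \<Sum>j\<in>B. f i j k l)"
    by (intro sum.cong refl sum.swap)
  finally show ?thesis .
qed

context atomless_space begin

lemma prob_finite_Union:
  assumes "finite I" "\<And>i. i \<in> I \<Longrightarrow> A i \<in> events" "disjoint_family_on A I"
  shows "prob (\<Union>i\<in>I. A i) = (\<Sum>i\<in>I. prob (A i))"
  using assms by (intro finite_measure_finite_Union) auto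

lemma sum_prob_cell:
  assumes S [measurable]: "S \<in> events"
  shows "(\<Sum>i<2^k. prob (S \<inter> cell k i)) = prob S"
proof -
  have "(\<Sum>i<2^k. prob (S \<inter> cell k i)) = prob (\<Union>i\<in>{..<2^k}. S \<inter> cell k i)"
    by (rule prob_finite_Union[symmetric]) (auto simp: disjoint_family_on_def cell_def)
  also have "(\<Union>i\<in>{..<2^k}. S \<inter> cell k i) = S"
    using sets.sets_into_space[OF S] lab_less by (auto simp: cell_def)
  finally show ?thesis .
qed

text \<open>A measure preserving bijection that spreads every dyadic cell proportionally over a much
  finer partition of each cell of \<open>P\<close> averages \<open>W\<close> over the cells of \<open>P\<close>.\<close>

lemma exists_spread_sets:
  assumes P: "fpart P"
  shows "\<exists>B \<pi>. \<pi> \<in> mp_bijections M \<and>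
    (\<forall>a<2^n. B a \<in> events \<and> (AE x in M. \<pi> x \<in> B a \<longleftrightarrow> x \<in> cell n a) \<and>
      (\<forall>i<2^k. prob (B a \<inter> cell k i) = (\<Sum>C\<in>P. prob (C \<inter> cell n a) * prob (C \<inter> cell k i) / prob C)))"
proof -
  note fin = fpart_finite[OF P]
  have ev [measurable]: "C \<in> events" if "C \<in> P" for C using fpart_events[OF P that] .
  \<comment> \<open>The target masses create independence inside \<open>C\<close>: the part for
    \<open>a\<close> takes the same share of every \<open>C \<inter> cell k i\<close> as
    \<open>cell n a\<close> has of \<open>C\<close>.\<close>
  define t where "t C i a = prob (C \<inter> cell n a) * prob (C \<inter> cell k i) / prob C" for C i a
  define Q where "Q C i b \<longleftrightarrow> (\<forall>a\<in>{..<2^n}. b a \<in> events \<and> b a \<subseteq> C \<inter> cell k i \<and> prob (b a) = t C i a)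
    \<and> disjoint_family_on b {..<2^n}" for C i and b :: "nat \<Rightarrow> 'a set"
  have exQ: "\<exists>b. Q C i b" if C: "C \<in> P" for C i
    unfolding Q_def
  proof (rule exists_disjoint_subsets_prob)
    show "C \<inter> cell k i \<in> events" using ev[OF C] by measurable
    have "(\<Sum>a<2^n. t C i a) = (\<Sum>a<2^n. prob (C \<inter> cell n a)) * prob (C \<inter> cell k i) / prob C"
      by (simp add: t_def sum_distrib_right sum_divide_distrib)
    also have "\<dots> \<le> prob (C \<inter> cell k i)"
      unfolding sum_prob_cell[OF ev[OF C]] by (cases "prob C = 0") auto
    finally show "(\<Sum>a<2^n. t C i a) \<le> prob (C \<inter> cell k i)" .
  qed (auto simp: t_def)
  define b where "b C i = (SOME b. Q C i b)" for C i
  have "Q C i (b C i)" if "C \<in> P" for C i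
    unfolding b_def by (rule someI_ex[OF exQ[OF that]])
  then have b: "b C i a \<in> events" "b C i a \<subseteq> C \<inter> cell k i" "prob (b C i a) = t C i a"
    and bd: "disjoint_family_on (b C i) {..<2^n}" if "C \<in> P" "a < 2 ^ n" for C i a
    using that by (auto simp: Q_def)
  \<comment> \<open>\<open>A p\<close> is the actual piece of the cell inside \<open>C\<close>, and
    \<open>B p\<close> below is its spread copy of equal measure; aligning these pairs yields the
    bijection.\<close>
  define A where "A p = fst p \<inter> cell n (snd p)" for p
  define B where "B p = (\<Union>i\<in>{..<2^k}. b (fst p) i (snd p))" for p
  have B_ev: "B (C, a) \<in> events" "B (C, a) \<subseteq> C" if "C \<in> P" "a < 2 ^ n" for C a
    using b[OF that] unfolding B_def by auto
  have B_prob: "prob (B (C, a)) = prob (C \<inter> cell n a)" if C: "C \<in> P" and a: "a < 2 ^ n" for C a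
  proof -
    have "prob (B (C, a)) = (\<Sum>i<2^k. prob (b C i a))"
      unfolding B_def fst_conv snd_conv
    proof (rule prob_finite_Union)
      show "disjoint_family_on (\<lambda>i. b C i a) {..<2^k}"
        using b(2)[OF C a] cell_disjoint unfolding disjoint_family_on_def by blast
    qed (use b[OF C a] in auto)
    also have "\<dots> = prob (C \<inter> cell n a) * (\<Sum>i<2^k. prob (C \<inter> cell k i)) / prob C"
      using b(3)[OF C a] by (simp add: t_def sum_distrib_left sum_divide_distrib)
    also have "\<dots> = prob (C \<inter> cell n a)"
    proof (cases "prob C = 0")
      case True
      then have "prob (C \<inter> cell n a) = 0"
        using finite_measure_mono[of "C \<inter> cell n a" C] ev[OF C] measure_le_0_iff by auto
      then show ?thesis by simp
    qed (simp add: sum_prob_cell[OF ev[OF C]])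
    finally show ?thesis .
  qed
  have "\<exists>\<pi>\<in>mp_bijections M. (\<forall>p\<in>P \<times> {..<2^n::nat}. AE x in M. \<pi> x \<in> B p \<longleftrightarrow> x \<in> A p) \<and>
    (\<forall>C\<in>{}. \<forall>x\<in>space M. \<pi> x \<in> C \<longleftrightarrow> x \<in> C)"
  proof (rule mp_align)
    show "finite (P \<times> {..<2^n::nat})" using fin by simp
    show "A p \<in> events" "B p \<in> events" "prob (A p) = prob (B p)" if "p \<in> P \<times> {..<2^n::nat}" for p
      using that ev B_ev B_prob by (auto simp: A_def)
    show "disjoint_family_on A (P \<times> {..<2 ^ n::nat})"
      unfolding disjoint_family_on_def A_def using fpart_unique[OF P]
      by (auto simp: cell_def)
    show "disjoint_family_on B (P \<times> {..<2 ^ n::nat})"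
      unfolding disjoint_family_on_def
    proof (intro ballI impI)
      fix p q :: "'a set \<times> nat" assume "p \<in> P \<times> {..<2 ^ n}" "q \<in> P \<times> {..<2 ^ n}" "p \<noteq> q"
      then obtain C a D a' where p: "p = (C, a)" "C \<in> P" "a < 2 ^ n" and q: "q = (D, a')" "D \<in> P" "a' < 2 ^ n"
        and ne: "C \<noteq> D \<or> a \<noteq> a'" by auto
      show "B p \<inter> B q = {}"
      proof (cases "C = D")
        case False
        then have "C \<inter> D = {}" using fpart_unique[OF P p(2) q(2)] by auto
        then show ?thesis using B_ev(2)[OF p(2,3)] B_ev(2)[OF q(2,3)] p(1) q(1) by blast
      next
        case True
        then have "a \<noteq> a'" using ne by simp
        have "b C i a \<inter> b C i' a' = {}" for i i'
        proof (cases "i = i'")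
          case True
          then show ?thesis using bd[OF p(2,3), of i] p q \<open>a \<noteq> a'\<close> by (auto simp: disjoint_family_on_def)
        next
          case False
          then have "cell k i \<inter> cell k i' = {}" by (rule cell_disjoint)
          then show ?thesis using b(2)[OF p(2,3), of i] b(2)[OF p(2) q(3), of i'] by blast
        qed
        then show ?thesis using True p(1) q(1) by (auto simp: B_def)
      qed
    qed
  qed auto
  then obtain \<pi> where \<pi>: "\<pi> \<in> mp_bijections M"
    and al: "\<And>p. p \<in> P \<times> {..<2^n::nat} \<Longrightarrow> AE x in M. \<pi> x \<in> B p \<longleftrightarrow> x \<in> A p" by blast
  define BB where "BB a = (\<Union>C\<in>P. B (C, a))" for a
  show ?thesis
  proof (intro exI[of _ BB] exI[of _ \<pi>] conjI allI impI \<pi>)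
    fix a :: nat assume a: "a < 2 ^ n"
    show "BB a \<in> events" unfolding BB_def using B_ev(1)[OF _ a] fin by auto
    have "AE x in M. \<forall>C\<in>P. \<pi> x \<in> B (C, a) \<longleftrightarrow> x \<in> A (C, a)"
      using al a fin by (intro AE_finite_allI) auto
    then show "AE x in M. \<pi> x \<in> BB a \<longleftrightarrow> x \<in> cell n a"
      using AE_space
    proof eventually_elim
      case (elim x)
      obtain C where "C \<in> P" "x \<in> C" using fpart_cell[OF P elim(2)] .
      then show ?case using elim(1) by (auto simp: BB_def A_def)
    qed
    fix i :: nat assume i: "i < 2 ^ k"
    have "BB a \<inter> cell k i = (\<Union>C\<in>P. b C i a)"
    proof
      show "BB a \<inter> cell k i \<subseteq> (\<Union>C\<in>P. b C i a)"
      proof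
        fix x assume "x \<in> BB a \<inter> cell k i"
        then obtain C i' where C: "C \<in> P" "x \<in> b C i' a" and x: "x \<in> cell k i"
          by (auto simp: BB_def B_def)
        then have "x \<in> cell k i'" using b(2)[OF C(1) a] by blast
        then have "i' = i" using x by (simp add: cell_def)
        then show "x \<in> (\<Union>C\<in>P. b C i a)" using C by blast
      qed
      show "(\<Union>C\<in>P. b C i a) \<subseteq> BB a \<inter> cell k i"
        using b(2)[OF _ a] i by (fastforce simp: BB_def B_def)
    qed
    then have "prob (BB a \<inter> cell k i) = prob (\<Union>C\<in>P. b C i a)" by simp
    also have "\<dots> = (\<Sum>C\<in>P. prob (b C i a))"
    proof (rule prob_finite_Union[OF fin])
      show "b C i a \<in> events" if "C \<in> P" for C using b(1)[OF that a] .
      show "disjoint_family_on (\<lambda>C. b C i a) P"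
        unfolding disjoint_family_on_def
      proof (intro ballI impI)
        fix C D assume CD: "C \<in> P" "D \<in> P" "C \<noteq> D"
        then have "C \<inter> D = {}" using fpart_unique[OF P CD(1,2)] by auto
        then show "b C i a \<inter> b D i a = {}" using b(2)[OF CD(1) a, of i] b(2)[OF CD(2) a, of i] by blast
      qed
    qed
    also have "\<dots> = (\<Sum>C\<in>P. t C i a)" using b(3)[OF _ a] by simp
    finally show "prob (BB a \<inter> cell k i) = (\<Sum>C\<in>P. prob (C \<inter> cell n a) * prob (C \<inter> cell k i) / prob C)"
      by (simp add: t_def)
  qed
qed

text \<open>\<open>W\<close> is replaced by an L1-close step function \<open>R\<close> of labels.
  Both integrals change by less than \<open>e / 2\<close>, on the averaged side because averaging
  contracts the cut norm. For \<open>R\<close> the sets of \<open>exists_spread_sets\<close> give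
  equality: masses split as products inside the cells of \<open>P\<close>, just as in the
  averages.\<close>

lemma stepping_in_envelope:
  assumes P: "fpart P" and W: "W \<in> graphons M"
  shows "stepping M W P \<in> envelope M W"
proof (rule envelopeI_cells[OF W stepping_graphon[OF P W]])
  fix n and e :: real assume e: "0 < e"
  note bW = graphon_bounded_kernel[OF W]
  have [measurable]: "W \<in> borel_measurable N" using W by (simp add: graphons_def)
  have "0 < e / 2" using e by simp
  then obtain k \<rho> where R: "(\<integral>z. \<bar>W z - \<rho> (lab k (fst z)) (lab k (snd z))\<bar> \<partial>N) < e / 2"
    using integrable_approx[OF bounded_kernel_integrable[OF bW]] by blast
  define R where "R z = \<rho> (lab k (fst z)) (lab k (snd z))" for z
  obtain r where bR: "bounded_kernel r R"
    using lab_step_bounded[of \<rho> k] unfolding R_def[abs_def] by blast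
  note bd = bounded_kernel_diff[OF bW bR]
  have L1: "(\<integral>z. \<bar>W z - R z\<bar> \<partial>N) < e / 2" using R by (simp add: R_def)
  obtain B \<pi> where \<pi>: "\<pi> \<in> mp_bijections M" and B: "\<And>a. a < 2 ^ n \<Longrightarrow> B a \<in> events"
    "\<And>a. a < 2 ^ n \<Longrightarrow> AE x in M. \<pi> x \<in> B a \<longleftrightarrow> x \<in> cell n a"
    "\<And>a i. a < 2 ^ n \<Longrightarrow> i < 2 ^ k \<Longrightarrow> prob (B a \<inter> cell k i)
      = (\<Sum>C\<in>P. prob (C \<inter> cell n a) * prob (C \<inter> cell k i) / prob C)"
    using exists_spread_sets[OF P, of n k] by blast
  note [measurable] = mp_measurable[OF \<pi>]
  show "\<exists>\<pi>\<in>mp_bijections M. \<forall>i<2^n. \<forall>j<2^n.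
      \<bar>rect_integral M (cell n i) (cell n j) (pullback W \<pi>)
        - rect_integral M (cell n i) (cell n j) (stepping M W P)\<bar> < e"
  proof (intro bexI[OF _ \<pi>] allI impI)
    fix a a' :: nat assume a: "a < 2 ^ n" and a': "a' < 2 ^ n"
    note ev [measurable] = B(1)[OF a] B(1)[OF a']
    have AE_cell: "AE x in M. x \<in> cell n d \<longleftrightarrow> x \<in> \<pi> -` B d \<inter> space M" if "d < 2 ^ n" for d
      using B(2)[OF that] AE_space by eventually_elim auto
    have "rect_integral M (cell n a) (cell n a') (pullback W \<pi>)
        = rect_integral M (\<pi> -` B a \<inter> space M) (\<pi> -` B a' \<inter> space M) (pullback W \<pi>)"
      by (rule rect_integral_change_AE[OF graphon_bounded_kernel[OF pullback_graphon[OF \<pi> W]] _ _ _ _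
            AE_cell[OF a] AE_cell[OF a']]) measurable
    also have "\<dots> = rect_integral M (B a) (B a') W"
      by (rule rect_integral_pullback[OF \<pi>]) measurable
    finally have 1: "rect_integral M (cell n a) (cell n a') (pullback W \<pi>) = rect_integral M (B a) (B a') W" .
    have 2: "\<bar>rect_integral M (B a) (B a') W - rect_integral M (B a) (B a') R\<bar> < e / 2"
      unfolding rect_integral_diff[OF bW bR ev, symmetric]
      using abs_rect_integral_le[OF bd ev] L1 by linarith
    have "\<bar>rect_integral M (cell n a) (cell n a') (stepping M W P) - rect_integral M (cell n a) (cell n a') (stepping M R P)\<bar>
        = \<bar>rect_integral M (cell n a) (cell n a') (stepping M (\<lambda>z. W z - R z) P)\<bar>"
      unfolding stepping_diff[OF P bW bR]
      by (subst rect_integral_diff[OF stepping_bounded_kernel[OF P bW] stepping_bounded_kernel[OF P bR]]) simp_all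
    also have "\<dots> \<le> cut_norm M (stepping M (\<lambda>z. W z - R z) P)"
      by (rule rect_le_cut_norm[OF stepping_bounded_kernel[OF P bd]]) simp_all
    also have "\<dots> \<le> cut_norm M (\<lambda>z. W z - R z)" by (rule cut_norm_stepping_le[OF P bd])
    also have "\<dots> < e / 2" using cut_norm_le_L1[OF bd] L1 by linarith
    finally have 3: "\<bar>rect_integral M (cell n a) (cell n a') (stepping M W P)
      - rect_integral M (cell n a) (cell n a') (stepping M R P)\<bar> < e / 2" .
    define t where "t C i d = prob (C \<inter> cell n d) * prob (C \<inter> cell k i) / prob C" for C i d
    have "rect_integral M (B a) (B a') R = (\<Sum>i<2^k. \<Sum>j<2^k. \<rho> i j * (prob (B a \<inter> cell k i) * prob (B a' \<inter> cell k j)))"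
      unfolding R_def[abs_def] by (rule rect_integral_lab_step[OF ev])
    also have "\<dots> = (\<Sum>i<2^k. \<Sum>j<2^k. \<rho> i j * ((\<Sum>C\<in>P. t C i a) * (\<Sum>D\<in>P. t D j a')))"
      unfolding t_def using B(3)[OF a] B(3)[OF a'] by (intro sum.cong refl) simp
    also have "\<dots> = (\<Sum>i<2^k. \<Sum>j<2^k. \<Sum>C\<in>P. \<Sum>D\<in>P. \<rho> i j * (t C i a * t D j a'))"
      unfolding sum_product by (simp add: sum_distrib_left)
    also have "\<dots> = (\<Sum>C\<in>P. \<Sum>D\<in>P. \<Sum>i<2^k. \<Sum>j<2^k. \<rho> i j * (t C i a * t D j a'))"
      by (rule sum_swap4)
    also have "\<dots> = rect_integral M (cell n a) (cell n a') (stepping M R P)"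
      unfolding rect_integral_stepping[OF P cell_sets cell_sets]
    proof (intro sum.cong refl)
      fix C D assume CD: "C \<in> P" "D \<in> P"
      have "rect_integral M C D R = (\<Sum>i<2^k. \<Sum>j<2^k. \<rho> i j * (prob (C \<inter> cell k i) * prob (D \<inter> cell k j)))"
        unfolding R_def[abs_def] using CD by (intro rect_integral_lab_step fpart_events[OF P])
      show "(\<Sum>i<2^k. \<Sum>j<2^k. \<rho> i j * (t C i a * t D j a'))
          = avg R C D * (prob (cell n a \<inter> C) * prob (cell n a' \<inter> D))"
        unfolding avg_def t_def \<open>rect_integral M C D R = _\<close> sum_divide_distrib sum_distrib_right
        by (intro sum.cong refl) (simp add: Int_commute mult_ac)
    qed
    finally show "\<bar>rect_integral M (cell n a) (cell n a') (pullback W \<pi>)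
        - rect_integral M (cell n a) (cell n a') (stepping M W P)\<bar> < e"
      using 1 2 3 by linarith
  qed
qed

end

section \<open>Weak regularity\<close>

context atomless_space begin

text \<open>Later rearrangements must not spoil coarser levels, so they move points only within the
  cells of level \<open>k\<close>. The condition holds at every point, so pullback and averaging
  over these cells commute exactly.\<close>

definition preserves :: "nat \<Rightarrow> ('a \<Rightarrow> 'a) \<Rightarrow> bool" where
  "preserves k \<pi> \<longleftrightarrow> (\<forall>x\<in>space M. lab k (\<pi> x) = lab k x)"

lemma lab_coarsen: "k \<le> l \<Longrightarrow> lab k x = lab l x div 2 ^ (l - k)"
  using lab_div[of k x "l - k"] by (simp only: le_add_diff_inverse)

lemma preserves_mono:
  assumes "preserves l \<pi>" "k \<le> l"
  shows "preserves k \<pi>"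
  using assms(1) unfolding preserves_def by (simp only: lab_coarsen[OF assms(2)]) simp

lemma preserves_comp:
  assumes "preserves k \<pi>" "preserves k \<sigma>" "\<sigma> \<in> mp_bijections M"
  shows "preserves k (\<lambda>x. \<pi> (\<sigma> x))"
  using assms(1,2) measurable_space[OF mp_measurable[OF assms(3)]] by (simp add: preserves_def)

lemma prob_coord_interval_le:
  assumes "s \<le> t" "0 \<le> t" "t \<le> 1"
  shows "prob {x \<in> space M. s \<le> coord x \<and> coord x < t} \<le> t - s"
proof -
  have "{x \<in> space M. s \<le> coord x \<and> coord x < t} = {x \<in> space M. max 0 s \<le> coord x \<and> coord x < t}"
    using coord_range(1) by auto
  also have "prob \<dots> = t - max 0 s" using assms by (intro prob_coord_interval) auto
  finally show ?thesis by simp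
qed

text \<open>Inside every cell of level \<open>j\<close>, the set \<open>S\<close> is moved to an initial segment with respect to
  the coordinate; such segments are described by cells of a level that does not depend on \<open>S\<close>.\<close>

lemma sort_set:
  assumes "0 < d"
  shows "\<exists>l\<ge>j. \<forall>S\<in>events. \<exists>\<pi>\<in>mp_bijections M. preserves j \<pi> \<and>
    (\<exists>J. prob {x \<in> space M. (\<pi> x \<in> S) \<noteq> (lab l x \<in> J)} < d)"
proof -
  \<comment> \<open>With \<open>m\<close> extra levels, each cell of level \<open>j\<close> has at
    most one undecided subcell, of mass \<open>1 / 2 ^ (j + m)\<close>; together these have mass at
    most \<open>(1 / 2) ^ m\<close>.\<close>
  obtain m where m: "(1 / 2) ^ m < d" using real_arch_pow_inv[OF assms, of "1/2"] by auto
  define l where "l = j + m"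
  have "\<exists>\<pi>\<in>mp_bijections M. preserves j \<pi> \<and> (\<exists>J. prob {x \<in> space M. (\<pi> x \<in> S) \<noteq> (lab l x \<in> J)} < d)"
    if S [measurable]: "S \<in> events" for S
  proof -
    define s where "s i = prob (S \<inter> cell j i)" for i
    \<comment> \<open>Right end of the initial segment of cell \<open>i\<close> whose measure is
      that of \<open>S\<close> in this cell.\<close>
    define v where "v i = real i / 2 ^ j + s i" for i
    have s: "0 \<le> s i" "s i \<le> 1 / 2 ^ j" if "i < 2 ^ j" for i
      using finite_measure_mono[of "S \<inter> cell j i" "cell j i"] prob_cell[OF that] by (auto simp: s_def)
    have v: "real i / 2 ^ j \<le> v i" "v i \<le> (real i + 1) / 2 ^ j" "0 \<le> v i" "v i \<le> 1" if i: "i < 2 ^ j" for i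
    proof -
      show "real i / 2 ^ j \<le> v i" using s[OF i] by (simp add: v_def)
      show 1: "v i \<le> (real i + 1) / 2 ^ j" using s[OF i] by (simp add: v_def add_divide_distrib)
      have "real (Suc i) \<le> real (2 ^ j)" using i by (simp only: of_nat_le_iff Suc_le_eq)
      then have "(real i + 1) / 2 ^ j \<le> 1" by simp
      then show "v i \<le> 1" using 1 by linarith
      show "0 \<le> v i" using s[OF i] by (simp add: v_def)
    qed
    define A where "A i = {x \<in> space M. real i / 2 ^ j \<le> coord x \<and> coord x < v i}" for i
    have A_cell: "A i \<subseteq> cell j i" if "i < 2 ^ j" for i
      using v[OF that] by (auto simp: A_def cell_def lab_eq_iff)
    have A_prob: "prob (A i) = s i" if "i < 2 ^ j" for i
      unfolding A_def by (subst prob_coord_interval) (use v[OF that] in \<open>auto simp: v_def\<close>)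
    have "\<exists>\<pi>\<in>mp_bijections M. (\<forall>i\<in>{..<2^j}. AE x in M. \<pi> x \<in> S \<inter> cell j i \<longleftrightarrow> x \<in> A i) \<and>
        (\<forall>C\<in>dyadic j. \<forall>x\<in>space M. \<pi> x \<in> C \<longleftrightarrow> x \<in> C)"
    proof (rule mp_align)
      show "A i \<in> events" for i unfolding A_def by measurable
      show "prob (A i) = prob (S \<inter> cell j i)" if "i \<in> {..<2^j}" for i
        using A_prob that by (simp add: s_def)
      show "disjoint_family_on A {..<2^j}"
        unfolding disjoint_family_on_def
      proof (intro ballI impI)
        fix i i' :: nat assume "i \<in> {..<2^j}" "i' \<in> {..<2^j}" "i \<noteq> i'"
        then show "A i \<inter> A i' = {}" using A_cell[of i] A_cell[of i'] cell_disjoint[of i i' j] by auto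
      qed
      show "disjoint_family_on (\<lambda>i. S \<inter> cell j i) {..<2^j}"
        by (auto simp: disjoint_family_on_def cell_def)
      show "A i \<union> S \<inter> cell j i \<subseteq> C \<or> (A i \<union> S \<inter> cell j i) \<inter> C = {}"
        if i: "i \<in> {..<2^j}" and Cd: "C \<in> dyadic j" for i C
      proof -
        obtain i' where C: "C = cell j i'" using Cd by (auto simp: dyadic_def)
        have sub: "A i \<union> S \<inter> cell j i \<subseteq> cell j i" using A_cell i by auto
        show ?thesis
        proof (cases "i = i'")
          case False
          then show ?thesis using sub cell_disjoint[of i i' j] C by blast
        qed (use sub C in blast)
      qed
    qed simp_all
    then obtain \<pi> where \<pi>: "\<pi> \<in> mp_bijections M"
      and al: "\<And>i. i < 2 ^ j \<Longrightarrow> AE x in M. \<pi> x \<in> S \<inter> cell j i \<longleftrightarrow> x \<in> A i"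
      and pr: "\<And>C x. C \<in> dyadic j \<Longrightarrow> x \<in> space M \<Longrightarrow> \<pi> x \<in> C \<longleftrightarrow> x \<in> C"
      by (auto simp: Ball_def)
    note [measurable] = mp_measurable[OF \<pi>]
    have pres: "preserves j \<pi>"
      unfolding preserves_def
    proof
      fix x assume x: "x \<in> space M"
      have "cell j (lab j x) \<in> dyadic j" using lab_less by (auto simp: dyadic_def)
      then have "\<pi> x \<in> cell j (lab j x)" using pr[OF _ x] x by (auto simp: cell_def)
      then show "lab j (\<pi> x) = lab j x" by (simp add: cell_def)
    qed
    \<comment> \<open>Subcells entirely to the left of the end point that belongs to their parent
      cell \<open>q div 2 ^ m\<close>.\<close>
    define J where "J = {q. (real q + 1) / 2 ^ l \<le> v (q div 2 ^ m)}"
    have lj: "lab l x div 2 ^ m = lab j x" for x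
      using lab_div[of j x m] by (simp add: l_def)
    define D where "D i = {x \<in> space M. v i - 1 / 2 ^ l \<le> coord x \<and> coord x < v i}" for i
    have [measurable]: "D i \<in> events" for i unfolding D_def by measurable
    have "AE x in M. \<forall>i\<in>{..<2^j}. \<pi> x \<in> S \<inter> cell j i \<longleftrightarrow> x \<in> A i"
      using al by (intro AE_finite_allI) auto
    then have "AE x in M. (\<pi> x \<in> S) \<noteq> (lab l x \<in> J) \<longrightarrow> x \<in> (\<Union>i<2^j. D i)"
      using AE_space
    proof eventually_elim
      case (elim x)
      define i where "i = lab j x"
      have i: "i < 2 ^ j" using lab_less by (simp add: i_def)
      have "\<pi> x \<in> space M" using mp_measurable[OF \<pi>] elim(2) by (rule measurable_space)
      then have "\<pi> x \<in> cell j i" using pres elim(2) by (simp add: i_def cell_def preserves_def)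
      then have 1: "\<pi> x \<in> S \<longleftrightarrow> coord x < v i"
        using elim(1) i elim(2) lab_eq_iff[of j x i] by (auto simp: A_def i_def)
      have q: "real (lab l x) / 2 ^ l \<le> coord x" "coord x < (real (lab l x) + 1) / 2 ^ l"
        using lab_eq_iff[of l x "lab l x"] by auto
      have "lab l x \<in> J \<longleftrightarrow> (real (lab l x) + 1) / 2 ^ l \<le> v i" by (simp add: J_def lj i_def)
      then have "x \<in> D i" if "(\<pi> x \<in> S) \<noteq> (lab l x \<in> J)"
        using that 1 q elim(2) by (auto simp: D_def add_divide_distrib)
      then show ?case using i by blast
    qed
    then have "prob {x \<in> space M. (\<pi> x \<in> S) \<noteq> (lab l x \<in> J)} \<le> prob (\<Union>i<2^j. D i)"
      by (intro finite_measure_mono_AE) auto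
    also have "\<dots> \<le> (\<Sum>i<2^j. prob (D i))"
      by (intro measure_UNION_le) auto
    also have "\<dots> \<le> (\<Sum>i<2^j::nat. 1 / 2 ^ l)"
    proof (rule sum_mono)
      fix i :: nat assume "i \<in> {..<2^j}"
      then have "prob (D i) \<le> v i - (v i - 1 / 2 ^ l)"
        unfolding D_def using v by (intro prob_coord_interval_le) auto
      then show "prob (D i) \<le> 1 / 2 ^ l" by simp
    qed
    also have "\<dots> = (1 / 2) ^ m" by (simp add: l_def power_add power_divide)
    finally show ?thesis using m \<pi> pres by (intro bexI[of _ \<pi>] conjI exI[of _ J]) auto
  qed
  then show ?thesis by (intro exI[of _ l]) (simp add: l_def)
qed

text \<open>The second set is sorted inside the cells of the level \<open>l1\<close> that already
  describes the first one; this rearrangement preserves them, so the first description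
  survives.\<close>

lemma sort_two_sets:
  assumes d: "0 < d"
  shows "\<exists>l\<ge>j. \<forall>S\<in>events. \<forall>T\<in>events. \<exists>\<pi>\<in>mp_bijections M. preserves j \<pi> \<and>
    (\<exists>I J. prob {x \<in> space M. (\<pi> x \<in> S) \<noteq> (lab l x \<in> I)} < d \<and>
      prob {x \<in> space M. (\<pi> x \<in> T) \<noteq> (lab l x \<in> J)} < d)"
proof -
  obtain l1 where l1: "l1 \<ge> j" "\<And>S. S \<in> events \<Longrightarrow> \<exists>\<pi>\<in>mp_bijections M. preserves j \<pi> \<and>
    (\<exists>J. prob {x \<in> space M. (\<pi> x \<in> S) \<noteq> (lab l1 x \<in> J)} < d)"
    using sort_set[OF d, of j] by auto
  obtain l where l: "l \<ge> l1" "\<And>S. S \<in> events \<Longrightarrow> \<exists>\<pi>\<in>mp_bijections M. preserves l1 \<pi> \<and>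
    (\<exists>J. prob {x \<in> space M. (\<pi> x \<in> S) \<noteq> (lab l x \<in> J)} < d)"
    using sort_set[OF d, of l1] by auto
  have "\<exists>\<pi>\<in>mp_bijections M. preserves j \<pi> \<and>
    (\<exists>I J. prob {x \<in> space M. (\<pi> x \<in> S) \<noteq> (lab l x \<in> I)} < d \<and>
      prob {x \<in> space M. (\<pi> x \<in> T) \<noteq> (lab l x \<in> J)} < d)"
    if S [measurable]: "S \<in> events" and T [measurable]: "T \<in> events" for S T
  proof -
    obtain \<pi> I where \<pi>: "\<pi> \<in> mp_bijections M" "preserves j \<pi>"
      and I: "prob {x \<in> space M. (\<pi> x \<in> S) \<noteq> (lab l1 x \<in> I)} < d" using l1(2)[OF S] by blast
    note [measurable] = mp_measurable[OF \<pi>(1)]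
    have "\<pi> -` T \<inter> space M \<in> events" by measurable
    from l(2)[OF this] obtain \<sigma> J where \<sigma>: "\<sigma> \<in> mp_bijections M" "preserves l1 \<sigma>"
      and J: "prob {x \<in> space M. (\<sigma> x \<in> \<pi> -` T \<inter> space M) \<noteq> (lab l x \<in> J)} < d" by blast
    note [measurable] = mp_measurable[OF \<sigma>(1)]
    have sp: "\<sigma> x \<in> space M" if "x \<in> space M" for x
      using mp_measurable[OF \<sigma>(1)] that by (rule measurable_space)
    have eq: "{x \<in> space M. (\<pi> (\<sigma> x) \<in> S) \<noteq> (lab l x \<in> {q. q div 2 ^ (l - l1) \<in> I})}
        = \<sigma> -` {x \<in> space M. (\<pi> x \<in> S) \<noteq> (lab l1 x \<in> I)} \<inter> space M"
      using sp \<sigma>(2) by (auto simp: preserves_def lab_coarsen[OF l(1), symmetric])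
    have 1: "prob {x \<in> space M. (\<pi> (\<sigma> x) \<in> S) \<noteq> (lab l x \<in> {q. q div 2 ^ (l - l1) \<in> I})} < d"
      unfolding eq by (subst mp_vimage_measure[OF \<sigma>(1)]) (measurable, rule I)
    have "{x \<in> space M. (\<pi> (\<sigma> x) \<in> T) \<noteq> (lab l x \<in> J)}
        = {x \<in> space M. (\<sigma> x \<in> \<pi> -` T \<inter> space M) \<noteq> (lab l x \<in> J)}"
      using sp by auto
    then have 2: "prob {x \<in> space M. (\<pi> (\<sigma> x) \<in> T) \<noteq> (lab l x \<in> J)} < d" using J by simp
    have "preserves j (\<lambda>x. \<pi> (\<sigma> x))"
      by (rule preserves_comp[OF \<pi>(2) preserves_mono[OF \<sigma>(2) l1(1)] \<sigma>(1)])
    then show ?thesis using 1 2 mp_comp[OF \<pi>(1) \<sigma>(1)] by blast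
  qed
  then show ?thesis using l1(1) l(1) by (intro exI[of _ l]) auto
qed

lemma vimage_dyadic:
  assumes "preserves k \<pi>" "\<pi> \<in> mp_bijections M"
  shows "(\<lambda>C. \<pi> -` C \<inter> space M) ` dyadic k = dyadic k"
proof -
  have "\<pi> -` cell k i \<inter> space M = cell k i" for i
    using assms(1) measurable_space[OF mp_measurable[OF assms(2)]] by (auto simp: cell_def preserves_def)
  then show ?thesis by (simp add: dyadic_def image_image)
qed

lemma stepping_dyadic_pullback:
  assumes "preserves k \<pi>" "\<pi> \<in> mp_bijections M" "W \<in> borel_measurable N" "z \<in> space N"
  shows "stepping M (pullback W \<pi>) (dyadic k) z = pullback (stepping M W (dyadic k)) \<pi> z"
  using stepping_pullback[OF assms(2) fpart_dyadic[of k] assms(3,4)]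
  by (simp only: vimage_dyadic[OF assms(1,2)])

text \<open>A kernel that is constant on the finer rectangles is its own average there. Cells of
  measure 0 are excluded because \<open>stepping\<close> puts 0 on null rectangles.\<close>

lemma stepping_refine_step:
  assumes P: "fpart P" and Q: "fpart Q" and Y: "bounded_kernel b Y"
    and ref: "\<And>C D. C \<in> P \<Longrightarrow> D \<in> Q \<Longrightarrow> D \<subseteq> C \<or> D \<inter> C = {}"
    and pos: "\<And>C. C \<in> Q \<Longrightarrow> prob C \<noteq> 0" and z: "z \<in> space N"
  shows "stepping M (stepping M Y P) Q z = stepping M Y P z"
proof -
  obtain x y where xy: "z = (x, y)" "x \<in> space M" "y \<in> space M"
    using z by (auto simp: space_pair_measure)
  obtain C D where CD: "C \<in> P" "x \<in> C" "D \<in> P" "y \<in> D" using fpart_cell[OF P] xy by metis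
  obtain C' D' where CD': "C' \<in> Q" "x \<in> C'" "D' \<in> Q" "y \<in> D'" using fpart_cell[OF Q] xy by metis
  have sub: "C' \<subseteq> C" "D' \<subseteq> D" using ref[OF CD(1) CD'(1)] ref[OF CD(3) CD'(3)] CD CD' by auto
  have "rect_integral M C' D' (stepping M Y P) = (\<integral>z. avg Y C D * indicator (C' \<times> D') z \<partial>N)"
    unfolding rect_integral_eq
  proof (rule Bochner_Integration.integral_cong[OF refl])
    fix z :: "'a \<times> 'a"
    show "indicator (C' \<times> D') z * stepping M Y P z = avg Y C D * indicator (C' \<times> D') z"
    proof (cases "z \<in> C' \<times> D'")
      case True
      then show ?thesis
        using sub stepping_value[OF P CD(1) _ CD(3), of "fst z" "snd z" Y] by (cases z) auto
    qed simp
  qed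
  also have "\<dots> = avg Y C D * (prob C' * prob D')"
    using fpart_events[OF Q] CD' by (simp add: measure_rect)
  finally have "avg (stepping M Y P) C' D' = avg Y C D"
    using pos CD' by (simp add: avg_def)
  then show ?thesis
    unfolding xy(1) stepping_value[OF P CD] stepping_value[OF Q CD'] .
qed

lemma cell_pos: "C \<in> dyadic k \<Longrightarrow> prob C \<noteq> 0"
  by (auto simp: dyadic_def prob_cell)

text \<open>The difference of the two averaged kernels is, up to sign, the finer average of the
  coarse error. Averaging contracts the cut norm, so this error counts twice.\<close>

lemma cut_norm_dyadic_mono:
  assumes Y: "bounded_kernel b Y" and kl: "k \<le> l"
  shows "cut_norm M (\<lambda>z. Y z - stepping M Y (dyadic l) z) \<le> 2 * cut_norm M (\<lambda>z. Y z - stepping M Y (dyadic k) z)"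
proof -
  note k = stepping_bounded_kernel[OF fpart_dyadic[of k] Y]
  note l = stepping_bounded_kernel[OF fpart_dyadic[of l] Y]
  have eq: "stepping M Y (dyadic k) z - stepping M Y (dyadic l) z
      = stepping M (\<lambda>z. stepping M Y (dyadic k) z - Y z) (dyadic l) z" if "z \<in> space N" for z
    using stepping_diff[OF fpart_dyadic k Y]
      stepping_refine_step[OF fpart_dyadic fpart_dyadic Y dyadic_refines[OF kl] cell_pos that] by simp
  have "cut_norm M (\<lambda>z. Y z - stepping M Y (dyadic l) z)
      \<le> cut_norm M (\<lambda>z. Y z - stepping M Y (dyadic k) z)
        + cut_norm M (\<lambda>z. stepping M Y (dyadic k) z - stepping M Y (dyadic l) z)"
    by (rule cut_norm_triangle[OF Y k l])
  also have "cut_norm M (\<lambda>z. stepping M Y (dyadic k) z - stepping M Y (dyadic l) z)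
      = cut_norm M (stepping M (\<lambda>z. stepping M Y (dyadic k) z - Y z) (dyadic l))"
    by (rule cut_norm_cong) (rule eq)
  also have "\<dots> \<le> cut_norm M (\<lambda>z. stepping M Y (dyadic k) z - Y z)"
    by (rule cut_norm_stepping_le[OF fpart_dyadic bounded_kernel_diff[OF k Y]])
  also have "\<dots> = cut_norm M (\<lambda>z. Y z - stepping M Y (dyadic k) z)"
    by (rule cut_norm_minus_commute[OF k Y])
  finally show ?thesis by simp
qed

text \<open>Energy increment. A rectangle on which \<open>W\<close> deviates from its averages
  becomes visible at level \<open>l\<close> once its two sides are sorted; the averages of level
  \<open>l\<close> then deviate too, and Pythagoras turns this into a gain in L2 norm. The level is
  chosen before \<open>W\<close>, as the sorting lemmas are uniform in the sets.\<close>

lemma index_increment: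
  assumes e: "0 < e"
  shows "\<exists>l\<ge>j. \<forall>W\<in>graphons M. e < cut_norm M (\<lambda>z. W z - stepping M W (dyadic j) z) \<longrightarrow>
    (\<exists>\<pi>\<in>mp_bijections M. preserves j \<pi> \<and>
      (\<integral>z. (stepping M W (dyadic j) z)\<^sup>2 \<partial>N) + (e / 2)\<^sup>2
        \<le> (\<integral>z. (stepping M (pullback W \<pi>) (dyadic l) z)\<^sup>2 \<partial>N))"
proof -
  \<comment> \<open>\<open>W\<close> minus its averages is bounded by 2, so the sorting errors cost
    at most \<open>2 * (e / 8 + e / 8)\<close>, half of the deviation \<open>e\<close>.\<close>
  have "0 < e / 8" using e by simp
  from sort_two_sets[OF this, of j]
  obtain l where jl: "j \<le> l" and l: "\<And>S T. S \<in> events \<Longrightarrow> T \<in> events \<Longrightarrow> \<exists>\<pi>\<in>mp_bijections M. preserves j \<pi> \<and>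
    (\<exists>I J. prob {x \<in> space M. (\<pi> x \<in> S) \<noteq> (lab l x \<in> I)} < e / 8 \<and>
      prob {x \<in> space M. (\<pi> x \<in> T) \<noteq> (lab l x \<in> J)} < e / 8)" by auto
  have "\<exists>\<pi>\<in>mp_bijections M. preserves j \<pi> \<and>
      (\<integral>z. (stepping M W (dyadic j) z)\<^sup>2 \<partial>N) + (e / 2)\<^sup>2
        \<le> (\<integral>z. (stepping M (pullback W \<pi>) (dyadic l) z)\<^sup>2 \<partial>N)"
    if W: "W \<in> graphons M" and big: "e < cut_norm M (\<lambda>z. W z - stepping M W (dyadic j) z)" for W
  proof -
    note bW = graphon_bounded_kernel[OF W]
    have mW [measurable]: "W \<in> borel_measurable N" using W by (simp add: graphons_def)
    define Y where "Y z = W z - stepping M W (dyadic j) z" for z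
    have bY: "bounded_kernel 2 Y"
      using bounded_kernel_diff[OF bW stepping_bounded_kernel[OF fpart_dyadic bW]] by (simp add: Y_def[abs_def])
    have "e < cut_norm M Y" using big by (simp add: Y_def[abs_def])
    then obtain S T where S [measurable]: "S \<in> events" and T [measurable]: "T \<in> events"
      and ST: "e < \<bar>rect_integral M S T Y\<bar>" using cut_norm_lessD[OF bY] by blast
    obtain \<pi> I J where \<pi>: "\<pi> \<in> mp_bijections M" and pres: "preserves j \<pi>"
      and I: "prob {x \<in> space M. (\<pi> x \<in> S) \<noteq> (lab l x \<in> I)} < e / 8"
      and J: "prob {x \<in> space M. (\<pi> x \<in> T) \<noteq> (lab l x \<in> J)} < e / 8"
      using l[OF S T] by blast
    note [measurable] = mp_measurable[OF \<pi>]
    define V where "V = pullback W \<pi>"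
    have V: "V \<in> graphons M" unfolding V_def by (rule pullback_graphon[OF \<pi> W])
    note bV = graphon_bounded_kernel[OF V]
    note bVj = stepping_bounded_kernel[OF fpart_dyadic[of j] bV]
    note bVl = stepping_bounded_kernel[OF fpart_dyadic[of l] bV]
    have step: "stepping M V (dyadic j) z = pullback (stepping M W (dyadic j)) \<pi> z" if "z \<in> space N" for z
      unfolding V_def by (rule stepping_dyadic_pullback[OF pres \<pi> mW that])
    have coarse: "stepping M (stepping M V (dyadic l)) (dyadic j) = stepping M V (dyadic j)"
      by (rule stepping_stepping[OF fpart_dyadic fpart_dyadic bV]) (rule dyadic_refines[OF jl])
    define S' where "S' = {x \<in> space M. lab l x \<in> I}"
    define T' where "T' = {x \<in> space M. lab l x \<in> J}"
    have S' [measurable]: "S' \<in> events" and T' [measurable]: "T' \<in> events"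
      unfolding S'_def T'_def by measurable
    have sets: "{x \<in> space M. (x \<in> \<pi> -` S \<inter> space M) \<noteq> (x \<in> S')} = {x \<in> space M. (\<pi> x \<in> S) \<noteq> (lab l x \<in> I)}"
      "{x \<in> space M. (x \<in> \<pi> -` T \<inter> space M) \<noteq> (x \<in> T')} = {x \<in> space M. (\<pi> x \<in> T) \<noteq> (lab l x \<in> J)}"
      by (auto simp: S'_def T'_def)
    have "\<bar>rect_integral M (\<pi> -` S \<inter> space M) (\<pi> -` T \<inter> space M) (pullback Y \<pi>) - rect_integral M S' T' (pullback Y \<pi>)\<bar>
        \<le> 2 * (prob {x \<in> space M. (\<pi> x \<in> S) \<noteq> (lab l x \<in> I)} + prob {x \<in> space M. (\<pi> x \<in> T) \<noteq> (lab l x \<in> J)})"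
      unfolding sets[symmetric]
      by (rule rect_integral_change[OF pullback_bounded_kernel[OF \<pi> bY]]) measurable
    moreover have "rect_integral M (\<pi> -` S \<inter> space M) (\<pi> -` T \<inter> space M) (pullback Y \<pi>) = rect_integral M S T Y"
      by (rule rect_integral_pullback[OF \<pi> bounded_kernel_measurable[OF bY] S T])
    moreover have "\<bar>rect_integral M S T Y\<bar> - \<bar>rect_integral M S' T' (pullback Y \<pi>)\<bar>
        \<le> \<bar>rect_integral M S T Y - rect_integral M S' T' (pullback Y \<pi>)\<bar>"
      by (rule abs_triangle_ineq2)
    ultimately have "e / 2 < \<bar>rect_integral M S' T' (pullback Y \<pi>)\<bar>" using ST I J by simp
    also have "rect_integral M S' T' (pullback Y \<pi>) = rect_integral M S' T' (\<lambda>z. V z - stepping M V (dyadic j) z)"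
      by (rule rect_integral_cong) (simp add: step, simp add: Y_def[abs_def] pullback_diff V_def)
    also have "\<dots> = rect_integral M S' T' V - rect_integral M S' T' (stepping M V (dyadic j))"
      by (rule rect_integral_diff[OF bV bVj S' T'])
    also have "rect_integral M S' T' V = rect_integral M S' T' (stepping M V (dyadic l))"
      by (rule rect_integral_stepping_compat[OF fpart_dyadic bV S' T', symmetric])
        (auto simp: dyadic_def cell_def S'_def T'_def)
    also have "\<dots> - rect_integral M S' T' (stepping M V (dyadic j))
        = rect_integral M S' T' (\<lambda>z. stepping M V (dyadic l) z - stepping M V (dyadic j) z)"
      by (rule rect_integral_diff[OF bVl bVj S' T', symmetric])
    finally have "e / 2 < (\<integral>z. \<bar>stepping M V (dyadic l) z - stepping M V (dyadic j) z\<bar> \<partial>N)"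
      using abs_rect_integral_le[OF bounded_kernel_diff[OF bVl bVj] S' T'] by linarith
    then have "(e / 2)\<^sup>2 \<le> (\<integral>z. \<bar>stepping M V (dyadic l) z - stepping M V (dyadic j) z\<bar> \<partial>N)\<^sup>2"
      using e by (intro power_mono) auto
    also have "\<dots> \<le> (\<integral>z. (stepping M V (dyadic l) z - stepping M V (dyadic j) z)\<^sup>2 \<partial>N)"
      by (rule L1_le_L2[OF bounded_kernel_diff[OF bVl bVj]])
    also have "\<dots> = (\<integral>z. (stepping M V (dyadic l) z)\<^sup>2 \<partial>N) - (\<integral>z. (stepping M V (dyadic j) z)\<^sup>2 \<partial>N)"
      using stepping_pythagoras[OF fpart_dyadic[of j] bVl] by (simp only: coarse)
    also have "(\<integral>z. (stepping M V (dyadic j) z)\<^sup>2 \<partial>N) = (\<integral>z. pullback (\<lambda>z. (stepping M W (dyadic j) z)\<^sup>2) \<pi> z \<partial>N)"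
      by (rule Bochner_Integration.integral_cong[OF refl]) (simp add: step, simp add: pullback_def split_beta)
    also have "\<dots> = (\<integral>z. (stepping M W (dyadic j) z)\<^sup>2 \<partial>N)"
      using stepping_measurable[OF fpart_dyadic[of j], of W] by (intro integral_pullback[OF \<pi>] borel_measurable_power)
    finally show ?thesis using \<pi> pres by (intro bexI[of _ \<pi>] conjI) (simp_all add: V_def)
  qed
  then show ?thesis using jl by (intro exI[of _ l]) blast
qed

text \<open>\<open>t\<close> bounds the number of increments still possible: the squared norm is at
  most 1, so \<open>t = 0\<close> is contradictory. Either level \<open>i\<close> is already
  regular, and finer levels lose at most the factor 2 of \<open>cut_norm_dyadic_mono\<close>, or an
  increment uses up one unit of \<open>t\<close>.\<close>

lemma regularity_index:
  assumes e: "0 < e"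
  shows "\<exists>l\<ge>i. \<forall>W\<in>graphons M. 1 - real t * (e / 2)\<^sup>2 < (\<integral>z. (stepping M W (dyadic i) z)\<^sup>2 \<partial>N) \<longrightarrow>
    (\<exists>\<pi>\<in>mp_bijections M. preserves i \<pi> \<and>
      cut_norm M (\<lambda>z. pullback W \<pi> z - stepping M (pullback W \<pi>) (dyadic l) z) \<le> 2 * e)"
proof (induction t arbitrary: i)
  case 0
  have "(\<integral>z. (stepping M W (dyadic i) z)\<^sup>2 \<partial>N) \<le> 1" if W: "W \<in> graphons M" for W
  proof -
    note b = graphon_bounded_kernel[OF stepping_graphon[OF fpart_dyadic[of i] W]]
    have "(\<integral>z. (stepping M W (dyadic i) z)\<^sup>2 \<partial>N) \<le> (\<integral>z. 1 \<partial>N)"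
    proof (rule integral_mono)
      show "integrable N (\<lambda>z. (stepping M W (dyadic i) z)\<^sup>2)"
        unfolding power2_eq_square by (rule bounded_kernel_integrable[OF bounded_kernel_mult[OF b b]])
      show "(stepping M W (dyadic i) z)\<^sup>2 \<le> 1" if "z \<in> space N" for z
        using bounded_kernel_bound[OF b that] by (simp add: abs_square_le_1)
    qed simp
    then show ?thesis by (simp add: P.prob_space)
  qed
  then show ?case by (intro exI[of _ i] conjI ballI impI) (simp_all add: not_less[symmetric])
next
  case (Suc t)
  obtain j where j: "i \<le> j" "\<And>W. W \<in> graphons M \<Longrightarrow> e < cut_norm M (\<lambda>z. W z - stepping M W (dyadic i) z) \<Longrightarrow>
    (\<exists>\<pi>\<in>mp_bijections M. preserves i \<pi> \<and>
      (\<integral>z. (stepping M W (dyadic i) z)\<^sup>2 \<partial>N) + (e / 2)\<^sup>2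
        \<le> (\<integral>z. (stepping M (pullback W \<pi>) (dyadic j) z)\<^sup>2 \<partial>N))"
    using index_increment[OF e, of i] by auto
  obtain l where l: "j \<le> l" "\<And>W. W \<in> graphons M \<Longrightarrow> 1 - real t * (e / 2)\<^sup>2 < (\<integral>z. (stepping M W (dyadic j) z)\<^sup>2 \<partial>N) \<Longrightarrow>
    (\<exists>\<pi>\<in>mp_bijections M. preserves j \<pi> \<and>
      cut_norm M (\<lambda>z. pullback W \<pi> z - stepping M (pullback W \<pi>) (dyadic l) z) \<le> 2 * e)"
    using Suc.IH[of j] by auto
  have "\<exists>\<pi>\<in>mp_bijections M. preserves i \<pi> \<and>
      cut_norm M (\<lambda>z. pullback W \<pi> z - stepping M (pullback W \<pi>) (dyadic l) z) \<le> 2 * e"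
    if W: "W \<in> graphons M" and idx: "1 - real (Suc t) * (e / 2)\<^sup>2 < (\<integral>z. (stepping M W (dyadic i) z)\<^sup>2 \<partial>N)" for W
  proof (cases "e < cut_norm M (\<lambda>z. W z - stepping M W (dyadic i) z)")
    case False
    have "cut_norm M (\<lambda>z. W z - stepping M W (dyadic l) z) \<le> 2 * e"
      using cut_norm_dyadic_mono[OF graphon_bounded_kernel[OF W], of i l] False j(1) l(1) by linarith
    then show ?thesis
      by (intro bexI[of _ "\<lambda>x. x"] conjI mp_id) (simp_all add: preserves_def pullback_def)
  next
    case True
    obtain \<pi> where \<pi>: "\<pi> \<in> mp_bijections M" "preserves i \<pi>" and inc:
      "(\<integral>z. (stepping M W (dyadic i) z)\<^sup>2 \<partial>N) + (e / 2)\<^sup>2 \<le> (\<integral>z. (stepping M (pullback W \<pi>) (dyadic j) z)\<^sup>2 \<partial>N)"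
      using j(2)[OF W True] by blast
    have "real (Suc t) * (e / 2)\<^sup>2 = real t * (e / 2)\<^sup>2 + (e / 2)\<^sup>2" by (simp add: distrib_right)
    then have "1 - real t * (e / 2)\<^sup>2 < (\<integral>z. (stepping M (pullback W \<pi>) (dyadic j) z)\<^sup>2 \<partial>N)"
      using idx inc by linarith
    from l(2)[OF pullback_graphon[OF \<pi>(1) W] this]
    obtain \<sigma> where \<sigma>: "\<sigma> \<in> mp_bijections M" "preserves j \<sigma>"
      "cut_norm M (\<lambda>z. pullback (pullback W \<pi>) \<sigma> z - stepping M (pullback (pullback W \<pi>) \<sigma>) (dyadic l) z) \<le> 2 * e"
      by blast
    have "preserves i (\<lambda>x. \<pi> (\<sigma> x))"
      by (rule preserves_comp[OF \<pi>(2) preserves_mono[OF \<sigma>(2) j(1)] \<sigma>(1)])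
    then show ?thesis using \<sigma>(3) mp_comp[OF \<pi>(1) \<sigma>(1)] unfolding pullback_comp by blast
  qed
  then show ?case using j(1) l(1) by (intro exI[of _ l]) auto
qed

text \<open>So many increments are allowed that the energy condition of
  \<open>regularity_index\<close> holds for every kernel; the accuracy is halved to absorb the
  factor 2.\<close>

lemma regularity:
  assumes e: "0 < e"
  shows "\<exists>l\<ge>i. \<forall>W\<in>graphons M. \<exists>\<pi>\<in>mp_bijections M. preserves i \<pi> \<and>
      cut_norm M (\<lambda>z. pullback W \<pi> z - stepping M (pullback W \<pi>) (dyadic l) z) \<le> e"
proof -
  have e4: "0 < e / 2" "0 < (e / 2 / 2)\<^sup>2" using e by auto
  obtain t where t: "1 < real t * (e / 2 / 2)\<^sup>2"
    using reals_Archimedean3[OF e4(2)] by blast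
  have "1 - real t * (e / 2 / 2)\<^sup>2 < (\<integral>z. (stepping M W (dyadic i) z)\<^sup>2 \<partial>N)" for W
  proof -
    have "0 \<le> (\<integral>z. (stepping M W (dyadic i) z)\<^sup>2 \<partial>N)" by simp
    then show ?thesis using t by linarith
  qed
  then show ?thesis using regularity_index[OF e4(1), of i t] by simp
qed

end

section \<open>Compactness of the space of graphons\<close>

text \<open>Diagonal extraction, obtained as sequential compactness of a product of countably many
  compact intervals.\<close>

lemma bounded_family_subseq:
  fixes f :: "nat \<Rightarrow> 'i :: countable \<Rightarrow> real"
  assumes "\<And>n i. \<bar>f n i\<bar> \<le> b"
  obtains l r where "strict_mono (r :: nat \<Rightarrow> nat)" "\<And>i. (\<lambda>n. f (r n) i) \<longlonglongrightarrow> l i"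
proof -
  have "compactin (product_topology (\<lambda>i :: 'i. euclidean) UNIV) (PiE UNIV (\<lambda>i. {-b..b}))"
    by (simp add: compactin_PiE)
  then have "compact (PiE (UNIV :: 'i set) (\<lambda>i. {-b..b}))"
    by (simp add: euclidean_product_topology)
  then have "seq_compact (PiE (UNIV :: 'i set) (\<lambda>i. {-b..b}))"
    by (rule compact_imp_seq_compact)
  moreover have "\<forall>n. f n \<in> PiE UNIV (\<lambda>i. {-b..b})"
    using assms by (auto simp: abs_le_iff minus_le_iff)
  ultimately obtain l r where r: "strict_mono (r :: nat \<Rightarrow> nat)" and lim: "(f \<circ> r) \<longlonglongrightarrow> l"
    by (rule seq_compactE)
  have "(\<lambda>n. f (r n) i) \<longlonglongrightarrow> l i" for i
    using continuous_on_tendsto_compose[OF continuous_on_product_coordinates[of i] lim]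
    by (simp add: comp_def)
  then show ?thesis using that r by blast
qed

text \<open>The rate \<open>(1 / 4) ^ i\<close> is chosen for squared L2 increments: its square
  root, which bounds the L1 increments, is summable.\<close>

lemma exists_fast_subseq:
  fixes a :: "nat \<Rightarrow> real"
  assumes "incseq a" and "\<And>k. a k \<le> b"
  obtains s where "strict_mono s" "\<And>i. a (s (Suc i)) - a (s i) \<le> (1 / 4) ^ i"
proof -
  obtain A where lim: "a \<longlonglongrightarrow> A" and le: "\<And>k. a k \<le> A"
    using incseq_convergent[OF assms(1), of b] assms(2) by auto
  have "\<exists>m. \<forall>k\<ge>m. A - a k \<le> (1 / 4) ^ i" for i :: nat
  proof -
    have "\<forall>\<^sub>F k in sequentially. A - (1 / 4) ^ i < a k"
      by (rule order_tendstoD(1)[OF lim]) simp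
    then obtain m where "\<And>k. k \<ge> m \<Longrightarrow> A - (1 / 4) ^ i < a k" by (auto simp: eventually_sequentially)
    then show ?thesis by (intro exI[of _ m]) (auto simp: algebra_simps intro: less_imp_le)
  qed
  then obtain m where m: "\<And>i k. k \<ge> m i \<Longrightarrow> A - a k \<le> (1 / 4) ^ i" by metis
  \<comment> \<open>Adding up the thresholds makes \<open>s\<close> strictly increasing while
    \<open>s i\<close> stays beyond \<open>m i\<close>.\<close>
  define s where "s i = (\<Sum>j\<le>i. Suc (m j))" for i
  have "strict_mono s" by (rule strict_monoI_Suc) (simp add: s_def)
  moreover have "a (s (Suc i)) - a (s i) \<le> (1 / 4) ^ i" for i
  proof -
    have "s i \<ge> Suc (m i)" unfolding s_def by (rule member_le_sum) auto
    then show ?thesis using m[of i "s i"] le[of "s (Suc i)"] by simp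
  qed
  ultimately show ?thesis using that by blast
qed

context atomless_space begin

lemma bounded_kernel_convergence:
  assumes Y: "\<And>n. bounded_kernel b (Y n)" and Z: "Z \<in> borel_measurable N"
    and lim: "AE z in N. (\<lambda>n. Y n z) \<longlonglongrightarrow> Z z"
  shows "(\<lambda>n. \<integral>z. Y n z \<partial>N) \<longlonglongrightarrow> (\<integral>z. Z z \<partial>N)"
  by (rule integral_dominated_convergence[where w = "\<lambda>_. b"])
    (use Z lim Y in \<open>auto intro!: AE_I2 dest: bounded_kernel_bound simp: bounded_kernel_measurable\<close>)

text \<open>L1 increments of at most \<open>(1 / 2) ^ i\<close> make the increments absolutely
  summable almost everywhere, and \<open>F\<close> is their telescoping sum.\<close>

lemma fast_L1_AE_convergent:
  assumes F: "\<And>i. bounded_kernel b (F i)"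
    and fast: "\<And>i. (\<integral>z. (F (Suc i) z - F i z)\<^sup>2 \<partial>N) \<le> (1 / 4) ^ i"
  shows "AE z in N. convergent (\<lambda>i. F i z)"
proof -
  define d where "d i z = \<bar>F (Suc i) z - F i z\<bar>" for i z
  have bk: "bounded_kernel (b + b) (\<lambda>z. F (Suc i) z - F i z)" for i by (rule bounded_kernel_diff[OF F F])
  have [measurable]: "d i \<in> borel_measurable N" for i
    unfolding d_def[abs_def] using bounded_kernel_measurable[OF bk[of i]] by measurable
  have int: "integrable N (d i)" for i
    unfolding d_def[abs_def] by (intro integrable_abs bounded_kernel_integrable[OF bk])
  have L1: "(\<integral>z. d i z \<partial>N) \<le> (1 / 2) ^ i" for i
  proof -
    have "(\<integral>z. d i z \<partial>N)\<^sup>2 \<le> (1 / 4) ^ i"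
      using L1_le_L2[OF bk[of i]] fast[of i] by (simp add: d_def)
    also have "\<dots> = ((1 / 2) ^ i)\<^sup>2"
      by (simp add: power2_eq_square power_mult_distrib[symmetric])
    finally show ?thesis by (rule power2_le_imp_le) simp
  qed
  have "(\<integral>\<^sup>+z. (\<Sum>i. ennreal (d i z)) \<partial>N) = (\<Sum>i. \<integral>\<^sup>+z. ennreal (d i z) \<partial>N)"
    by (rule nn_integral_suminf) measurable
  also have "\<dots> \<le> (\<Sum>i. ennreal ((1 / 2) ^ i))"
  proof (rule suminf_le)
    fix i
    have "(\<integral>\<^sup>+z. ennreal (d i z) \<partial>N) = ennreal (\<integral>z. d i z \<partial>N)"
      by (rule nn_integral_eq_integral[OF int]) (simp add: d_def)
    then show "(\<integral>\<^sup>+z. ennreal (d i z) \<partial>N) \<le> ennreal ((1 / 2) ^ i)"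
      using L1[of i] by (simp add: ennreal_leI)
  qed auto
  also have "\<dots> < \<infinity>"
    by (subst suminf_ennreal2) (auto intro!: summable_geometric)
  finally have "AE z in N. (\<Sum>i. ennreal (d i z)) \<noteq> \<infinity>"
    by (intro nn_integral_PInf_AE) auto
  then show ?thesis
  proof eventually_elim
    case (elim z)
    then have "summable (\<lambda>i. d i z)"
      by (intro summable_suminf_not_top) (auto simp: d_def)
    then have "summable (\<lambda>i. F (Suc i) z - F i z)"
      unfolding d_def by (rule summable_rabs_cancel)
    then have "convergent (\<lambda>n. \<Sum>i<n. F (Suc i) z - F i z)"
      by (simp add: summable_iff_convergent)
    then have "convergent (\<lambda>n. F n z - F 0 z)" by (simp only: sum_lessThan_telescope[of "\<lambda>i. F i z"])
    then have "convergent (\<lambda>n. (F n z - F 0 z) + F 0 z)"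
      by (intro convergent_add convergent_const)
    then show ?case by simp
  qed
qed

text \<open>The level in \<open>regularity\<close> is uniform, so iterating it yields one sequence
  of levels for all graphons, each rearrangement keeping the level it started from.\<close>

lemma regular_levels:
  obtains J :: "nat \<Rightarrow> nat" where "mono J"
    "\<And>k W. W \<in> graphons M \<Longrightarrow> \<exists>\<pi>\<in>mp_bijections M. preserves (J k) \<pi> \<and>
      cut_norm M (\<lambda>z. pullback W \<pi> z - stepping M (pullback W \<pi>) (dyadic (J (Suc k))) z) \<le> 1 / real (Suc k)"
proof -
  have "\<exists>l. \<forall>k i. i \<le> l k i \<and> (\<forall>W\<in>graphons M. \<exists>\<pi>\<in>mp_bijections M. preserves i \<pi> \<and>
      cut_norm M (\<lambda>z. pullback W \<pi> z - stepping M (pullback W \<pi>) (dyadic (l k i)) z) \<le> 1 / real (Suc k))"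
    using regularity[of "1 / real (Suc k)" for k] by (intro choice allI) simp
  then obtain l where l: "\<And>k i. i \<le> l k i" "\<And>k i W. W \<in> graphons M \<Longrightarrow> \<exists>\<pi>\<in>mp_bijections M. preserves i \<pi> \<and>
      cut_norm M (\<lambda>z. pullback W \<pi> z - stepping M (pullback W \<pi>) (dyadic (l k i)) z) \<le> 1 / real (Suc k)"
    by blast
  define J where "J = rec_nat 0 l"
  have J: "J (Suc k) = l k (J k)" for k by (simp add: J_def)
  show ?thesis
  proof (rule that[of J])
    show "mono J" using l(1) by (simp add: mono_iff_le_Suc J)
  qed (simp only: J l(2))
qed

text \<open>The rearrangement for a new level preserves the coarser ones and so carries their
  estimates along unchanged. Only finitely many levels are treated, as an infinite composition of
  bijections need not converge; letting \<open>n\<close> grow along a sequence covers every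
  level.\<close>

lemma regular_representative:
  assumes J: "mono J" and reg: "\<And>k W. W \<in> graphons M \<Longrightarrow> \<exists>\<pi>\<in>mp_bijections M. preserves (J k) \<pi> \<and>
      cut_norm M (\<lambda>z. pullback W \<pi> z - stepping M (pullback W \<pi>) (dyadic (J (Suc k))) z) \<le> 1 / real (Suc k)"
    and W: "W \<in> graphons M"
  shows "\<exists>\<pi>\<in>mp_bijections M. \<forall>k<n.
      cut_norm M (\<lambda>z. pullback W \<pi> z - stepping M (pullback W \<pi>) (dyadic (J (Suc k))) z) \<le> 1 / real (Suc k)"
proof (induction n)
  case 0
  then show ?case using mp_id by blast
next
  case (Suc n)
  then obtain \<pi> where \<pi>: "\<pi> \<in> mp_bijections M" and IH: "\<And>k. k < n \<Longrightarrow>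
      cut_norm M (\<lambda>z. pullback W \<pi> z - stepping M (pullback W \<pi>) (dyadic (J (Suc k))) z) \<le> 1 / real (Suc k)"
    by blast
  define V where "V = pullback W \<pi>"
  have V: "V \<in> graphons M" unfolding V_def by (rule pullback_graphon[OF \<pi> W])
  note bV = graphon_bounded_kernel[OF V]
  obtain \<sigma> where \<sigma>: "\<sigma> \<in> mp_bijections M" "preserves (J n) \<sigma>"
    and last: "cut_norm M (\<lambda>z. pullback V \<sigma> z - stepping M (pullback V \<sigma>) (dyadic (J (Suc n))) z) \<le> 1 / real (Suc n)"
    using reg[OF V] by blast
  have "cut_norm M (\<lambda>z. pullback V \<sigma> z - stepping M (pullback V \<sigma>) (dyadic (J (Suc k))) z) \<le> 1 / real (Suc k)"
    if "k < Suc n" for k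
  proof (cases "k = n")
    case False
    then have k: "k < n" using that by simp
    have pres: "preserves (J (Suc k)) \<sigma>"
      by (rule preserves_mono[OF \<sigma>(2)]) (use J k in \<open>auto simp: mono_def\<close>)
    have "cut_norm M (\<lambda>z. pullback V \<sigma> z - stepping M (pullback V \<sigma>) (dyadic (J (Suc k))) z)
        = cut_norm M (pullback (\<lambda>z. V z - stepping M V (dyadic (J (Suc k))) z) \<sigma>)"
      unfolding pullback_diff
      by (rule cut_norm_cong)
        (simp add: stepping_dyadic_pullback[OF pres \<sigma>(1) bounded_kernel_measurable[OF bV]])
    also have "\<dots> = cut_norm M (\<lambda>z. V z - stepping M V (dyadic (J (Suc k))) z)"
      by (rule cut_norm_pullback[OF \<sigma>(1) bounded_kernel_diff[OF bV stepping_bounded_kernel[OF fpart_dyadic bV]]])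
    finally show ?thesis using IH[OF k] by (simp add: V_def)
  qed (use last in simp)
  then show ?case
    using mp_comp[OF \<pi> \<sigma>(1)] unfolding V_def pullback_comp by blast
qed

lemma stepping_tendsto_sum:
  assumes "\<And>C D. C \<in> P \<Longrightarrow> D \<in> P \<Longrightarrow> (\<lambda>n. rect_integral M C D (Y n)) \<longlonglongrightarrow> l C D"
  shows "(\<lambda>n. stepping M (Y n) P z)
    \<longlonglongrightarrow> (\<Sum>C\<in>P. \<Sum>D\<in>P. l C D / (prob C * prob D) * indicator (C \<times> D) z)"
  unfolding stepping_def divide_inverse by (intro tendsto_sum tendsto_mult tendsto_const assms)

lemma stepping_tendsto:
  assumes "\<And>C D. C \<in> P \<Longrightarrow> D \<in> P \<Longrightarrow> (\<lambda>n. rect_integral M C D (Y n)) \<longlonglongrightarrow> rect_integral M C D Z"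
  shows "(\<lambda>n. stepping M (Y n) P z) \<longlonglongrightarrow> stepping M Z P z"
  using stepping_tendsto_sum[OF assms, of P z] by (simp only: stepping_def)

text \<open>The stepped kernels converge level by level; their limits form an \<open>L\<^sup>2\<close>-bounded martingale,
  and the almost everywhere limit along a fast subsequence of levels is the weak* limit.\<close>

lemma weak_star_limit_exists:
  assumes V: "\<And>n. V n \<in> graphons M"
    and lim: "\<And>k i j. (\<lambda>n. rect_integral M (cell k i) (cell k j) (V n)) \<longlonglongrightarrow> L k i j"
  obtains W where "W \<in> graphons M" "weak_star_conv M V W"
proof -
  note bV = graphon_bounded_kernel[OF V]
  define S where "S n k = stepping M (V n) (dyadic k)" for n k
  have Sg: "S n k \<in> graphons M" for n k unfolding S_def by (rule stepping_graphon[OF fpart_dyadic V])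
  note bS = graphon_bounded_kernel[OF Sg]
  define F where "F k z = lim (\<lambda>n. S n k z)" for k z
  have conv: "(\<lambda>n. S n k z) \<longlonglongrightarrow> F k z" for k z
  proof -
    have "(\<lambda>n. rect_integral M C D (V n)) \<longlonglongrightarrow> lim (\<lambda>n. rect_integral M C D (V n))"
      if CD: "C \<in> dyadic k" "D \<in> dyadic k" for C D
    proof -
      obtain i j where "C = cell k i" "D = cell k j" using CD by (auto simp: dyadic_def)
      then show ?thesis using lim[of k i j] by (metis convergentI convergent_LIMSEQ_iff)
    qed
    from stepping_tendsto_sum[of "dyadic k" V, OF this]
    have "convergent (\<lambda>n. S n k z)" unfolding S_def by (rule convergentI)
    then show ?thesis unfolding F_def by (simp add: convergent_LIMSEQ_iff)
  qed
  have mF [measurable]: "F k \<in> borel_measurable N" for k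
    unfolding F_def[abs_def] by (rule borel_measurable_lim_metric) (rule bounded_kernel_measurable[OF bS])
  have Fg: "F k \<in> graphons M" for k
    unfolding graphons_def
  proof (intro CollectI conjI mF ballI)
    fix x y assume xy: "x \<in> space M" "y \<in> space M"
    have s: "S n k (x, y) = S n k (y, x)" "0 \<le> S n k (x, y)" "S n k (x, y) \<le> 1" for n
      using Sg[of n k] xy by (auto simp: graphons_def)
    show "F k (x, y) = F k (y, x)" by (simp add: F_def s(1))
    show "0 \<le> F k (x, y)" by (rule LIMSEQ_le_const[OF conv]) (use s in auto)
    show "F k (x, y) \<le> 1" by (rule LIMSEQ_le_const2[OF conv]) (use s in auto)
  qed
  note bF = graphon_bounded_kernel[OF Fg]
  \<comment> \<open>Averaging at a finer level leaves integrals over cells of level \<open>k\<close>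
    alone, so all these limits have the same integrals there.\<close>
  have rect_F: "rect_integral M (cell k i) (cell k j) (F l) = L k i j" if "k \<le> l" for k i j l
  proof (rule LIMSEQ_unique)
    show "(\<lambda>n. rect_integral M (cell k i) (cell k j) (S n l)) \<longlonglongrightarrow> rect_integral M (cell k i) (cell k j) (F l)"
      unfolding rect_integral_eq
    proof (rule bounded_kernel_convergence)
      show "bounded_kernel (1 * 1) (\<lambda>z. indicator (cell k i \<times> cell k j) z * S n l z)" for n
        by (intro bounded_kernel_mult bounded_kernel_indicator bS) simp
      show "AE z in N. (\<lambda>n. indicator (cell k i \<times> cell k j) z * S n l z) \<longlonglongrightarrow> indicator (cell k i \<times> cell k j) z * F l z"
        by (intro AE_I2 tendsto_intros conv)
    qed measurable
    have "C \<subseteq> cell k i' \<or> C \<inter> cell k i' = {}" if "C \<in> dyadic l" for C i'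
      using that lab_coarsen[OF \<open>k \<le> l\<close>] by (auto simp: dyadic_def cell_def)
    then have "rect_integral M (cell k i) (cell k j) (S n l) = rect_integral M (cell k i) (cell k j) (V n)" for n
      unfolding S_def by (intro rect_integral_stepping_compat[OF fpart_dyadic bV] cell_sets)
    then show "(\<lambda>n. rect_integral M (cell k i) (cell k j) (S n l)) \<longlonglongrightarrow> L k i j"
      using lim by simp
  qed
  have sq: "(\<lambda>n. \<integral>z. (S n k z)\<^sup>2 \<partial>N) \<longlonglongrightarrow> (\<integral>z. (F k z)\<^sup>2 \<partial>N)" for k
    unfolding power2_eq_square
    by (rule bounded_kernel_convergence[OF bounded_kernel_mult[OF bS bS]])
      (auto intro!: AE_I2 tendsto_intros conv)
  \<comment> \<open>Pythagoras for the stepped kernels survives the limit in \<open>n\<close>: the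
    martingale has orthogonal increments.\<close>
  have mart: "(\<integral>z. (F l z - F k z)\<^sup>2 \<partial>N) = (\<integral>z. (F l z)\<^sup>2 \<partial>N) - (\<integral>z. (F k z)\<^sup>2 \<partial>N)" if kl: "k \<le> l" for k l
  proof (rule LIMSEQ_unique)
    show "(\<lambda>n. \<integral>z. (S n l z - S n k z)\<^sup>2 \<partial>N) \<longlonglongrightarrow> (\<integral>z. (F l z - F k z)\<^sup>2 \<partial>N)"
      unfolding power2_eq_square
      by (rule bounded_kernel_convergence[OF bounded_kernel_mult[OF bounded_kernel_diff[OF bS bS] bounded_kernel_diff[OF bS bS]]])
        (auto intro!: AE_I2 tendsto_intros conv)
    have coarse: "stepping M (S n l) (dyadic k) = S n k" for n
      unfolding S_def by (rule stepping_stepping[OF fpart_dyadic fpart_dyadic bV]) (rule dyadic_refines[OF kl])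
    have "(\<integral>z. (S n l z - S n k z)\<^sup>2 \<partial>N) = (\<integral>z. (S n l z)\<^sup>2 \<partial>N) - (\<integral>z. (S n k z)\<^sup>2 \<partial>N)" for n
      using stepping_pythagoras[OF fpart_dyadic[of k] bS[of n l]] by (simp only: coarse)
    then show "(\<lambda>n. \<integral>z. (S n l z - S n k z)\<^sup>2 \<partial>N) \<longlonglongrightarrow> (\<integral>z. (F l z)\<^sup>2 \<partial>N) - (\<integral>z. (F k z)\<^sup>2 \<partial>N)"
      using tendsto_diff[OF sq sq] by simp
  qed
  have "(\<integral>z. (F k z)\<^sup>2 \<partial>N) \<le> (\<integral>z. 1 \<partial>N)" for k
  proof (rule integral_mono)
    show "integrable N (\<lambda>z. (F k z)\<^sup>2)"
      unfolding power2_eq_square by (rule bounded_kernel_integrable[OF bounded_kernel_mult[OF bF bF]])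
    show "(F k z)\<^sup>2 \<le> 1" if "z \<in> space N" for z
      using bounded_kernel_bound[OF bF that, of k] by (simp add: abs_square_le_1)
  qed simp
  moreover have "incseq (\<lambda>k. \<integral>z. (F k z)\<^sup>2 \<partial>N)"
  proof (rule incseq_SucI)
    fix k
    have "0 \<le> (\<integral>z. (F (Suc k) z - F k z)\<^sup>2 \<partial>N)" by simp
    then show "(\<integral>z. (F k z)\<^sup>2 \<partial>N) \<le> (\<integral>z. (F (Suc k) z)\<^sup>2 \<partial>N)" using mart[of k "Suc k"] by simp
  qed
  ultimately obtain s where s: "strict_mono s"
    "\<And>i. (\<integral>z. (F (s (Suc i)) z)\<^sup>2 \<partial>N) - (\<integral>z. (F (s i) z)\<^sup>2 \<partial>N) \<le> (1 / 4) ^ i"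
    using exists_fast_subseq[of "\<lambda>k. \<integral>z. (F k z)\<^sup>2 \<partial>N"] by blast
  have fast: "(\<integral>z. (F (s (Suc i)) z - F (s i) z)\<^sup>2 \<partial>N) \<le> (1 / 4) ^ i" for i
    using s(2)[of i] mart[of "s i" "s (Suc i)"] strict_mono_less_eq[OF s(1), of i "Suc i"] by simp
  have AEc: "AE z in N. convergent (\<lambda>i. F (s i) z)"
    by (rule fast_L1_AE_convergent[OF bF fast])
  \<comment> \<open>\<open>lim\<close> is unspecified on the null set of divergence; clamping keeps
    \<open>W\<close> a graphon there.\<close>
  define W where "W z = max 0 (min 1 (lim (\<lambda>i. F (s i) z)))" for z
  have mW [measurable]: "W \<in> borel_measurable N"
  proof -
    have "(\<lambda>z. lim (\<lambda>i. F (s i) z)) \<in> borel_measurable N"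
      by (rule borel_measurable_lim_metric) (rule mF)
    then show ?thesis unfolding W_def[abs_def] by measurable
  qed
  have W: "W \<in> graphons M"
    unfolding graphons_def
  proof (intro CollectI conjI mW ballI)
    fix x y assume xy: "x \<in> space M" "y \<in> space M"
    have "F k (x, y) = F k (y, x)" for k using Fg[of k] xy by (auto simp: graphons_def)
    then show "W (x, y) = W (y, x)" by (simp add: W_def)
  qed (auto simp: W_def)
  have AEW: "AE z in N. (\<lambda>i. F (s i) z) \<longlonglongrightarrow> W z"
    using AEc AE_space
  proof eventually_elim
    case (elim z)
    have l: "(\<lambda>i. F (s i) z) \<longlonglongrightarrow> lim (\<lambda>i. F (s i) z)" using elim(1) by (simp add: convergent_LIMSEQ_iff)
    have f: "0 \<le> F k z" "F k z \<le> 1" for k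
      using Fg[of k] elim(2) by (auto simp: graphons_def space_pair_measure)
    have "0 \<le> lim (\<lambda>i. F (s i) z)" by (rule LIMSEQ_le_const[OF l]) (use f in auto)
    moreover have "lim (\<lambda>i. F (s i) z) \<le> 1" by (rule LIMSEQ_le_const2[OF l]) (use f in auto)
    ultimately have "W z = lim (\<lambda>i. F (s i) z)" by (simp add: W_def)
    then show ?case using l by simp
  qed
  have rect_W: "rect_integral M (cell k i) (cell k j) W = L k i j" for k i j
  proof (rule LIMSEQ_unique)
    show "(\<lambda>m. rect_integral M (cell k i) (cell k j) (F (s m))) \<longlonglongrightarrow> rect_integral M (cell k i) (cell k j) W"
      unfolding rect_integral_eq
    proof (rule bounded_kernel_convergence)
      show "bounded_kernel (1 * 1) (\<lambda>z. indicator (cell k i \<times> cell k j) z * F (s n) z)" for n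
        by (intro bounded_kernel_mult bounded_kernel_indicator bF) simp
      show "AE z in N. (\<lambda>n. indicator (cell k i \<times> cell k j) z * F (s n) z) \<longlonglongrightarrow> indicator (cell k i \<times> cell k j) z * W z"
        using AEW by eventually_elim (intro tendsto_intros)
    qed measurable
    have "\<forall>\<^sub>F m in sequentially. L k i j = rect_integral M (cell k i) (cell k j) (F (s m))"
      using eventually_ge_at_top[of k]
    proof eventually_elim
      case (elim m)
      then have "k \<le> s m" using seq_suble[OF s(1), of m] by simp
      then show ?case using rect_F by simp
    qed
    then show "(\<lambda>m. rect_integral M (cell k i) (cell k j) (F (s m))) \<longlonglongrightarrow> L k i j"
      by (rule Lim_transform_eventually[OF tendsto_const])
  qed
  have "weak_star_conv M V W"
    by (rule weak_star_convI_cells[OF bV graphon_bounded_kernel[OF W]]) (simp add: rect_W lim)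
  then show ?thesis using that W by blast
qed

text \<open>Suitable rearrangements are regular at all early levels of \<open>J\<close>. Along a
  weak* convergent subsequence the averages over one fixed level converge in L1, and the uniform
  regularity of the sequence, inherited by its limit, bridges the gap to the kernels themselves.
  This upgrades weak* to cut norm convergence.\<close>

lemma graphon_compactness:
  assumes U: "\<And>n. U n \<in> graphons M"
  obtains r W \<pi> where "strict_mono (r :: nat \<Rightarrow> nat)" "W \<in> graphons M" "\<And>n. \<pi> n \<in> mp_bijections M"
    "(\<lambda>n. cut_norm M (\<lambda>z. pullback (U (r n)) (\<pi> n) z - W z)) \<longlonglongrightarrow> 0"
proof -
  obtain J where J: "mono J" and reg: "\<And>k W. W \<in> graphons M \<Longrightarrow> \<exists>\<pi>\<in>mp_bijections M. preserves (J k) \<pi> \<and>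
      cut_norm M (\<lambda>z. pullback W \<pi> z - stepping M (pullback W \<pi>) (dyadic (J (Suc k))) z) \<le> 1 / real (Suc k)"
    using regular_levels by blast
  have "\<exists>\<sigma>. \<forall>n. \<sigma> n \<in> mp_bijections M \<and> (\<forall>k<n.
      cut_norm M (\<lambda>z. pullback (U n) (\<sigma> n) z - stepping M (pullback (U n) (\<sigma> n)) (dyadic (J (Suc k))) z) \<le> 1 / real (Suc k))"
    using regular_representative[OF J reg U] by (intro choice allI) blast
  then obtain \<sigma> where \<sigma>: "\<And>n. \<sigma> n \<in> mp_bijections M" and cut: "\<And>n k. k < n \<Longrightarrow>
      cut_norm M (\<lambda>z. pullback (U n) (\<sigma> n) z - stepping M (pullback (U n) (\<sigma> n)) (dyadic (J (Suc k))) z) \<le> 1 / real (Suc k)"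
    by blast
  define X where "X n = pullback (U n) (\<sigma> n)" for n
  have X: "X n \<in> graphons M" for n unfolding X_def by (rule pullback_graphon[OF \<sigma> U])
  have "\<bar>rect_integral M (cell k i) (cell k j) (X n)\<bar> \<le> 1" for n k i j
  proof -
    have "\<bar>rect_integral M (cell k i) (cell k j) (X n)\<bar> \<le> 1 * (prob (cell k i) * prob (cell k j))"
      by (rule abs_avg_le(1)[OF graphon_bounded_kernel[OF X]]) simp_all
    also have "\<dots> \<le> 1" by (simp add: mult_le_one)
    finally show ?thesis .
  qed
  then have "\<bar>(\<lambda>(k, i, j). rect_integral M (cell k i) (cell k j) (X n)) p\<bar> \<le> 1" for n p
    by (cases p) simp
  from bounded_family_subseq[of "\<lambda>n (k, i, j). rect_integral M (cell k i) (cell k j) (X n)", OF this]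
  obtain L r where r: "strict_mono (r :: nat \<Rightarrow> nat)" and
    L: "\<And>p. (\<lambda>n. (\<lambda>(k, i, j). rect_integral M (cell k i) (cell k j) (X (r n))) p) \<longlonglongrightarrow> L p" by blast
  define V where "V n = X (r n)" for n
  have V: "V n \<in> graphons M" for n unfolding V_def by (rule X)
  note bV = graphon_bounded_kernel[OF V]
  have "(\<lambda>n. rect_integral M (cell k i) (cell k j) (V n)) \<longlonglongrightarrow> L (k, i, j)" for k i j
    using L[of "(k, i, j)"] by (simp add: V_def)
  from weak_star_limit_exists[OF V this]
  obtain W where W: "W \<in> graphons M" and weak: "weak_star_conv M V W" by blast
  note bW = graphon_bounded_kernel[OF W]
  \<comment> \<open>From \<open>k < n\<close> and \<open>n \<le> r n\<close> the estimates survive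
    the passage to the subsequence.\<close>
  have cutV: "cut_norm M (\<lambda>z. V n z - stepping M (V n) (dyadic (J (Suc k))) z) \<le> 1 / real (Suc k)" if "k < n" for n k
    unfolding V_def X_def using seq_suble[OF r, of n] that by (intro cut) simp
  have rect: "(\<lambda>n. rect_integral M S T (V n)) \<longlonglongrightarrow> rect_integral M S T W" if "S \<in> events" "T \<in> events" for S T
    using weak that by (simp add: weak_star_conv_def)
  have "(\<lambda>n. cut_norm M (\<lambda>z. V n z - W z)) \<longlonglongrightarrow> 0"
  proof (rule LIMSEQ_I)
    fix e :: real assume e: "0 < e"
    then obtain k where k: "1 / real (Suc k) < e / 3"
      using reals_Archimedean[of "e / 3"] by (auto simp: inverse_eq_divide)
    define D where "D = dyadic (J (Suc k))"
    have D: "fpart D" unfolding D_def by (rule fpart_dyadic)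
    note bVD = stepping_bounded_kernel[OF D bV] and bWD = stepping_bounded_kernel[OF D bW]
    have step: "(\<lambda>n. stepping M (V n) D z) \<longlonglongrightarrow> stepping M W D z" for z
      by (rule stepping_tendsto) (intro rect fpart_events[OF D])
    \<comment> \<open>The limit inherits the regularity estimate rectangle by rectangle, since for
      fixed sets both integrals converge.\<close>
    have third: "cut_norm M (\<lambda>z. stepping M W D z - W z) \<le> 1 / real (Suc k)"
    proof (rule cut_norm_leI)
      fix S T assume ST: "S \<in> events" "T \<in> events"
      have "(\<lambda>n. rect_integral M S T (stepping M (V n) D)) \<longlonglongrightarrow> rect_integral M S T (stepping M W D)"
        unfolding rect_integral_eq
      proof (rule bounded_kernel_convergence)
        show "bounded_kernel (1 * 1) (\<lambda>z. indicator (S \<times> T) z * stepping M (V n) D z)" for n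
          using ST by (intro bounded_kernel_mult bounded_kernel_indicator bVD) simp
        show "(\<lambda>z. indicator (S \<times> T) z * stepping M W D z) \<in> borel_measurable N"
          using ST stepping_measurable[OF D, of W] by measurable
        show "AE z in N. (\<lambda>n. indicator (S \<times> T) z * stepping M (V n) D z) \<longlonglongrightarrow> indicator (S \<times> T) z * stepping M W D z"
          by (intro AE_I2 tendsto_intros step)
      qed
      then have "(\<lambda>n. \<bar>rect_integral M S T (stepping M (V n) D) - rect_integral M S T (V n)\<bar>)
          \<longlonglongrightarrow> \<bar>rect_integral M S T (stepping M W D) - rect_integral M S T W\<bar>"
        by (intro tendsto_intros rect ST)
      moreover have "\<forall>\<^sub>F n in sequentially. \<bar>rect_integral M S T (stepping M (V n) D) - rect_integral M S T (V n)\<bar> \<le> 1 / real (Suc k)"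
        using eventually_gt_at_top[of k]
      proof eventually_elim
        case (elim n)
        have "\<bar>rect_integral M S T (stepping M (V n) D) - rect_integral M S T (V n)\<bar>
            = \<bar>rect_integral M S T (\<lambda>z. V n z - stepping M (V n) D z)\<bar>"
          using rect_integral_diff[OF bV bVD ST] by (simp add: abs_minus_commute)
        also have "\<dots> \<le> cut_norm M (\<lambda>z. V n z - stepping M (V n) D z)"
          by (rule rect_le_cut_norm[OF bounded_kernel_diff[OF bV bVD] ST])
        finally show ?case using cutV[OF elim] by (simp add: D_def)
      qed
      ultimately have "\<bar>rect_integral M S T (stepping M W D) - rect_integral M S T W\<bar> \<le> 1 / real (Suc k)"
        by (rule tendsto_upperbound) simp
      then show "\<bar>rect_integral M S T (\<lambda>z. stepping M W D z - W z)\<bar> \<le> 1 / real (Suc k)"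
        by (simp add: rect_integral_diff[OF bWD bW ST])
    qed
    have "(\<lambda>n. \<integral>z. \<bar>stepping M (V n) D z - stepping M W D z\<bar> \<partial>N) \<longlonglongrightarrow> (\<integral>z. 0 \<partial>N)"
    proof (rule bounded_kernel_convergence)
      show "bounded_kernel (1 + 1) (\<lambda>z. \<bar>stepping M (V n) D z - stepping M W D z\<bar>)" for n
        using bounded_kernel_diff[OF bVD bWD, of n] by (auto simp: bounded_kernel_def intro: borel_measurable_abs)
      have "(\<lambda>n. \<bar>stepping M (V n) D z - stepping M W D z\<bar>) \<longlonglongrightarrow> \<bar>stepping M W D z - stepping M W D z\<bar>" for z
        by (intro tendsto_intros step)
      then show "AE z in N. (\<lambda>n. \<bar>stepping M (V n) D z - stepping M W D z\<bar>) \<longlonglongrightarrow> 0" by simp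
    qed simp
    then have "\<forall>\<^sub>F n in sequentially. (\<integral>z. \<bar>stepping M (V n) D z - stepping M W D z\<bar> \<partial>N) < e / 3"
      using e by (intro order_tendstoD(2)) auto
    then have "\<forall>\<^sub>F n in sequentially. norm (cut_norm M (\<lambda>z. V n z - W z) - 0) < e"
      using eventually_gt_at_top[of k]
    proof eventually_elim
      case (elim n)
      have "cut_norm M (\<lambda>z. V n z - W z)
          \<le> cut_norm M (\<lambda>z. V n z - stepping M (V n) D z) + cut_norm M (\<lambda>z. stepping M (V n) D z - W z)"
        by (rule cut_norm_triangle[OF bV bVD bW])
      moreover have "cut_norm M (\<lambda>z. stepping M (V n) D z - W z)
          \<le> cut_norm M (\<lambda>z. stepping M (V n) D z - stepping M W D z) + cut_norm M (\<lambda>z. stepping M W D z - W z)"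
        by (rule cut_norm_triangle[OF bVD bWD bW])
      moreover have "cut_norm M (\<lambda>z. stepping M (V n) D z - stepping M W D z) < e / 3"
        using cut_norm_le_L1[OF bounded_kernel_diff[OF bVD bWD], of n] elim(1) by linarith
      ultimately have "cut_norm M (\<lambda>z. V n z - W z) < e"
        using cutV[OF elim(2)] third k unfolding D_def[symmetric] by linarith
      then show ?case using cut_norm_nonneg[OF bounded_kernel_diff[OF bV bW], of n] by simp
    qed
    then show "\<exists>no. \<forall>n\<ge>no. norm (cut_norm M (\<lambda>z. V n z - W z) - 0) < e"
      by (simp add: eventually_sequentially)
  qed
  then show ?thesis using that[of r W "\<lambda>n. \<sigma> (r n)"] r W \<sigma> by (simp add: V_def X_def)
qed

end

section \<open>The uniform increment\<close>

lemma tendsto_zero_squeeze: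
  fixes f g :: "nat \<Rightarrow> real"
  assumes "\<And>n. 0 \<le> f n" "\<And>n. f n \<le> g n" "g \<longlonglongrightarrow> 0"
  shows "f \<longlonglongrightarrow> 0"
  by (rule Lim_null_comparison[OF always_eventually assms(3)]) (simp add: assms(1,2))

context atomless_space begin

lemma pullback_inverse:
  assumes "\<And>x. x \<in> space M \<Longrightarrow> \<pi> (\<pi>' x) = x" "\<rho> \<in> mp_bijections M" "z \<in> space N"
  shows "pullback (pullback Y \<pi>) (\<lambda>x. \<pi>' (\<rho> x)) z = pullback Y \<rho> z"
proof -
  have "\<rho> x \<in> space M" if "x \<in> space M" for x
    using mp_measurable[OF assms(2)] that by (rule measurable_space)
  then show ?thesis using assms(1,3) by (auto simp: pullback_def space_pair_measure)
qed

lemma square_pullback: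
  assumes \<phi>: "\<phi> \<in> mp_bijections M" and Y: "bounded_kernel b Y"
  shows "(\<integral>z. (pullback Y \<phi> z)\<^sup>2 \<partial>N) = (\<integral>z. (Y z)\<^sup>2 \<partial>N)"
proof -
  have "(\<integral>z. (pullback Y \<phi> z)\<^sup>2 \<partial>N) = (\<integral>z. pullback (\<lambda>z. (Y z)\<^sup>2) \<phi> z \<partial>N)"
    by (simp add: pullback_def case_prod_beta')
  also have "\<dots> = (\<integral>z. (Y z)\<^sup>2 \<partial>N)"
    by (intro integral_pullback[OF \<phi>] borel_measurable_power bounded_kernel_measurable[OF Y])
  finally show ?thesis .
qed

text \<open>Conditional expectations contract the cut norm, so a kernel \<open>V\<close> that is close to a version
  of \<open>X\<close> may replace it inside the averaging operator.\<close>

lemma stepping_transfer: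
  assumes X: "X \<in> graphons M" and V: "V \<in> graphons M" and U: "U \<in> graphons M" and P: "fpart P"
    and \<pi>: "\<pi> \<in> mp_bijections M" and \<rho>: "\<rho> \<in> mp_bijections M"
  shows "\<exists>\<sigma>\<in>mp_bijections M. \<exists>Q. fpart Q \<and>
    cut_norm M (\<lambda>z. stepping M (pullback V \<sigma>) Q z - U z)
      \<le> cut_norm M (\<lambda>z. pullback X \<pi> z - V z) + cut_norm M (\<lambda>z. pullback (stepping M X P) \<rho> z - U z) \<and>
    cut_norm M (\<lambda>z. X z - stepping M X P z)
      \<le> 2 * cut_norm M (\<lambda>z. pullback X \<pi> z - V z)
        + cut_norm M (\<lambda>z. pullback V \<sigma> z - stepping M (pullback V \<sigma>) Q z)"
proof -
  obtain \<pi>' where \<pi>': "\<pi>' \<in> mp_bijections M" "\<And>x. x \<in> space M \<Longrightarrow> \<pi> (\<pi>' x) = x"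
    using mp_obtain_inverse[OF \<pi>] by metis
  \<comment> \<open>Undoing \<open>\<pi>\<close> and then applying \<open>\<rho>\<close> brings
    \<open>V\<close> close to \<open>pullback X \<rho>\<close>, the arrangement in which the
    averages are close to \<open>U\<close>.\<close>
  define \<sigma> where "\<sigma> = (\<lambda>x. \<pi>' (\<rho> x))"
  have \<sigma>: "\<sigma> \<in> mp_bijections M" unfolding \<sigma>_def by (rule mp_comp[OF \<pi>'(1) \<rho>])
  define Q where "Q = (\<lambda>C. \<rho> -` C \<inter> space M) ` P"
  have Q: "fpart Q" unfolding Q_def by (rule vimage_fpart[OF \<rho> P])
  note bX = graphon_bounded_kernel[OF X] and bV = graphon_bounded_kernel[OF V] and bU = graphon_bounded_kernel[OF U]
  note bXP = stepping_bounded_kernel[OF P bX]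
  note bX\<rho> = pullback_bounded_kernel[OF \<rho> bX] and bX\<pi> = pullback_bounded_kernel[OF \<pi> bX]
  note bV\<sigma> = pullback_bounded_kernel[OF \<sigma> bV]
  note bZ = stepping_bounded_kernel[OF Q bV\<sigma>]
  note bXP\<rho> = pullback_bounded_kernel[OF \<rho> bXP]
  let ?a = "cut_norm M (\<lambda>z. pullback X \<pi> z - V z)"
  let ?Z = "stepping M (pullback V \<sigma>) Q"
  have 1: "cut_norm M (\<lambda>z. pullback X \<rho> z - pullback V \<sigma> z) = ?a"
  proof -
    have "cut_norm M (\<lambda>z. pullback X \<rho> z - pullback V \<sigma> z)
        = cut_norm M (pullback (\<lambda>z. pullback X \<pi> z - V z) \<sigma>)"
      unfolding pullback_diff
      by (rule cut_norm_cong) (simp add: \<sigma>_def pullback_inverse[where \<pi> = \<pi> and \<pi>' = \<pi>', OF \<pi>'(2) \<rho>])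
    then show ?thesis by (simp add: cut_norm_pullback[OF \<sigma> bounded_kernel_diff[OF bX\<pi> bV]])
  qed
  have step: "pullback (stepping M X P) \<rho> z = stepping M (pullback X \<rho>) Q z" if "z \<in> space N" for z
    unfolding Q_def by (rule stepping_pullback[OF \<rho> P bounded_kernel_measurable[OF bX] that, symmetric])
  have 2: "cut_norm M (\<lambda>z. ?Z z - pullback (stepping M X P) \<rho> z) \<le> ?a"
  proof -
    have "cut_norm M (\<lambda>z. ?Z z - pullback (stepping M X P) \<rho> z)
        = cut_norm M (stepping M (\<lambda>z. pullback V \<sigma> z - pullback X \<rho> z) Q)"
      by (rule cut_norm_cong) (simp add: step stepping_diff[OF Q bV\<sigma> bX\<rho>])
    also have "\<dots> \<le> cut_norm M (\<lambda>z. pullback V \<sigma> z - pullback X \<rho> z)"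
      by (rule cut_norm_stepping_le[OF Q bounded_kernel_diff[OF bV\<sigma> bX\<rho>]])
    finally show ?thesis unfolding cut_norm_minus_commute[OF bV\<sigma> bX\<rho>] 1 .
  qed
  have 3: "cut_norm M (\<lambda>z. ?Z z - U z) \<le> ?a + cut_norm M (\<lambda>z. pullback (stepping M X P) \<rho> z - U z)"
    using cut_norm_triangle[OF bZ bXP\<rho> bU] 2 by linarith
  have "cut_norm M (\<lambda>z. X z - stepping M X P z) = cut_norm M (pullback (\<lambda>z. X z - stepping M X P z) \<rho>)"
    by (rule cut_norm_pullback[OF \<rho> bounded_kernel_diff[OF bX bXP], symmetric])
  also have "\<dots> = cut_norm M (\<lambda>z. pullback X \<rho> z - pullback (stepping M X P) \<rho> z)"
    unfolding pullback_diff ..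
  also have "\<dots> \<le> cut_norm M (\<lambda>z. pullback X \<rho> z - pullback V \<sigma> z)
      + cut_norm M (\<lambda>z. pullback V \<sigma> z - pullback (stepping M X P) \<rho> z)"
    by (rule cut_norm_triangle[OF bX\<rho> bV\<sigma> bXP\<rho>])
  also have "cut_norm M (\<lambda>z. pullback V \<sigma> z - pullback (stepping M X P) \<rho> z)
      \<le> cut_norm M (\<lambda>z. pullback V \<sigma> z - ?Z z) + cut_norm M (\<lambda>z. ?Z z - pullback (stepping M X P) \<rho> z)"
    by (rule cut_norm_triangle[OF bV\<sigma> bZ bXP\<rho>])
  finally have "cut_norm M (\<lambda>z. X z - stepping M X P z) \<le> 2 * ?a + cut_norm M (\<lambda>z. pullback V \<sigma> z - ?Z z)"
    using 1 2 by linarith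
  then show ?thesis using \<sigma> Q 3 by blast
qed

lemma envelope_pullback:
  assumes W: "W \<in> graphons M" and \<sigma>: "\<sigma> \<in> mp_bijections M" and U: "U \<in> envelope M (pullback W \<sigma>)"
  shows "U \<in> envelope M W"
proof -
  obtain \<pi> where \<pi>: "\<And>n. \<pi> n \<in> mp_bijections M" "weak_star_conv M (\<lambda>n. pullback (pullback W \<sigma>) (\<pi> n)) U"
    and Ug: "U \<in> graphons M" using U by (auto simp: envelope_def)
  show ?thesis
    unfolding envelope_def
    using \<pi>(2) mp_comp[OF \<sigma> \<pi>(1)] Ug unfolding pullback_comp
    by (intro CollectI conjI exI[of _ "\<lambda>n x. \<sigma> (\<pi> n x)"]) auto
qed

text \<open>By \<open>stepping_transfer\<close>, \<open>U\<close> is close in cut norm to an average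
  of a version of \<open>V\<close>. Such averages lie in the envelope of \<open>V\<close>, and
  closeness on finitely many cells is all that \<open>envelopeI_cells\<close> asks for.\<close>

lemma limit_in_envelope:
  assumes X: "\<And>n. X n \<in> graphons M" and V: "V \<in> graphons M" and U: "U \<in> graphons M"
    and P: "\<And>n. fpart (P n)" and \<pi>: "\<And>n. \<pi> n \<in> mp_bijections M" and \<rho>: "\<And>n. \<rho> n \<in> mp_bijections M"
    and limV: "(\<lambda>n. cut_norm M (\<lambda>z. pullback (X n) (\<pi> n) z - V z)) \<longlonglongrightarrow> 0"
    and limU: "(\<lambda>n. cut_norm M (\<lambda>z. pullback (stepping M (X n) (P n)) (\<rho> n) z - U z)) \<longlonglongrightarrow> 0"
  shows "U \<in> envelope M V"
proof (rule envelopeI_cells[OF V U])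
  fix n and e :: real assume e: "0 < e"
  have "(\<lambda>n. cut_norm M (\<lambda>z. pullback (X n) (\<pi> n) z - V z)
      + cut_norm M (\<lambda>z. pullback (stepping M (X n) (P n)) (\<rho> n) z - U z)) \<longlonglongrightarrow> 0 + 0"
    by (rule tendsto_add[OF limV limU])
  then have "\<forall>\<^sub>F m in sequentially. cut_norm M (\<lambda>z. pullback (X m) (\<pi> m) z - V z)
      + cut_norm M (\<lambda>z. pullback (stepping M (X m) (P m)) (\<rho> m) z - U z) < e / 2"
    using e by (intro order_tendstoD(2)) auto
  then obtain m where m: "cut_norm M (\<lambda>z. pullback (X m) (\<pi> m) z - V z)
      + cut_norm M (\<lambda>z. pullback (stepping M (X m) (P m)) (\<rho> m) z - U z) < e / 2"
    by (auto dest: eventually_happens)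
  obtain \<sigma> Q where \<sigma>: "\<sigma> \<in> mp_bijections M" and Q: "fpart Q"
    and close: "cut_norm M (\<lambda>z. stepping M (pullback V \<sigma>) Q z - U z)
      \<le> cut_norm M (\<lambda>z. pullback (X m) (\<pi> m) z - V z) + cut_norm M (\<lambda>z. pullback (stepping M (X m) (P m)) (\<rho> m) z - U z)"
    using stepping_transfer[OF X V U P \<pi> \<rho>, of m m m m] by blast
  define Z where "Z = stepping M (pullback V \<sigma>) Q"
  have V\<sigma>: "pullback V \<sigma> \<in> graphons M" by (rule pullback_graphon[OF \<sigma> V])
  have Z: "Z \<in> graphons M" unfolding Z_def by (rule stepping_graphon[OF Q V\<sigma>])
  note bZU = bounded_kernel_diff[OF graphon_bounded_kernel[OF Z] graphon_bounded_kernel[OF U]]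
  have "Z \<in> envelope M V"
    unfolding Z_def by (rule envelope_pullback[OF V \<sigma> stepping_in_envelope[OF Q V\<sigma>]])
  moreover have "finite (dyadic n)" "dyadic n \<subseteq> events" "0 < e / 2"
    using fpart_dyadic[of n] e by (auto simp: fpart_def)
  ultimately obtain \<tau> where \<tau>: "\<tau> \<in> mp_bijections M" and ap: "\<forall>S\<in>dyadic n. \<forall>T\<in>dyadic n.
      \<bar>rect_integral M S T (pullback V \<tau>) - rect_integral M S T Z\<bar> < e / 2"
    using envelope_finite_approx[of Z V "dyadic n" "e / 2"] by blast
  show "\<exists>\<pi>\<in>mp_bijections M. \<forall>i<2^n. \<forall>j<2^n.
      \<bar>rect_integral M (cell n i) (cell n j) (pullback V \<pi>) - rect_integral M (cell n i) (cell n j) U\<bar> < e"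
  proof (intro bexI[OF _ \<tau>] allI impI)
    fix i j :: nat assume "i < 2 ^ n" "j < 2 ^ n"
    then have 1: "\<bar>rect_integral M (cell n i) (cell n j) (pullback V \<tau>) - rect_integral M (cell n i) (cell n j) Z\<bar> < e / 2"
      using ap by (auto simp: dyadic_def)
    have "\<bar>rect_integral M (cell n i) (cell n j) Z - rect_integral M (cell n i) (cell n j) U\<bar>
        = \<bar>rect_integral M (cell n i) (cell n j) (\<lambda>z. Z z - U z)\<bar>"
      using rect_integral_diff[OF graphon_bounded_kernel[OF Z] graphon_bounded_kernel[OF U], of "cell n i" "cell n j"]
      by simp
    also have "\<dots> \<le> cut_norm M (\<lambda>z. Z z - U z)" by (rule rect_le_cut_norm[OF bZU]) simp_all
    also have "\<dots> < e / 2" using close m by (simp add: Z_def)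
    finally show "\<bar>rect_integral M (cell n i) (cell n j) (pullback V \<tau>) - rect_integral M (cell n i) (cell n j) U\<bar> < e"
      using 1 by linarith
  qed
qed

text \<open>Relabelling keeps the L2 norm and weak* limits cannot raise it.\<close>

lemma envelope_square_le:
  assumes W: "W \<in> graphons M" and U: "U \<in> envelope M W"
  shows "(\<integral>z. (U z)\<^sup>2 \<partial>N) \<le> (\<integral>z. (W z)\<^sup>2 \<partial>N)"
proof -
  obtain \<pi> where \<pi>: "\<And>n. \<pi> n \<in> mp_bijections M" and weak: "weak_star_conv M (\<lambda>n. pullback W (\<pi> n)) U"
    and Ug: "U \<in> graphons M" using U by (auto simp: envelope_def)
  note bW = graphon_bounded_kernel[OF W]
  show ?thesis
    by (rule weak_star_square_le[OF weak pullback_bounded_kernel[OF \<pi> bW] graphon_bounded_kernel[OF Ug]])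
      (simp add: square_pullback[OF \<pi> bW])
qed

lemma cut_norm_imp_weak_star:
  assumes Y: "\<And>n. bounded_kernel b (Y n)" and Z: "bounded_kernel b Z"
    and lim: "(\<lambda>n. cut_norm M (\<lambda>z. Y n z - Z z)) \<longlonglongrightarrow> 0"
  shows "weak_star_conv M Y Z"
  unfolding weak_star_conv_def
proof (intro ballI)
  fix S T assume ST: "S \<in> events" "T \<in> events"
  have "(\<lambda>n. rect_integral M S T (Y n) - rect_integral M S T Z) \<longlonglongrightarrow> 0"
  proof (rule Lim_null_comparison[OF always_eventually lim], rule allI)
    fix n
    show "norm (rect_integral M S T (Y n) - rect_integral M S T Z) \<le> cut_norm M (\<lambda>z. Y n z - Z z)"
      using rect_le_cut_norm[OF bounded_kernel_diff[OF Y Z] ST, of n]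
      by (simp add: rect_integral_diff[OF Y Z ST])
  qed
  then show "(\<lambda>n. rect_integral M S T (Y n)) \<longlonglongrightarrow> rect_integral M S T Z" by (rule LIM_zero_cancel)
qed

lemma square_imp_cut_norm_limit:
  assumes Y: "\<And>n. bounded_kernel b (Y n)" and lim: "(\<lambda>n. \<integral>z. (Y n z)\<^sup>2 \<partial>N) \<longlonglongrightarrow> 0"
  shows "(\<lambda>n. cut_norm M (Y n)) \<longlonglongrightarrow> 0"
proof (rule Lim_null_comparison[OF always_eventually], rule allI)
  show "norm (cut_norm M (Y n)) \<le> sqrt (\<integral>z. (Y n z)\<^sup>2 \<partial>N)" for n
    using cut_norm_square_le[OF Y] cut_norm_nonneg[OF Y] by (simp add: real_le_rsqrt)
  show "(\<lambda>n. sqrt (\<integral>z. (Y n z)\<^sup>2 \<partial>N)) \<longlonglongrightarrow> 0" using tendsto_real_sqrt[OF lim] by simp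
qed

text \<open>If \<open>V\<close> lies in the envelope of \<open>U\<close>, then \<open>U\<close> and \<open>V\<close> have the same \<open>L\<^sup>2\<close> norm. Weak*
  convergence without loss of norm is \<open>L\<^sup>2\<close> convergence, so the averages of \<open>V\<close> lose
  asymptotically no mass, which forces averaging to be asymptotically trivial on \<open>X n\<close> too.\<close>

lemma averaging_asymptotically_trivial:
  assumes X: "\<And>n. X n \<in> graphons M" and V: "V \<in> graphons M" and U: "U \<in> graphons M"
    and P: "\<And>n. fpart (P n)" and \<pi>: "\<And>n. \<pi> n \<in> mp_bijections M" and \<rho>: "\<And>n. \<rho> n \<in> mp_bijections M"
    and limV: "(\<lambda>n. cut_norm M (\<lambda>z. pullback (X n) (\<pi> n) z - V z)) \<longlonglongrightarrow> 0"
    and limU: "(\<lambda>n. cut_norm M (\<lambda>z. pullback (stepping M (X n) (P n)) (\<rho> n) z - U z)) \<longlonglongrightarrow> 0"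
    and env: "V \<in> envelope M U"
  shows "(\<lambda>n. cut_norm M (\<lambda>z. X n z - stepping M (X n) (P n) z)) \<longlonglongrightarrow> 0"
proof -
  note bX = graphon_bounded_kernel[OF X] and bV = graphon_bounded_kernel[OF V] and bU = graphon_bounded_kernel[OF U]
  note bXP = stepping_bounded_kernel[OF P bX]
  \<comment> \<open>This is the norm bound under which the weak* convergence of versions of
    \<open>U\<close> to \<open>V\<close> becomes L2 convergence.\<close>
  have UV: "(\<integral>z. (U z)\<^sup>2 \<partial>N) \<le> (\<integral>z. (V z)\<^sup>2 \<partial>N)"
    by (rule envelope_square_le[OF V limit_in_envelope[OF X V U P \<pi> \<rho> limV limU]])
  obtain \<tau> where \<tau>: "\<And>n. \<tau> n \<in> mp_bijections M" and weak: "weak_star_conv M (\<lambda>n. pullback U (\<tau> n)) V"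
    using env by (auto simp: envelope_def)
  note bU\<tau> = pullback_bounded_kernel[OF \<tau> bU]
  have "(\<lambda>n. \<integral>z. (V z - pullback U (\<tau> n) z)\<^sup>2 \<partial>N) \<longlonglongrightarrow> 0"
    by (rule weak_star_square_imp_L2[OF weak bU\<tau> bV]) (simp add: square_pullback[OF \<tau> bU] UV)
  then have limUV: "(\<lambda>n. cut_norm M (\<lambda>z. V z - pullback U (\<tau> n) z)) \<longlonglongrightarrow> 0"
    by (rule square_imp_cut_norm_limit[OF bounded_kernel_diff[OF bV bU\<tau>]])
  \<comment> \<open>The extra bijection \<open>\<tau> n\<close> moves the averages from
    \<open>U\<close> towards \<open>V\<close>, so that \<open>stepping_transfer\<close> applies with
    \<open>V\<close> in both roles.\<close>
  define \<rho>' where "\<rho>' n = (\<lambda>x. \<rho> n (\<tau> n x))" for n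
  have \<rho>': "\<rho>' n \<in> mp_bijections M" for n unfolding \<rho>'_def by (rule mp_comp[OF \<rho> \<tau>])
  define a where "a n = cut_norm M (\<lambda>z. pullback (X n) (\<pi> n) z - V z)" for n
  define d where "d n = cut_norm M (\<lambda>z. pullback (stepping M (X n) (P n)) (\<rho>' n) z - V z)" for n
  have a0: "a \<longlonglongrightarrow> 0" unfolding a_def[abs_def] by (rule limV)
  have d_le: "d n \<le> cut_norm M (\<lambda>z. pullback (stepping M (X n) (P n)) (\<rho> n) z - U z)
      + cut_norm M (\<lambda>z. V z - pullback U (\<tau> n) z)" for n
  proof -
    note bXP\<rho> = pullback_bounded_kernel[OF \<rho>[of n] bXP[of n]]
    have "d n \<le> cut_norm M (\<lambda>z. pullback (stepping M (X n) (P n)) (\<rho>' n) z - pullback U (\<tau> n) z)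
        + cut_norm M (\<lambda>z. pullback U (\<tau> n) z - V z)"
      unfolding d_def by (rule cut_norm_triangle[OF pullback_bounded_kernel[OF \<rho>' bXP] bU\<tau> bV])
    also have "cut_norm M (\<lambda>z. pullback (stepping M (X n) (P n)) (\<rho>' n) z - pullback U (\<tau> n) z)
        = cut_norm M (pullback (\<lambda>z. pullback (stepping M (X n) (P n)) (\<rho> n) z - U z) (\<tau> n))"
      unfolding pullback_diff pullback_comp \<rho>'_def ..
    also have "\<dots> = cut_norm M (\<lambda>z. pullback (stepping M (X n) (P n)) (\<rho> n) z - U z)"
      by (rule cut_norm_pullback[OF \<tau> bounded_kernel_diff[OF bXP\<rho> bU]])
    finally show ?thesis unfolding cut_norm_minus_commute[OF bU\<tau> bV] .
  qed
  have d_nonneg: "0 \<le> d n" for n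
    unfolding d_def by (rule cut_norm_nonneg[OF bounded_kernel_diff[OF pullback_bounded_kernel[OF \<rho>' bXP] bV]])
  have d0: "d \<longlonglongrightarrow> 0"
    by (rule tendsto_zero_squeeze[OF d_nonneg d_le]) (use tendsto_add[OF limU limUV] in simp)
  have "\<exists>\<sigma>. \<forall>n. \<sigma> n \<in> mp_bijections M \<and> (\<exists>Q. fpart Q \<and>
      cut_norm M (\<lambda>z. stepping M (pullback V (\<sigma> n)) Q z - V z) \<le> a n + d n \<and>
      cut_norm M (\<lambda>z. X n z - stepping M (X n) (P n) z)
        \<le> 2 * a n + cut_norm M (\<lambda>z. pullback V (\<sigma> n) z - stepping M (pullback V (\<sigma> n)) Q z))"
    unfolding a_def d_def using stepping_transfer[OF X V V P \<pi> \<rho>'] by (intro choice allI) blast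
  then obtain \<sigma> where \<sigma>: "\<And>n. \<sigma> n \<in> mp_bijections M" and "\<forall>n. \<exists>Q. fpart Q \<and>
      cut_norm M (\<lambda>z. stepping M (pullback V (\<sigma> n)) Q z - V z) \<le> a n + d n \<and>
      cut_norm M (\<lambda>z. X n z - stepping M (X n) (P n) z)
        \<le> 2 * a n + cut_norm M (\<lambda>z. pullback V (\<sigma> n) z - stepping M (pullback V (\<sigma> n)) Q z)" by blast
  from this(2) obtain Q where Q: "\<And>n. fpart (Q n)" and
    QV: "\<And>n. cut_norm M (\<lambda>z. stepping M (pullback V (\<sigma> n)) (Q n) z - V z) \<le> a n + d n" and
    XQ: "\<And>n. cut_norm M (\<lambda>z. X n z - stepping M (X n) (P n) z)
        \<le> 2 * a n + cut_norm M (\<lambda>z. pullback V (\<sigma> n) z - stepping M (pullback V (\<sigma> n)) (Q n) z)"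
    unfolding choice_iff by blast
  define Z where "Z n = stepping M (pullback V (\<sigma> n)) (Q n)" for n
  note bV\<sigma> = pullback_bounded_kernel[OF \<sigma> bV]
  have bZ: "bounded_kernel 1 (Z n)" for n unfolding Z_def by (rule stepping_bounded_kernel[OF Q bV\<sigma>])
  have "(\<lambda>n. a n + d n) \<longlonglongrightarrow> 0" using tendsto_add[OF a0 d0] by simp
  then have "(\<lambda>n. cut_norm M (\<lambda>z. Z n z - V z)) \<longlonglongrightarrow> 0"
    by (rule tendsto_zero_squeeze[OF cut_norm_nonneg[OF bounded_kernel_diff[OF bZ bV]] QV[folded Z_def]])
  then have weakZ: "weak_star_conv M Z V" by (rule cut_norm_imp_weak_star[OF bZ bV])
  have "(\<integral>z. (Z n z)\<^sup>2 \<partial>N) \<le> (\<integral>z. (V z)\<^sup>2 \<partial>N)" for n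
    using stepping_square_le[OF Q bV\<sigma>, of n n] by (simp add: Z_def square_pullback[OF \<sigma> bV])
  then have L2: "(\<lambda>n. \<integral>z. (V z - Z n z)\<^sup>2 \<partial>N) \<longlonglongrightarrow> 0"
    by (rule weak_star_square_imp_L2[OF weakZ bZ bV])
  \<comment> \<open>By Pythagoras, the squared distance of the rearranged \<open>V\<close> from
    \<open>Z n\<close> is the loss of norm; the expansion of the square of \<open>V - Z n\<close>
    rewrites this loss through quantities with known limits.\<close>
  have "(\<lambda>n. 2 * ((\<integral>z. (V z)\<^sup>2 \<partial>N) - (\<integral>z. V z * Z n z \<partial>N)) - (\<integral>z. (V z - Z n z)\<^sup>2 \<partial>N))
      \<longlonglongrightarrow> 2 * ((\<integral>z. (V z)\<^sup>2 \<partial>N) - (\<integral>z. V z * V z \<partial>N)) - 0"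
    by (intro tendsto_intros weak_star_integral_mult[OF weakZ bZ bV bV] L2)
  moreover have "(\<integral>z. (pullback V (\<sigma> n) z - Z n z)\<^sup>2 \<partial>N)
      = 2 * ((\<integral>z. (V z)\<^sup>2 \<partial>N) - (\<integral>z. V z * Z n z \<partial>N)) - (\<integral>z. (V z - Z n z)\<^sup>2 \<partial>N)" for n
    using stepping_pythagoras[OF Q bV\<sigma>, of n n] integral_diff_square[OF bV bZ, of n]
    by (simp add: Z_def square_pullback[OF \<sigma> bV])
  ultimately have "(\<lambda>n. \<integral>z. (pullback V (\<sigma> n) z - Z n z)\<^sup>2 \<partial>N) \<longlonglongrightarrow> 0"
    by (simp add: power2_eq_square)
  then have "(\<lambda>n. cut_norm M (\<lambda>z. pullback V (\<sigma> n) z - Z n z)) \<longlonglongrightarrow> 0"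
    by (rule square_imp_cut_norm_limit[OF bounded_kernel_diff[OF bV\<sigma> bZ]])
  then have "(\<lambda>n. 2 * a n + cut_norm M (\<lambda>z. pullback V (\<sigma> n) z - Z n z)) \<longlonglongrightarrow> 2 * 0 + 0"
    by (intro tendsto_intros a0)
  then have "(\<lambda>n. 2 * a n + cut_norm M (\<lambda>z. pullback V (\<sigma> n) z - Z n z)) \<longlonglongrightarrow> 0" by simp
  then show ?thesis
    by (rule tendsto_zero_squeeze[OF cut_norm_nonneg[OF bounded_kernel_diff[OF bX bXP]] XQ[folded Z_def]])
qed

text \<open>The cut distance is an infimum over bijections, so the given ones bound it from
  above.\<close>

lemma parameter_limit:
  assumes cont: "cut_dist_continuous M \<theta>" and X: "\<And>n. X n \<in> graphons M" and V: "V \<in> graphons M"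
    and \<pi>: "\<And>n. \<pi> n \<in> mp_bijections M"
    and lim: "(\<lambda>n. cut_norm M (\<lambda>z. pullback (X n) (\<pi> n) z - V z)) \<longlonglongrightarrow> 0"
  shows "(\<lambda>n. \<theta> (X n)) \<longlonglongrightarrow> \<theta> V"
proof (rule LIMSEQ_I)
  fix e :: real assume "0 < e"
  then obtain d where d: "0 < d" "\<And>U. U \<in> graphons M \<Longrightarrow> cut_dist M V U < d \<Longrightarrow> \<bar>\<theta> U - \<theta> V\<bar> < e"
    using cont V unfolding cut_dist_continuous_def by blast
  note bX = graphon_bounded_kernel[OF X] and bV = graphon_bounded_kernel[OF V]
  have le: "cut_dist M V (X n) \<le> cut_norm M (\<lambda>z. pullback (X n) (\<pi> n) z - V z)" for n
  proof -
    have "cut_dist M V (X n) \<le> cut_norm M (\<lambda>z. V z - pullback (X n) (\<pi> n) z)"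
      unfolding cut_dist_def
    proof (rule cINF_lower)
      show "bdd_below ((\<lambda>\<phi>. cut_norm M (\<lambda>z. V z - pullback (X n) \<phi> z)) ` mp_bijections M)"
        by (rule bdd_belowI2[where m = 0])
          (rule cut_norm_nonneg[OF bounded_kernel_diff[OF bV pullback_bounded_kernel[OF _ bX]]])
    qed (rule \<pi>)
    then show ?thesis unfolding cut_norm_minus_commute[OF bV pullback_bounded_kernel[OF \<pi> bX]] .
  qed
  have "\<forall>\<^sub>F n in sequentially. cut_norm M (\<lambda>z. pullback (X n) (\<pi> n) z - V z) < d"
    by (rule order_tendstoD(2)[OF lim d(1)])
  then have "\<forall>\<^sub>F n in sequentially. norm (\<theta> (X n) - \<theta> V) < e"
  proof eventually_elim
    case (elim n)
    then show ?case using d(2)[OF X] le[of n] by simp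
  qed
  then show "\<exists>no. \<forall>n\<ge>no. norm (\<theta> (X n) - \<theta> V) < e" by (simp add: eventually_sequentially)
qed

section \<open>Contradiction along a sequence of counterexamples\<close>

lemma fpart_finite_partition: "finite_partition M P \<Longrightarrow> fpart P"
  unfolding finite_partition_def fpart_def partition_on_def by simp

lemma fpart_split_by:
  assumes P: "fpart P" and X: "X \<in> events"
  shows "fpart (split_by P X)"
  unfolding fpart_def
proof (intro conjI)
  show "finite (split_by P X)" using fpart_finite[OF P] by (simp add: split_by_def)
  show "split_by P X \<subseteq> events" using fpart_events[OF P] X by (auto simp: split_by_def)
  have "\<Union> (split_by P X) = \<Union> P" unfolding split_by_def by blast
  then show "\<Union> (split_by P X) = space M" using P by (simp add: fpart_def)
  show "disjoint (split_by P X)"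
    unfolding disjoint_def
  proof (intro ballI impI)
    fix A B assume "A \<in> split_by P X" "B \<in> split_by P X" "A \<noteq> B"
    then obtain C D where CD: "C \<in> P" "D \<in> P" "A = C \<inter> X \<or> A = C - X" "B = D \<inter> X \<or> B = D - X"
      by (auto simp: split_by_def)
    show "A \<inter> B = {}"
    proof (cases "C = D")
      case True
      then show ?thesis using CD \<open>A \<noteq> B\<close> by blast
    next
      case False
      then have "C \<inter> D = {}" using fpart_unique[OF P CD(1,2)] by blast
      then show ?thesis using CD(3,4) by blast
    qed
  qed
qed

lemma split_by_uniform_increment:
  assumes ident: "cut_dist_identifying M \<theta>" and cont: "cut_dist_continuous M \<theta>" and \<epsilon>: "0 < \<epsilon>"
  shows "\<exists>b>0. \<forall>W P X. W \<in> graphons M \<longrightarrow> finite_partition M P \<longrightarrow> X \<in> sets M \<longrightarrow>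
    \<bar>rect_integral M X X (\<lambda>z. W z - stepping M W P z)\<bar> > \<epsilon> / 4 \<longrightarrow>
    \<theta> (stepping M W (split_by P X)) > \<theta> (stepping M W P) + b"
proof (rule ccontr)
  assume "\<not> ?thesis"
  then have ex: "\<exists>W P X. W \<in> graphons M \<and> finite_partition M P \<and> X \<in> sets M \<and>
    \<bar>rect_integral M X X (\<lambda>z. W z - stepping M W P z)\<bar> > \<epsilon> / 4 \<and>
    \<theta> (stepping M W (split_by P X)) \<le> \<theta> (stepping M W P) + b" if "b > 0" for b
    using that unfolding not_less[symmetric] by blast
  have "\<exists>t. \<forall>n. case t n of (W, P, X) \<Rightarrow> W \<in> graphons M \<and> finite_partition M P \<and> X \<in> sets M \<and>
    \<bar>rect_integral M X X (\<lambda>z. W z - stepping M W P z)\<bar> > \<epsilon> / 4 \<and>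
    \<theta> (stepping M W (split_by P X)) \<le> \<theta> (stepping M W P) + 1 / real (Suc n)"
    using ex[of "1 / real (Suc n)" for n] by (intro choice allI) simp
  then obtain t where t: "\<And>n. case t n of (W, P, X) \<Rightarrow> W \<in> graphons M \<and> finite_partition M P \<and> X \<in> sets M \<and>
    \<bar>rect_integral M X X (\<lambda>z. W z - stepping M W P z)\<bar> > \<epsilon> / 4 \<and>
    \<theta> (stepping M W (split_by P X)) \<le> \<theta> (stepping M W P) + 1 / real (Suc n)" by blast
  define W where "W n = fst (t n)" for n
  define P where "P n = fst (snd (t n))" for n
  define X where "X n = snd (snd (t n))" for n
  have W: "W n \<in> graphons M" and fP: "finite_partition M (P n)" and X: "X n \<in> events" and
    big: "\<bar>rect_integral M (X n) (X n) (\<lambda>z. W n z - stepping M (W n) (P n) z)\<bar> > \<epsilon> / 4" and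
    small: "\<theta> (stepping M (W n) (split_by (P n) (X n))) \<le> \<theta> (stepping M (W n) (P n)) + 1 / real (Suc n)" for n
    using t[of n] by (simp_all add: W_def P_def X_def split_beta)
  note bW = graphon_bounded_kernel[OF W]
  have P: "fpart (P n)" for n by (rule fpart_finite_partition[OF fP])
  define S where "S n = split_by (P n) (X n)" for n
  have S: "fpart (S n)" for n unfolding S_def by (rule fpart_split_by[OF P X])
  define Y where "Y n = stepping M (W n) (S n)" for n
  have Y: "Y n \<in> graphons M" for n unfolding Y_def by (rule stepping_graphon[OF S W])
  note bY = graphon_bounded_kernel[OF Y]
  \<comment> \<open>\<open>S n\<close> refines \<open>P n\<close>, so averaging \<open>Y n\<close>
    further over \<open>P n\<close> gives the averages of \<open>W n\<close>.\<close>
  have coarse: "stepping M (Y n) (P n) = stepping M (W n) (P n)" for n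
    unfolding Y_def
  proof (rule stepping_stepping[OF P S bW])
    fix C D assume C: "C \<in> P n" and "D \<in> S n"
    then obtain C' where C': "C' \<in> P n" "D \<subseteq> C'" by (auto simp: S_def split_by_def)
    show "D \<subseteq> C \<or> D \<inter> C = {}"
      using fpart_unique[OF P C C'(1)] C'(2) by blast
  qed
  note YP = stepping_graphon[OF P Y]
  \<comment> \<open>\<open>X n\<close> is a union of cells of \<open>S n\<close>, so replacing
    \<open>W n\<close> by \<open>Y n\<close> does not change the integral over
    \<open>X n \<times> X n\<close>.\<close>
  have gap: "\<epsilon> / 4 < cut_norm M (\<lambda>z. Y n z - stepping M (Y n) (P n) z)" for n
  proof -
    have "rect_integral M (X n) (X n) (Y n) = rect_integral M (X n) (X n) (W n)"
      unfolding Y_def by (rule rect_integral_stepping_compat[OF S bW X X]) (auto simp: S_def split_by_def)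
    then have "rect_integral M (X n) (X n) (\<lambda>z. Y n z - stepping M (Y n) (P n) z)
        = rect_integral M (X n) (X n) (\<lambda>z. W n z - stepping M (W n) (P n) z)"
      using rect_integral_diff[OF bY stepping_bounded_kernel[OF P bY] X X, of n n n n n]
        rect_integral_diff[OF bW stepping_bounded_kernel[OF P bW] X X, of n n n n n]
      by (simp add: coarse)
    then show ?thesis
      using big[of n] rect_le_cut_norm[OF bounded_kernel_diff[OF bY stepping_bounded_kernel[OF P bY]] X X, of n n n n n]
      by simp
  qed
  obtain r1 V \<pi> where r1: "strict_mono (r1 :: nat \<Rightarrow> nat)" and V: "V \<in> graphons M" and \<pi>: "\<And>n. \<pi> n \<in> mp_bijections M"
    and limV: "(\<lambda>n. cut_norm M (\<lambda>z. pullback (Y (r1 n)) (\<pi> n) z - V z)) \<longlonglongrightarrow> 0"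
    by (rule graphon_compactness[of Y, OF Y]) (rule that)
  \<comment> \<open>The second extraction runs along the first subsequence. The bijections
    \<open>\<pi>\<close> and \<open>\<rho>\<close> are unrelated, which is why averages have to be
    transferred from one arrangement to the other.\<close>
  obtain r2 U \<rho> where r2: "strict_mono (r2 :: nat \<Rightarrow> nat)" and U: "U \<in> graphons M" and \<rho>: "\<And>n. \<rho> n \<in> mp_bijections M"
    and limU: "(\<lambda>n. cut_norm M (\<lambda>z. pullback (stepping M (Y (r1 (r2 n))) (P (r1 (r2 n)))) (\<rho> n) z - U z)) \<longlonglongrightarrow> 0"
    by (rule graphon_compactness[of "\<lambda>n. stepping M (Y (r1 n)) (P (r1 n))", OF YP]) (rule that)
  define r where "r n = r1 (r2 n)" for n
  have r: "strict_mono r" using strict_mono_o[OF r1 r2] by (simp add: r_def[abs_def] comp_def)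
  have limV': "(\<lambda>n. cut_norm M (\<lambda>z. pullback (Y (r n)) (\<pi> (r2 n)) z - V z)) \<longlonglongrightarrow> 0"
    using LIMSEQ_subseq_LIMSEQ[OF limV r2] by (simp add: comp_def r_def)
  have limU': "(\<lambda>n. cut_norm M (\<lambda>z. pullback (stepping M (Y (r n)) (P (r n))) (\<rho> n) z - U z)) \<longlonglongrightarrow> 0"
    using limU by (simp add: r_def)
  have "\<theta> V \<le> \<theta> U"
  proof (rule LIMSEQ_le)
    show "(\<lambda>n. \<theta> (Y (r n))) \<longlonglongrightarrow> \<theta> V" by (rule parameter_limit[OF cont Y V \<pi> limV'])
    have "(\<lambda>n. 1 / real (Suc n)) \<longlonglongrightarrow> 0"
      using LIMSEQ_inverse_real_of_nat by (simp add: inverse_eq_divide)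
    from LIMSEQ_subseq_LIMSEQ[OF this r] have "(\<lambda>n. 1 / real (Suc (r n))) \<longlonglongrightarrow> 0" by (simp add: comp_def)
    then show "(\<lambda>n. \<theta> (stepping M (Y (r n)) (P (r n))) + 1 / real (Suc (r n))) \<longlonglongrightarrow> \<theta> U"
      using tendsto_add[OF parameter_limit[OF cont YP U \<rho> limU']] by fastforce
    show "\<exists>n0. \<forall>n\<ge>n0. \<theta> (Y (r n)) \<le> \<theta> (stepping M (Y (r n)) (P (r n))) + 1 / real (Suc (r n))"
      unfolding coarse unfolding Y_def S_def using small by blast
  qed
  moreover have "struct_less M U V"
    unfolding struct_less_def struct_le_def
  proof
    have "U \<in> envelope M V" by (rule limit_in_envelope[OF Y V U P \<pi> \<rho> limV' limU'])
    then show "envelope M U \<subseteq> envelope M V" using envelope_trans[OF V] by blast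
    show "\<not> envelope M V \<subseteq> envelope M U"
    proof
      assume "envelope M V \<subseteq> envelope M U"
      then have "V \<in> envelope M U" using envelope_refl[OF V] by blast
      from averaging_asymptotically_trivial[OF Y V U P \<pi> \<rho> limV' limU' this]
      have "(\<lambda>n. cut_norm M (\<lambda>z. Y (r n) z - stepping M (Y (r n)) (P (r n)) z)) \<longlonglongrightarrow> 0" .
      then have "\<epsilon> / 4 \<le> 0"
        by (rule LIMSEQ_le_const) (use gap less_imp_le in blast)
      then show False using \<epsilon> by simp
    qed
  qed
  then have "\<theta> U < \<theta> V" using ident U V unfolding cut_dist_identifying_def by blast
  ultimately show False by simp
qed

end

theorem proposition3p11:
  fixes M :: "'a measure" and \<theta> :: "('a \<times> 'a \<Rightarrow> real) \<Rightarrow> real"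
  assumes "prob_space M" and "standard_borel M" and "atomless M"
    and "graphon_parameter M \<theta>"
    and "cut_dist_identifying M \<theta>"
    and "cut_dist_continuous M \<theta>"
  shows "\<forall>\<epsilon>>0. \<exists>b>0. \<forall>W P X.
           W \<in> graphons M \<longrightarrow> finite_partition M P \<longrightarrow> X \<in> sets M \<longrightarrow>
           \<bar>rect_integral M X X (\<lambda>z. W z - stepping M W P z)\<bar> > \<epsilon> / 4 \<longrightarrow>
           \<theta> (stepping M W (split_by P X)) > \<theta> (stepping M W P) + b"
proof -
  interpret prob_space M by fact
  obtain c :: "'a \<Rightarrow> real" and g where c: "c \<in> borel_measurable M" and g: "g \<in> measurable borel M"
    and "\<forall>x\<in>space M. g (c x) = x"
    using standard_borel_real_code[OF assms(2) not_empty] by blast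
  then have gc: "g (c x) = x" if "x \<in> space M" for x using that by simp
  \<comment> \<open>A singleton is a fibre of the code, hence measurable; its only subsets are
    itself and the empty set, so \<open>atomless\<close> leaves it no mass.\<close>
  have "prob {x} = 0" if x: "x \<in> space M" for x
  proof (rule ccontr)
    have "{x} = c -` {c x} \<inter> space M"
    proof
      show "{x} \<subseteq> c -` {c x} \<inter> space M" using x by simp
      show "c -` {c x} \<inter> space M \<subseteq> {x}"
      proof
        fix y assume "y \<in> c -` {c x} \<inter> space M"
        then have "c y = c x" "y \<in> space M" by auto
        then have "y = x" using gc[of y] gc[of x] x by metis
        then show "y \<in> {x}" by simp
      qed
    qed
    moreover have "c -` {c x} \<inter> space M \<in> events" using c by measurable
    ultimately have "{x} \<in> events" by simp
    moreover assume "prob {x} \<noteq> 0"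
    ultimately have "\<exists>B\<in>events. B \<subseteq> {x} \<and> 0 < prob B \<and> prob B < prob {x}"
      using assms(3) unfolding atomless_def zero_less_measure_iff by blast
    then obtain B where "B \<subseteq> {x}" and B: "0 < prob B" "prob B < prob {x}" by blast
    then consider "B = {}" | "B = {x}" by blast
    then show False by cases (use B in simp_all)
  qed
  then interpret atomless_space M c g
    using c g gc by unfold_locales
  show ?thesis using split_by_uniform_increment[OF assms(5,6)] by blast
qed

end
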